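(* For all $u,v,w\in S_n$, the generating function $$P_{u,v,w}(t) \,:=\, \sum_{N=1}^\infty c_{N*u,N*v}^{N*w}\, t^N$$ is a rational function of $t$. Moreover, the function $f_{u,v,w}:\mathbb{N}_{\ge1}\to\mathbb{N}$, $f_{u,v,w}(N):=c_{N*u,N*v}^{N*w}$, is eventually quasi-polynomial.
   Context: $S_n$ is the symmetric group on $[n]=\{1,\dots,n\}$. It embeds in $S_{n+1}$ by letting permutations fix $n+1$, and $S_\infty=\bigcup_n S_n$. For $w_0=(n,n-1,\dots,1)\in S_n$, put $\mathfrak S_{w_0}=x_1^{n-1}x_2^{n-2}\cdots x_{n-1}$. Whenever $w(i)<w(i+1)$, put $\mathfrak S_w=\partial_i\mathfrak S_{ws_i}$, where $s_i$ is the simple transposition $(i,i+1)$ and $\partial_i f=(f-s_if)/(x_i-x_{i+1})$, with $s_i$ acting on polynomials by swapping $x_i$ and $x_{i+1}$. These Schubert polynomials are compatible with the embeddings $S_n\subset S_{n+1}$ and form a $\mathbb Z$-basis of $\mathbb Z[x_1,x_2,\dots]$. The Schubert coefficients $c_{u,v}^w$ ($u,v,w\in S_\infty$) are defined by $\mathfrak S_u\mathfrak S_v=\sum_{w}c_{u,v}^w\mathfrak S_w$. Lehmer code: for $w\in S_n$ and $i\in[n]$, let $c_i(w)=|\{j>i: w(j)<w(i)\}|$ and $\mathrm{code}(w)=(c_1(w),\dots,c_n(w))$. The code determines $w\in S_\infty$ uniquely. For an integer $N\ge1$ and $w\in S_n$, $N*w\in S_{Nn}$ is the unique permutation whose Lehmer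 code is $(Nc_1(w),\dots,Nc_n(w),0,\dots,0)$. A function $f:\mathbb N_{\ge1}\to\mathbb N$ is eventually quasi-polynomial if there exist integers $m,M\ge1$ and polynomials $g_0,\dots,g_{m-1}$ such that $f(N)=g_i(N)$ for all $N\ge M$ with $N\equiv i\pmod m$. *)

theory Defs
  imports
    "HOL-Library.Poly_Mapping"
    "HOL-Combinatorics.Permutations"
    "HOL-Computational_Algebra.Polynomial_FPS"
begin

(* A permutation in S_n is a function w on nat with "w permutes {1..n}"; such a function fixes
   everything outside {1..n}, so the embedding of S_n into S_(n+1) is an inclusion of sets. *)
definition S_infinity :: "(nat \<Rightarrow> nat) set" where
  "S_infinity = {w. \<exists>n. w permutes {1..n}}"

abbreviation simple_transposition :: "nat \<Rightarrow> nat \<Rightarrow> nat" where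
  "simple_transposition i \<equiv> transpose i (Suc i)"

definition longest_perm :: "nat \<Rightarrow> nat \<Rightarrow> nat" where
  "longest_perm n i = (if i \<in> {1..n} then n + 1 - i else i)"

(* Z[x_1, x_2, ...]: finitely supported maps from exponent vectors to integers, with the
   convolution product. The index type also provides a variable x_0, which is never used. *)
type_synonym ipoly = "(nat \<Rightarrow>\<^sub>0 nat) \<Rightarrow>\<^sub>0 int"

definition X :: "nat \<Rightarrow> ipoly" where
  "X i = Poly_Mapping.single (Poly_Mapping.single i 1) 1"

(* s_i is an involution, so precomposing exponent vectors with it is the same as swapping
   x_i and x_(i+1). *)
definition swap_vars :: "nat \<Rightarrow> ipoly \<Rightarrow> ipoly" where
  "swap_vars i f =
     Poly_Mapping.map_key (Poly_Mapping.map_key (simple_transposition i)) f"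

(* The quotient (f - s_i f) / (x_i - x_(i+1)), which is exact in the polynomial ring. *)
definition divided_difference :: "nat \<Rightarrow> ipoly \<Rightarrow> ipoly" where
  "divided_difference i f = (THE g. (X i - X (Suc i)) * g = f - swap_vars i f)"

(* The two defining rules, for all n at once. That they assign exactly one polynomial to each
   w in S_infinity is the well-definedness of Schubert polynomials, including their
   compatibility with the embeddings of S_n into S_(n+1). *)
inductive is_schubert :: "(nat \<Rightarrow> nat) \<Rightarrow> ipoly \<Rightarrow> bool" where
  longest: "is_schubert (longest_perm n) (\<Prod>i\<in>{1..n}. X i ^ (n - i))"
| ascent: "1 \<le> i \<Longrightarrow> w i < w (Suc i) \<Longrightarrow> is_schubert (w \<circ> simple_transposition i) f
    \<Longrightarrow> is_schubert w (divided_difference i f)"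

definition schubert :: "(nat \<Rightarrow> nat) \<Rightarrow> ipoly" where
  "schubert w = (THE f. is_schubert w f)"

(* The finitely supported family of coefficients c_(u,v)^w, w in S_infinity. *)
definition schubert_expansion ::
    "(nat \<Rightarrow> nat) \<Rightarrow> (nat \<Rightarrow> nat) \<Rightarrow> (nat \<Rightarrow> nat) \<Rightarrow>\<^sub>0 int" where
  "schubert_expansion u v =
     (THE c. Poly_Mapping.keys c \<subseteq> S_infinity \<and>
        schubert u * schubert v =
          (\<Sum>w\<in>Poly_Mapping.keys c. of_int (Poly_Mapping.lookup c w) * schubert w))"

definition schubert_coeff ::
    "(nat \<Rightarrow> nat) \<Rightarrow> (nat \<Rightarrow> nat) \<Rightarrow> (nat \<Rightarrow> nat) \<Rightarrow> int" where
  "schubert_coeff u v w = Poly_Mapping.lookup (schubert_expansion u v) w"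

(* For w in S_n and i in [n], indices j > n satisfy w j = j > w i, so j need not be bounded. *)
definition lehmer_code :: "(nat \<Rightarrow> nat) \<Rightarrow> nat \<Rightarrow> nat" where
  "lehmer_code w i = card {j. i < j \<and> w j < w i}"

(* N * w for w in S_n. *)
definition stretch :: "nat \<Rightarrow> nat \<Rightarrow> (nat \<Rightarrow> nat) \<Rightarrow> nat \<Rightarrow> nat" where
  "stretch n N w =
     (THE v. v permutes {1..N * n} \<and>
        (\<forall>i\<in>{1..N * n}. lehmer_code v i = (if i \<le> n then N * lehmer_code w i else 0)))"

definition is_rational_fps :: "'a::field fps \<Rightarrow> bool" where
  "is_rational_fps F \<longleftrightarrow> (\<exists>p q. q \<noteq> 0 \<and> fps_of_poly q * F = fps_of_poly p)"

(* Only the values of f at positive integers matter; natural-valued functions are the special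
   case of a nonnegative f. Polynomials with rational coefficients
   suffice: a polynomial taking integer values at infinitely many integers is rational. *)
definition eventually_quasi_polynomial :: "(nat \<Rightarrow> int) \<Rightarrow> bool" where
  "eventually_quasi_polynomial f \<longleftrightarrow>
     (\<exists>m M (g :: nat \<Rightarrow> rat poly). 1 \<le> m \<and> 1 \<le> M \<and>
        (\<forall>i<m. \<forall>N\<ge>M. N mod m = i \<longrightarrow> of_int (f N) = poly (g i) (of_nat N)))"

end

theory Submission
  imports Defs
begin

text \<open>
  The code of \<open>N * w\<close> is supported on the first \<open>n\<close> positions and affine in \<open>N\<close>, so for large \<open>N\<close>
  every comparison between its entries is constant in \<open>N\<close>. Sorting the code into decreasing order by
  the rule \<open>(.., a, b, ..) \<mapsto> (.., b + 1, a, ..)\<close> for \<open>a \<le> b\<close> therefore writes the Schubert polynomial of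
  \<open>N * w\<close> as one fixed composition of divided differences applied to a monomial whose exponents are
  affine in \<open>N\<close>. Dually, the functional extracting the coefficient of the Schubert polynomial of \<open>w\<close> is
  the constant term of the divided difference indexed by \<open>w\<close>. Sorting the code into increasing
  order makes the last entry \<open>k\<close> maximal, and then expanding in the complete homogeneous polynomials
  \<open>h_j(x_1, .., x_n)\<close> over the polynomials in \<open>x_1, .., x_(n-1)\<close> turns the functional into
  extraction of the coefficients of \<open>x_n^k, x_n^(k+1), ..\<close> followed by the functional
  for \<open>n - 1\<close> variables. Hence the stretched Schubert coefficient arises from affine monomials by a fixed number of
  bounded summations over affine ranges and affine substitutions, and the functions built from linear
  forms, congruence conditions and linear inequalities are closed under these operations.
\<close>

subsection \<open>Permutations and simple transpositions\<close>

text \<open>The length of N * w grows linearly in N, so the recursions that define Schubert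
  polynomials and coefficient functionals use a number of divided differences that is unbounded in
  N, whereas piecewise quasi-polynomial arrays survive only a number of operations independent of N.
  Sorting touches the first n positions only and takes at most n * n steps. It stops exactly where
  the unbounded remainder collapses: a weakly decreasing code gives a monomial, and a maximal last
  entry k gives a chain of k divided differences, each of which lowers j in h_j by one and adjoins a
  variable, so that a single j survives. Each sorting step adds or subtracts 1, hence codes with
  constant terms must be allowed although those of N * w are pure multiples of N. The finitely many
  N for which comparisons are not yet settled change the generating function only by a
  polynomial.\<close>

abbreviation s :: "nat \<Rightarrow> nat \<Rightarrow> nat" where "s \<equiv> simple_transposition"

lemma s_simps [simp]: "s i i = Suc i" "s i (Suc i) = i" "s i (s i j) = j"
  by (auto simp: transpose_def)

lemma s_other: "j \<noteq> i \<Longrightarrow> j \<noteq> Suc i \<Longrightarrow> s i j = j"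
  by (auto simp: transpose_def)

lemma comp_s_cancel [simp]: "w \<circ> s i \<circ> s i = w"
  by (auto simp: fun_eq_iff)

lemma permutes_comp_s:
  assumes "w permutes {1..m}" "1 \<le> i" "i < m"
  shows "w \<circ> s i permutes {1..m}"
proof -
  have "s i permutes {1..m}" using assms(2,3) by (intro permutes_swap_id) auto
  from permutes_compose[OF this assms(1)] show ?thesis .
qed

lemma permutes_mono: "w permutes {1..m::nat} \<Longrightarrow> m \<le> m' \<Longrightarrow> w permutes {1..m'}"
  by (erule permutes_subset) auto

lemma S_infinity_eventually:
  assumes "w \<in> S_infinity" obtains m where "w permutes {1..m}" "m \<ge> k"
proof -
  obtain m where "w permutes {1..m}" using assms by (auto simp: S_infinity_def)
  hence "w permutes {1..max m k}" by (rule permutes_mono) simp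
  thus ?thesis using that[of "max m k"] by simp
qed

lemma S_infinity_comp_s: assumes "w \<in> S_infinity" "1 \<le> i" shows "w \<circ> s i \<in> S_infinity"
proof -
  obtain m where "w permutes {1..m}" "m \<ge> Suc i" using S_infinity_eventually assms(1) by blast
  thus ?thesis unfolding S_infinity_def using permutes_comp_s[of w m i] assms(2) by auto
qed

lemma permutes_in_S_infinity: "w permutes {1..m} \<Longrightarrow> w \<in> S_infinity"
  by (auto simp: S_infinity_def)

lemma id_in_S_infinity [simp]: "id \<in> S_infinity"
  by (auto simp: S_infinity_def permutes_id)

lemma S_infinity_inj: "w \<in> S_infinity \<Longrightarrow> inj w"
  by (auto simp: S_infinity_def permutes_inj)

lemma S_infinity_zero: "w \<in> S_infinity \<Longrightarrow> w 0 = 0"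
  by (auto simp: S_infinity_def permutes_def)

lemma S_infinity_neq: "w \<in> S_infinity \<Longrightarrow> i \<noteq> j \<Longrightarrow> w i \<noteq> w j"
  by (meson S_infinity_inj injD)

text \<open>A strictly increasing \<open>w\<close> satisfies \<open>j \<le> w j\<close>, so the
  preimage of \<open>i\<close> lies at or below \<open>i\<close>; by strong induction the smaller
  points are already taken by their own values.\<close>

lemma increasing_S_infinity_is_id:
  assumes w: "w \<in> S_infinity" and inc: "\<And>i. 1 \<le> i \<Longrightarrow> w i < w (Suc i)"
  shows "w = id"
proof -
  have "w 0 < w 1" using S_infinity_zero[OF w] S_infinity_neq[OF w, of 0 1] by simp
  hence "w i < w (Suc i)" for i using inc[of i] by (cases i) auto
  hence sm: "strict_mono w" by (simp add: strict_mono_Suc_iff)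
  obtain m where m: "w permutes {1..m}" using w by (auto simp: S_infinity_def)
  have "w i = i" for i
  proof (induction i rule: less_induct)
    case (less i)
    obtain j where j: "w j = i" using permutes_surj[OF m] by (metis surjD)
    have "j \<le> i" using strict_mono_imp_increasing[OF sm, of j] j by simp
    thus ?case using less.IH[of j] j by (cases "j = i") auto
  qed
  thus ?thesis by auto
qed

lemma obtain_descent:
  assumes "w \<in> S_infinity" "w \<noteq> id"
  obtains i where "1 \<le> i" "w (Suc i) < w i"
  using increasing_S_infinity_is_id[OF assms(1)] assms(2) S_infinity_neq[OF assms(1)]
  by (metis n_not_Suc_n nat_neq_iff)

lemma descent_bound:
  assumes "w permutes {1..m}" "w (Suc i) < w i" shows "1 \<le> i" "i < m"
proof -
  show "1 \<le> i" using assms permutes_not_in[of w "{1..m}" 0] by (cases i) auto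
  show "i < m"
  proof (rule ccontr)
    assume "\<not> i < m"
    hence "w (Suc i) = Suc i" "i > m \<Longrightarrow> w i = i" "i = m \<Longrightarrow> w i \<le> m"
      using assms(1) \<open>1 \<le> i\<close> permutes_not_in[OF assms(1)] permutes_in_image[OF assms(1), of m] by auto
    thus False using assms(2) \<open>\<not> i < m\<close> by (cases "i = m") auto
  qed
qed

subsection \<open>Lehmer codes\<close>

lemma finite_lehmer: assumes "w \<in> S_infinity" shows "finite {j. i < j \<and> w j < w i}"
proof -
  have "finite (w -` {..<w i})" by (intro finite_vimageI S_infinity_inj assms) auto
  thus ?thesis by (rule rev_finite_subset) auto
qed

text \<open>This is the sorting rule for codes: precomposing with \<open>s i\<close> at an ascent
  exchanges the two entries and creates a single new inversion, the pair
  \<open>(i, Suc i)\<close>.\<close>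

lemma lehmer_code_comp_s:
  assumes w: "w \<in> S_infinity" and lt: "w i < w (Suc i)"
  shows "lehmer_code (w \<circ> s i) =
           (lehmer_code w)(i := Suc (lehmer_code w (Suc i)), Suc i := lehmer_code w i)"
proof
  fix l
  let ?v = "w \<circ> s i"
  have im: "{j. l < j \<and> ?v j < ?v l} = s i ` {j. l < s i j \<and> w j < w (s i l)}"
  proof (intro set_eqI iffI)
    fix j assume "j \<in> {j. l < j \<and> ?v j < ?v l}"
    hence "s i j \<in> {j. l < s i j \<and> w j < w (s i l)}" by simp
    from imageI[OF this, of "s i"] show "j \<in> s i ` {j. l < s i j \<and> w j < w (s i l)}" by simp
  qed auto
  have card: "lehmer_code ?v l = card {j. l < s i j \<and> w j < w (s i l)}"
    unfolding lehmer_code_def im by (rule card_image, rule inj_on_inverseI[of _ "s i"]) simp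
  consider "l = i" | "l = Suc i" | "l \<noteq> i" "l \<noteq> Suc i" by auto
  then show "lehmer_code ?v l =
      ((lehmer_code w)(i := Suc (lehmer_code w (Suc i)), Suc i := lehmer_code w i)) l"
  proof cases
    case 1
    have "{j. l < s i j \<and> w j < w (s i l)} = insert i {j. Suc i < j \<and> w j < w (Suc i)}"
      using 1 lt by (auto simp: transpose_def split: if_splits)
    thus ?thesis unfolding card using 1 finite_lehmer[OF w, of "Suc i"] by (auto simp: lehmer_code_def)
  next
    case 2
    have "{j. l < s i j \<and> w j < w (s i l)} = {j. i < j \<and> w j < w i}"
      using 2 lt by (auto simp: transpose_def split: if_splits)
    thus ?thesis unfolding card using 2 by (auto simp: lehmer_code_def)
  next
    case 3
    have "{j. l < s i j \<and> w j < w (s i l)} = {j. l < j \<and> w j < w l}"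
      using 3 by (auto simp: transpose_def split: if_splits)
    thus ?thesis unfolding card using 3 by (auto simp: lehmer_code_def)
  qed
qed

lemma lehmer_code_ascent_le:
  assumes w: "w \<in> S_infinity" and lt: "w i < w (Suc i)"
  shows "lehmer_code w i \<le> lehmer_code w (Suc i)"
  unfolding lehmer_code_def
proof (rule card_mono[OF finite_lehmer[OF w]], safe)
  fix j assume j: "i < j" "w j < w i"
  show "Suc i < j" using j lt by (metis Suc_lessI less_asym)
  show "w j < w (Suc i)" using j lt by simp
qed

lemma lehmer_code_descent_less:
  assumes w: "w \<in> S_infinity" and lt: "w (Suc i) < w i"
  shows "lehmer_code w (Suc i) < lehmer_code w i"
  unfolding lehmer_code_def using lt
  by (intro psubset_card_mono[OF finite_lehmer[OF w]]) auto

text \<open>Ascents become comparisons of code entries, which is how they are decided for all large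
  \<open>N\<close> at once when the codes are affine in \<open>N\<close>.\<close>

lemma ascent_iff_code:
  assumes w: "w \<in> S_infinity"
  shows "w i < w (Suc i) \<longleftrightarrow> lehmer_code w i \<le> lehmer_code w (Suc i)"
  using lehmer_code_ascent_le[OF w] lehmer_code_descent_less[OF w] S_infinity_neq[OF w, of i "Suc i"]
  by (meson linorder_not_le n_not_Suc_n nat_neq_iff)

lemma descent_iff_code:
  assumes w: "w \<in> S_infinity"
  shows "w (Suc i) < w i \<longleftrightarrow> lehmer_code w (Suc i) < lehmer_code w i"
  using ascent_iff_code[OF w] S_infinity_neq[OF w, of i "Suc i"]
  by (metis linorder_not_le n_not_Suc_n nat_neq_iff order_less_asym)

lemma lehmer_code_comp_s_descent:
  assumes w: "w \<in> S_infinity" and lt: "w (Suc i) < w i"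
  shows "lehmer_code (w \<circ> s i) =
           (lehmer_code w)(i := lehmer_code w (Suc i), Suc i := lehmer_code w i - 1)"
proof -
  have i: "1 \<le> i" using lt S_infinity_zero[OF w] by (cases i) auto
  let ?v = "w \<circ> s i"
  have "?v \<in> S_infinity" "?v i < ?v (Suc i)" using S_infinity_comp_s[OF w i] lt by auto
  from lehmer_code_comp_s[OF this] have "lehmer_code w =
      (lehmer_code ?v)(i := Suc (lehmer_code ?v (Suc i)), Suc i := lehmer_code ?v i)"
    unfolding comp_s_cancel .
  thus ?thesis by (simp only: fun_eq_iff fun_upd_apply) auto
qed

lemma lehmer_code_id [simp]: "lehmer_code id = (\<lambda>_. 0)"
  by (auto simp: lehmer_code_def fun_eq_iff)

lemma lehmer_code_zero: assumes "w \<in> S_infinity" shows "lehmer_code w 0 = 0"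
  using S_infinity_zero[OF assms] by (simp add: lehmer_code_def)

lemma lehmer_code_le:
  assumes "w permutes {1..m}" shows "lehmer_code w i \<le> m - i"
proof -
  have "w (j) = j" if "j > m" for j using assms that by (auto simp: permutes_def)
  moreover have "w i \<le> max m i" using assms
    by (metis atLeastAtMost_iff le_max_iff_disj permutes_in_image permutes_not_in le_refl)
  ultimately have "{j. i < j \<and> w j < w i} \<subseteq> {i<..m}"
    by (auto simp: not_le[symmetric]) (metis linorder_not_le max.absorb_iff1 max.cobounded2 less_imp_le order_less_le_trans max_def)
  from card_mono[OF _ this] show ?thesis by (simp add: lehmer_code_def)
qed

lemma lehmer_code_beyond: "w permutes {1..m} \<Longrightarrow> m \<le> i \<Longrightarrow> lehmer_code w i = 0"
  using lehmer_code_le[of w m i] by simp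

section \<open>Length and induction along descents\<close>

definition perm_length :: "(nat \<Rightarrow> nat) \<Rightarrow> nat" where
  "perm_length w = (\<Sum>i | lehmer_code w i \<noteq> 0. lehmer_code w i)"

lemma perm_length_eq: assumes "w permutes {1..m}" shows "perm_length w = (\<Sum>i<m. lehmer_code w i)"
proof -
  have "{i. lehmer_code w i \<noteq> 0} \<subseteq> {..<m}"
    using lehmer_code_beyond[OF assms] by (metis (mono_tags) linorder_not_le lessThan_iff mem_Collect_eq subsetI)
  thus ?thesis unfolding perm_length_def by (intro sum.mono_neutral_left) auto
qed

lemma perm_length_id [simp]: "perm_length id = 0" by (simp add: perm_length_def)

lemma perm_length_comp_s:
  assumes w: "w \<in> S_infinity" and i: "1 \<le> i" and lt: "w i < w (Suc i)"
  shows "perm_length (w \<circ> s i) = Suc (perm_length w)"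
proof -
  obtain m where m: "w permutes {1..m}" "m \<ge> Suc (Suc i)" using S_infinity_eventually[OF w] by blast
  have m': "w \<circ> s i permutes {1..m}" using permutes_comp_s[OF m(1) i] m(2) by auto
  have split: "(\<Sum>l<m. f l) = f i + f (Suc i) + (\<Sum>l\<in>{..<m} - {i, Suc i}. f l)" for f :: "nat \<Rightarrow> nat"
  proof -
    have "(\<Sum>l<m. f l) = (\<Sum>l\<in>{..<m} - {i, Suc i}. f l) + (\<Sum>l\<in>{i, Suc i}. f l)"
      using m(2) by (intro sum.subset_diff) auto
    thus ?thesis by simp
  qed
  have "(\<Sum>l\<in>{..<m} - {i, Suc i}. lehmer_code (w \<circ> s i) l) = (\<Sum>l\<in>{..<m} - {i, Suc i}. lehmer_code w l)"
    by (intro sum.cong) (auto simp: lehmer_code_comp_s[OF w lt])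
  thus ?thesis unfolding perm_length_eq[OF m(1)] perm_length_eq[OF m'] split
    by (simp add: lehmer_code_comp_s[OF w lt])
qed

lemma perm_length_comp_s_descent:
  assumes w: "w \<in> S_infinity" and lt: "w (Suc i) < w i"
  shows "perm_length w = Suc (perm_length (w \<circ> s i))"
proof -
  have i: "1 \<le> i" using lt S_infinity_zero[OF w] by (cases i) auto
  show ?thesis using perm_length_comp_s[OF S_infinity_comp_s[OF w i] i, unfolded comp_s_cancel] lt by simp
qed

lemma perm_length_bound: assumes "w permutes {1..m}" shows "perm_length w \<le> m * m"
proof -
  have "lehmer_code w i \<le> m" for i using lehmer_code_le[OF assms, of i] by simp
  hence "(\<Sum>i<m. lehmer_code w i) \<le> (\<Sum>i<m. m)" by (intro sum_mono) auto
  thus ?thesis using perm_length_eq[OF assms] by simp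
qed

lemma S_infinity_descent_induct [consumes 1, case_names id descent]:
  assumes "w \<in> S_infinity" and "P id"
    and step: "\<And>w i. w \<in> S_infinity \<Longrightarrow> 1 \<le> i \<Longrightarrow> w (Suc i) < w i \<Longrightarrow> P (w \<circ> s i) \<Longrightarrow> P w"
  shows "P w"
  using assms(1)
proof (induction "perm_length w" arbitrary: w rule: less_induct)
  case less
  show ?case
  proof (cases "w = id")
    case False
    then obtain i where i: "1 \<le> i" "w (Suc i) < w i" using obtain_descent less.prems by blast
    show ?thesis
      using step[OF less.prems i] less.hyps[OF _ S_infinity_comp_s[OF less.prems i(1)]]
        perm_length_comp_s_descent[OF less.prems i(2)] by simp
  qed (use assms(2) in simp)
qed

section \<open>Permutations recovered from and built from their codes\<close>

lemma lehmer_code_inj: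
  assumes "w \<in> S_infinity" "v \<in> S_infinity" "lehmer_code w = lehmer_code v"
  shows "w = v"
  using assms
proof (induction w arbitrary: v rule: S_infinity_descent_induct)
  case id
  thus ?case using increasing_S_infinity_is_id[of v] ascent_iff_code[of v]
    by (metis lehmer_code_id order_refl)
next
  case (descent w i)
  have v: "v (Suc i) < v i" using descent descent_iff_code by metis
  have "lehmer_code (w \<circ> s i) = lehmer_code (v \<circ> s i)"
    unfolding lehmer_code_comp_s_descent[OF descent(1,3)] lehmer_code_comp_s_descent[OF descent.prems(1) v]
    using descent.prems(2) by simp
  hence "w \<circ> s i = v \<circ> s i"
    by (rule descent.IH[OF S_infinity_comp_s[OF descent.prems(1) descent.hyps(2)]])
  thus ?case by (metis comp_s_cancel)
qed

text \<open>The hypotheses place the code under the staircase (m - 1, .., 1, 0). Reading the sorting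
  rule backwards at the last nonzero entry replaces (a, 0) by (0, a - 1) and lowers the
  total.\<close>

lemma code_realizable:
  fixes \<alpha> :: "nat \<Rightarrow> nat"
  assumes "\<And>i. \<alpha> i \<le> m - i" "\<alpha> 0 = 0"
  shows "\<exists>w. w permutes {1..m} \<and> lehmer_code w = \<alpha>"
  using assms
proof (induction "\<Sum>i<m. \<alpha> i" arbitrary: \<alpha> rule: less_induct)
  case less
  show ?case
  proof (cases "\<forall>i<m. \<alpha> i = 0")
    case True
    have "\<alpha> i = 0" for i using True less.prems(1)[of i] by (cases "i < m") auto
    hence "\<alpha> = (\<lambda>_. 0)" by auto
    thus ?thesis using permutes_id lehmer_code_id by metis
  next
    case False
    then obtain i0 where i0: "i0 < m" "\<alpha> i0 \<noteq> 0" by blast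
    define i where "i = (GREATEST i. \<alpha> i \<noteq> 0)"
    have bd: "\<alpha> j \<noteq> 0 \<Longrightarrow> j \<le> m" for j using less.prems(1)[of j] by (cases "j \<le> m") auto
    have nz: "\<alpha> i \<noteq> 0" unfolding i_def by (rule GreatestI_nat[of "\<lambda>i. \<alpha> i \<noteq> 0"]) (use i0 bd in auto)
    have z: "\<alpha> j = 0" if "j > i" for j
      using Greatest_le_nat[of "\<lambda>i. \<alpha> i \<noteq> 0" j m] that bd unfolding i_def by force
    have i: "1 \<le> i" "i < m" using nz less.prems(1)[of i] less.prems(2) by (cases i; auto)+
    define \<beta> where "\<beta> = \<alpha>(i := 0, Suc i := \<alpha> i - 1)"
    have si: "(\<Sum>l<m. \<alpha> l) = \<alpha> i + (\<Sum>l\<in>{..<m} - {i}. \<alpha> l)"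
      using i by (intro sum.remove) auto
    have "(\<Sum>l<m. \<beta> l) < (\<Sum>l<m. \<alpha> l)"
    proof (cases "Suc i < m")
      case True
      have "(\<Sum>l<m. f l) = (\<Sum>l\<in>{..<m} - {i, Suc i}. f l) + (\<Sum>l\<in>{i, Suc i}. f l)" for f :: "nat \<Rightarrow> nat"
        using True by (intro sum.subset_diff) auto
      moreover have "(\<Sum>l\<in>{..<m} - {i, Suc i}. \<beta> l) = (\<Sum>l\<in>{..<m} - {i, Suc i}. \<alpha> l)"
        by (intro sum.cong) (auto simp: \<beta>_def)
      ultimately show ?thesis using nz z[of "Suc i"] by (simp add: \<beta>_def)
    next
      case False
      \<comment> \<open>The shifted entry lands at position \<open>m\<close>, outside the range of
        summation.\<close>
      hence "Suc i = m" using i by simp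
      have "(\<Sum>l<m. \<beta> l) = \<beta> i + (\<Sum>l\<in>{..<m} - {i}. \<beta> l)" using i by (intro sum.remove) auto
      also have "(\<Sum>l\<in>{..<m} - {i}. \<beta> l) = (\<Sum>l\<in>{..<m} - {i}. \<alpha> l)"
        using \<open>Suc i = m\<close> by (intro sum.cong) (auto simp: \<beta>_def)
      finally show ?thesis using si nz by (simp add: \<beta>_def)
    qed
    moreover have "\<beta> j \<le> m - j" for j using less.prems(1)[of j] less.prems(1)[of i] by (auto simp: \<beta>_def)
    moreover have "\<beta> 0 = 0" using less.prems(2) i by (auto simp: \<beta>_def)
    ultimately obtain v where v: "v permutes {1..m}" "lehmer_code v = \<beta>" using less.hyps by blast
    have vS: "v \<in> S_infinity" using v(1) permutes_in_S_infinity by blast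
    have "v i < v (Suc i)" using ascent_iff_code[OF vS] v(2) by (simp add: \<beta>_def)
    from lehmer_code_comp_s[OF vS this] have "lehmer_code (v \<circ> s i) = \<alpha>"
      using v(2) nz z[of "Suc i"] by (auto simp: \<beta>_def fun_eq_iff)
    thus ?thesis using permutes_comp_s[OF v(1) i] by blast
  qed
qed

text \<open>Converse of \<open>lehmer_code_le\<close>: some permutation of {1..m} has the same code,
  and codes are injective.\<close>

lemma permutes_from_code:
  assumes w: "w \<in> S_infinity" and "\<And>i. 1 \<le> i \<Longrightarrow> lehmer_code w i \<le> m - i"
  shows "w permutes {1..m}"
proof -
  have "lehmer_code w i \<le> m - i" for i using assms(2)[of i] lehmer_code_zero[OF w] by (cases i) auto
  then obtain v where "v permutes {1..m}" "lehmer_code v = lehmer_code w"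
    using code_realizable lehmer_code_zero[OF w] by blast
  thus ?thesis using lehmer_code_inj[OF w, of v] permutes_in_S_infinity by metis
qed

text \<open>Resolves the definite description: N c_i \<le> N (n - i) \<le> N n - i, so the scaled
  code fits under the staircase of S_(N n).\<close>

lemma stretch:
  assumes w: "w permutes {1..n}" and N: "N \<ge> 1"
  shows "stretch n N w \<in> S_infinity"
    and "1 \<le> i \<Longrightarrow> lehmer_code (stretch n N w) i = (if i \<le> n then N * lehmer_code w i else 0)"
proof -
  define \<alpha> where "\<alpha> i = (if i \<le> n then N * lehmer_code w i else 0)" for i
  have bd: "\<alpha> i \<le> N * n - i" for i
  proof (cases "i \<le> n")
    case True
    have "N * lehmer_code w i \<le> N * (n - i)" using lehmer_code_le[OF w] by simp
    also have "\<dots> \<le> N * n - i" using N by (simp add: diff_mult_distrib2 diff_le_mono2)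
    finally show ?thesis using True by (simp add: \<alpha>_def)
  qed (simp add: \<alpha>_def)
  have wS: "w \<in> S_infinity" using w permutes_in_S_infinity by blast
  have a0: "\<alpha> 0 = 0" using lehmer_code_zero[OF wS] by (simp add: \<alpha>_def)
  obtain v where v: "v permutes {1..N * n}" "lehmer_code v = \<alpha>" using code_realizable[OF bd a0] by blast
  have "stretch n N w = v" unfolding stretch_def
  proof (rule the_equality)
    show "v permutes {1..N * n} \<and> (\<forall>i\<in>{1..N * n}. lehmer_code v i = (if i \<le> n then N * lehmer_code w i else 0))"
      using v by (auto simp: \<alpha>_def)
  next
    fix v' assume v': "v' permutes {1..N * n} \<and> (\<forall>i\<in>{1..N * n}. lehmer_code v' i = (if i \<le> n then N * lehmer_code w i else 0))"
    have "lehmer_code v' = lehmer_code v"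
    proof
      fix i show "lehmer_code v' i = lehmer_code v i"
      proof (cases "i \<in> {1..N * n}")
        case True thus ?thesis using v' v(2) by (simp add: \<alpha>_def)
      next
        case False
        hence "i = 0 \<or> i \<ge> N * n" by auto
        thus ?thesis using v' v(1) lehmer_code_zero permutes_in_S_infinity lehmer_code_beyond by metis
      qed
    qed
    thus "v' = v" using lehmer_code_inj v' v(1) permutes_in_S_infinity by metis
  qed
  thus "stretch n N w \<in> S_infinity" "1 \<le> i \<Longrightarrow> lehmer_code (stretch n N w) i = (if i \<le> n then N * lehmer_code w i else 0)"
    using v permutes_in_S_infinity by (auto simp: \<alpha>_def)
qed

text \<open>Inversions between the first \<open>n\<close> positions. Unlike
  \<open>perm_length\<close>, this count is at most \<open>n * n\<close> however large the values of
  \<open>w\<close> are, so it measures both sortings uniformly in \<open>N\<close>.\<close>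

definition inv_upto :: "nat \<Rightarrow> (nat \<Rightarrow> nat) \<Rightarrow> nat" where
  "inv_upto n w = card {(i, j). i < j \<and> j \<in> {1..n} \<and> i \<in> {1..n} \<and> w j < w i}"

lemma inv_upto_le: "inv_upto n w \<le> n * n"
proof -
  have "inv_upto n w \<le> card ({1..n} \<times> {1..n})" unfolding inv_upto_def by (rule card_mono) auto
  thus ?thesis by simp
qed

lemma s_mono: "a < b \<Longrightarrow> a \<noteq> i \<or> b \<noteq> Suc i \<Longrightarrow> s i a < s i b"
  by (auto simp add: transpose_def split: if_splits)

lemma s_in_interval: "1 \<le> i \<Longrightarrow> i < n \<Longrightarrow> a \<in> {1..n} \<Longrightarrow> s i a \<in> {1..n}"
  by (simp add: transpose_def)

text \<open>Applying \<open>s i\<close> to both positions matches the inversions of \<open>w\<close>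
  with those of \<open>w \<circ> s i\<close> other than \<open>(i, Suc i)\<close>, since
  \<open>s i\<close> reverses the order of no other pair.\<close>

lemma inv_upto_comp_s:
  assumes i: "1 \<le> i" "i < n" and lt: "w i < w (Suc i)"
  shows "inv_upto n (w \<circ> s i) = Suc (inv_upto n w)"
proof -
  define I where "I w = {(a, b). a < b \<and> b \<in> {1..n} \<and> a \<in> {1..n} \<and> w b < w a}" for w :: "nat \<Rightarrow> nat"
  define h where "h = (\<lambda>(a, b). (s i a, s i b))"
  have hh: "h (h p) = p" for p by (simp add: h_def split: prod.split)
  have fin: "finite (I w)" for w by (rule finite_subset[of _ "{1..n} \<times> {1..n}"]) (auto simp: I_def)
  have in_I: "(a, b) \<in> I w \<longleftrightarrow> a < b \<and> b \<in> {1..n} \<and> a \<in> {1..n} \<and> w b < w a" for a b w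
    by (simp add: I_def)
  have sub1: "h ` (I (w \<circ> s i) - {(i, Suc i)}) \<subseteq> I w"
  proof
    fix p assume "p \<in> h ` (I (w \<circ> s i) - {(i, Suc i)})"
    then obtain a b where p: "p = h (a, b)"
      and ab: "(a, b) \<in> I (w \<circ> s i)" "\<not> (a = i \<and> b = Suc i)" by auto
    hence "s i a < s i b" "s i a \<in> {1..n}" "s i b \<in> {1..n}" "w (s i b) < w (s i a)"
      using s_mono[of a b i] s_in_interval[OF i] unfolding in_I by (blast, blast, blast, simp)
    thus "p \<in> I w" unfolding p h_def prod.case in_I by blast
  qed
  have sub2: "h ` I w \<subseteq> I (w \<circ> s i) - {(i, Suc i)}"
  proof
    fix p assume "p \<in> h ` I w"
    then obtain a b where p: "p = h (a, b)" and ab: "(a, b) \<in> I w" by auto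
    hence ne: "\<not> (a = i \<and> b = Suc i)" using lt unfolding in_I by auto
    have "s i a < s i b" "s i a \<in> {1..n}" "s i b \<in> {1..n}"
      using ab s_mono[of a b i] s_in_interval[OF i] ne unfolding in_I by blast+
    moreover have "\<not> (s i a = i \<and> s i b = Suc i)"
    proof
      assume "s i a = i \<and> s i b = Suc i"
      hence "a = Suc i" "b = i" by (metis s_simps(1,3), metis s_simps(2,3))
      thus False using ab unfolding in_I by simp
    qed
    ultimately show "p \<in> I (w \<circ> s i) - {(i, Suc i)}"
      using ab unfolding p h_def prod.case in_I by (auto simp: in_I)
  qed
  have "h ` I w = I (w \<circ> s i) - {(i, Suc i)}"
  proof
    show "I (w \<circ> s i) - {(i, Suc i)} \<subseteq> h ` I w" 
    proof
      fix p assume "p \<in> I (w \<circ> s i) - {(i, Suc i)}"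
      hence "h p \<in> I w" using sub1 by blast
      from imageI[OF this, of h] show "p \<in> h ` I w" unfolding hh .
    qed
  qed (rule sub2)
  moreover have "card (h ` I w) = card (I w)"
    by (rule card_image, rule inj_on_inverseI[of _ h]) (rule hh)
  moreover have "(i, Suc i) \<in> I (w \<circ> s i)" using i lt unfolding in_I by simp
  ultimately have "card (I (w \<circ> s i)) = Suc (card (I w))"
    using fin[of "w \<circ> s i"] by (metis card_Suc_Diff1)
  thus ?thesis unfolding inv_upto_def I_def by simp
qed

subsection \<open>Divided differences\<close>

abbreviation "lookup \<equiv> Poly_Mapping.lookup"
abbreviation "single \<equiv> Poly_Mapping.single"
abbreviation "keys \<equiv> Poly_Mapping.keys"
abbreviation "dd \<equiv> divided_difference"

lemma poly_mapping_sum_singles: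
  fixes f :: "'a \<Rightarrow>\<^sub>0 'b::comm_monoid_add"
  shows "f = (\<Sum>k\<in>keys f. single k (lookup f k))"
proof (rule poly_mapping_eqI)
  fix k
  have "lookup (\<Sum>k\<in>keys f. single k (lookup f k)) k = (\<Sum>l\<in>keys f. if k = l then lookup f l else 0)"
    unfolding lookup_sum by (intro sum.cong) (auto simp: lookup_single when_def)
  also have "\<dots> = lookup f k" by (simp add: sum.delta in_keys_iff)
  finally show "lookup f k = lookup (\<Sum>k\<in>keys f. single k (lookup f k)) k" ..
qed

lemma poly_mapping_add_induct [case_names single add]:
  fixes f :: "'a \<Rightarrow>\<^sub>0 'b::comm_monoid_add"
  assumes "\<And>k v. P (single k v)" "\<And>f g. P f \<Longrightarrow> P g \<Longrightarrow> P (f + g)"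
  shows "P f"
proof -
  have "finite A \<Longrightarrow> P (\<Sum>k\<in>A. single k (lookup f k))" for A
  proof (induction A rule: finite_induct)
    case empty thus ?case using assms(1)[of undefined 0] by simp
  qed (use assms in auto)
  from this[OF finite_keys[of f]] show ?thesis using poly_mapping_sum_singles[of f] by simp
qed

definition swap_exp :: "nat \<Rightarrow> (nat \<Rightarrow>\<^sub>0 nat) \<Rightarrow> (nat \<Rightarrow>\<^sub>0 nat)" where
  "swap_exp i = Poly_Mapping.map_key (s i)"

lemma lookup_swap_exp [simp]: "lookup (swap_exp i e) j = lookup e (s i j)"
  by (simp add: swap_exp_def Poly_Mapping.map_key.rep_eq)

lemma swap_exp_swap_exp [simp]: "swap_exp i (swap_exp i e) = e"
  by (rule poly_mapping_eqI) simp

lemma inj_swap_exp: "inj (swap_exp i)"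
  by (metis inj_onI swap_exp_swap_exp)

lemma lookup_swap_vars [simp]: "lookup (swap_vars i f) e = lookup f (swap_exp i e)"
  by (simp add: swap_vars_def Poly_Mapping.map_key.rep_eq inj_swap_exp flip: swap_exp_def)

lemma swap_exp_add: "swap_exp i (d + e) = swap_exp i d + swap_exp i e"
  by (rule poly_mapping_eqI) (simp add: lookup_add)

lemma swap_exp_0 [simp]: "swap_exp i 0 = 0"
  by (rule poly_mapping_eqI) simp

lemma swap_exp_single: "swap_exp i (single j n) = single (s i j) n"
  by (rule poly_mapping_eqI) (auto simp: lookup_single when_def)

lemma swap_vars_single: "swap_vars i (single e c) = single (swap_exp i e) c"
  by (rule poly_mapping_eqI) (auto simp: lookup_single when_def)

lemma swap_vars_add: "swap_vars i (f + g) = swap_vars i f + swap_vars i g"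
  by (rule poly_mapping_eqI) (simp add: lookup_add)

lemma swap_vars_diff: "swap_vars i (f - g) = swap_vars i f - swap_vars i g"
  by (rule poly_mapping_eqI) (simp add: lookup_minus)

lemma swap_vars_swap_vars [simp]: "swap_vars i (swap_vars i f) = f"
  by (rule poly_mapping_eqI) simp

lemma swap_vars_mult: "swap_vars i (f * g) = swap_vars i f * swap_vars i g"
proof (induction f rule: poly_mapping_add_induct)
  case (single k v)
  show ?case
    by (induction g rule: poly_mapping_add_induct)
      (simp_all add: mult_single swap_vars_single swap_exp_add swap_vars_add distrib_left)
qed (simp add: distrib_right swap_vars_add)

lemma swap_vars_X: "swap_vars i (X j) = X (s i j)"
  by (simp add: X_def swap_vars_single swap_exp_single)

lemma swap_vars_const [simp]: "swap_vars i (single 0 c) = single 0 c"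
  by (simp add: swap_vars_single)

lemma swap_vars_0 [simp]: "swap_vars i 0 = 0" and swap_vars_1 [simp]: "swap_vars i 1 = 1"
  using swap_vars_const[of i 0] swap_vars_const[of i 1] by simp_all

lemma X_power: "X j ^ n = single (single j n) 1"
  by (induction n) (simp_all add: X_def mult_single flip: single_add)

lemma prod_X_power:
  "finite A \<Longrightarrow> (\<Prod>j\<in>A. X j ^ a j) = single (\<Sum>j\<in>A. single j (a j)) 1"
  by (induction A rule: finite_induct) (simp_all add: X_power mult_single)

lemma ipoly_ring_induct [case_names const X add mult]:
  fixes f :: ipoly
  assumes const: "\<And>c. P (single 0 c)" and X: "\<And>i. P (X i)"
    and add: "\<And>f g. P f \<Longrightarrow> P g \<Longrightarrow> P (f + g)" and mult: "\<And>f g. P f \<Longrightarrow> P g \<Longrightarrow> P (f * g)"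
  shows "P f"
proof (induction f rule: poly_mapping_add_induct)
  case (single e c)
  have one: "P 1" using const[of 1] by simp
  have pow: "P (X j ^ n)" for j n by (induction n) (auto intro: X mult one)
  have "P (\<Prod>j\<in>A. X j ^ lookup e j)" if "finite A" for A
    using that by (induction A rule: finite_induct) (auto intro: one mult pow)
  from this[OF finite_keys[of e]] have "P (single (\<Sum>j\<in>keys e. single j (lookup e j)) 1)"
    by (simp only: finite_keys prod_X_power)
  hence "P (single e 1)" unfolding poly_mapping_sum_singles[of e, symmetric] .
  from mult[OF const[of c] this] show ?case by (simp add: mult_single)
qed (rule add)

definition simple_root :: "nat \<Rightarrow> ipoly" where "simple_root i = X i - X (Suc i)"

lemma X_inj: "X i = X j \<longleftrightarrow> i = j"
  by (metis X_def lookup_single_eq lookup_single_not_eq zero_neq_one)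

lemma simple_root_neq_0 [simp]: "simple_root i \<noteq> 0"
  by (simp add: simple_root_def X_inj)

lemma swap_vars_simple_root [simp]: "swap_vars i (simple_root i) = - simple_root i"
  by (simp add: simple_root_def swap_vars_diff swap_vars_X)

lemma swap_vars_simple_root_far: "Suc i < j \<or> Suc j < i \<Longrightarrow> swap_vars i (simple_root j) = simple_root j"
  by (auto simp: simple_root_def swap_vars_diff swap_vars_X s_other)

lemma swap_vars_simple_root_Suc: "swap_vars i (simple_root (Suc i)) = simple_root i + simple_root (Suc i)"
  "swap_vars (Suc i) (simple_root i) = simple_root i + simple_root (Suc i)"
  by (simp_all add: simple_root_def swap_vars_diff swap_vars_X s_other)

text \<open>Divisibility passes to products by fg - s(f) s(g) = (f - s(f)) g + s(f) (g - s(g)),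
  which leaves only constants and variables to check.\<close>

lemma simple_root_dvd: "simple_root i dvd f - swap_vars i f"
proof (induction f rule: ipoly_ring_induct)
  case (X j)
  show ?case
    by (cases "j = i"; cases "j = Suc i")
      (auto simp: swap_vars_X s_other simple_root_def intro: dvdI[of _ _ "-1"])
next
  case (add f g)
  have "f + g - swap_vars i (f + g) = (f - swap_vars i f) + (g - swap_vars i g)"
    by (simp add: swap_vars_add)
  thus ?case using add by (metis dvd_add)
next
  case (mult f g)
  have "f * g - swap_vars i (f * g) = (f - swap_vars i f) * g + swap_vars i f * (g - swap_vars i g)"
    by (simp add: swap_vars_mult algebra_simps)
  thus ?case using mult by (metis dvd_add dvd_mult dvd_mult2)
qed simp

text \<open>The ring has no zero divisors, so an exact quotient by a simple root is unique.\<close>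

lemma dd_unique: "simple_root i * g = f - swap_vars i f \<Longrightarrow> dd i f = g"
  unfolding divided_difference_def simple_root_def[symmetric]
  by (rule the_equality) (auto, metis mult_cancel_left simple_root_neq_0)

lemma dd_spec: "simple_root i * dd i f = f - swap_vars i f"
  using simple_root_dvd[of i f] dd_unique by (metis dvdE)

lemma dd_add: "dd i (f + g) = dd i f + dd i g"
  by (rule dd_unique) (simp add: distrib_left dd_spec swap_vars_add)

lemma dd_Leibniz: "dd i (f * g) = dd i f * g + swap_vars i f * dd i g"
proof (rule dd_unique)
  have "simple_root i * (dd i f * g + swap_vars i f * dd i g)
      = (simple_root i * dd i f) * g + swap_vars i f * (simple_root i * dd i g)" by (simp add: algebra_simps)
  thus "simple_root i * (dd i f * g + swap_vars i f * dd i g) = f * g - swap_vars i (f * g)"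
    by (simp add: dd_spec swap_vars_mult algebra_simps)
qed

lemma dd_eq_0_iff: "dd i f = 0 \<longleftrightarrow> swap_vars i f = f"
  using dd_spec[of i f] by (metis dd_unique diff_self eq_iff_diff_eq_0 mult_zero_right)

lemma dd_symmetric_mult: "swap_vars i f = f \<Longrightarrow> dd i (f * g) = f * dd i g"
  by (simp add: dd_Leibniz dd_eq_0_iff[THEN iffD2])

lemma swap_vars_dd: "swap_vars i (dd i f) = dd i f"
proof -
  have "- simple_root i * swap_vars i (dd i f) = swap_vars i (simple_root i * dd i f)" by (simp add: swap_vars_mult)
  also have "\<dots> = - (simple_root i * dd i f)" by (simp add: dd_spec swap_vars_diff)
  finally have "simple_root i * swap_vars i (dd i f) = simple_root i * dd i f" by simp
  thus ?thesis by (metis mult_cancel_left simple_root_neq_0)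
qed

lemma dd_dd [simp]: "dd i (dd i f) = 0"
  by (simp add: dd_eq_0_iff swap_vars_dd)

lemma dd_0 [simp]: "dd i 0 = 0" and dd_1 [simp]: "dd i 1 = 0"
  by (simp_all add: dd_eq_0_iff)

lemma dd_swap_vars: "dd i (swap_vars i f) = - dd i f"
  by (rule dd_unique) (simp add: dd_spec)

section \<open>Nil-Coxeter relations for divided differences\<close>

lemma swap_vars_far:
  assumes "Suc i < j \<or> Suc j < i" shows "swap_vars i (swap_vars j f) = swap_vars j (swap_vars i f)"
proof -
  have "s j (s i k) = s i (s j k)" for k using assms by (auto simp: transpose_def)
  hence "swap_exp j (swap_exp i e) = swap_exp i (swap_exp j e)" for e by (intro poly_mapping_eqI) simp
  thus ?thesis by (intro poly_mapping_eqI) simp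
qed

lemma swap_vars_braid:
  "swap_vars i (swap_vars (Suc i) (swap_vars i f)) = swap_vars (Suc i) (swap_vars i (swap_vars (Suc i) f))"
proof -
  have "s i (s (Suc i) (s i k)) = s (Suc i) (s i (s (Suc i) k))" for k by (auto simp: transpose_def)
  hence "swap_exp i (swap_exp (Suc i) (swap_exp i e)) = swap_exp (Suc i) (swap_exp i (swap_exp (Suc i) e))" for e
    by (intro poly_mapping_eqI) simp
  thus ?thesis by (intro poly_mapping_eqI) simp
qed

text \<open>Each swap fixes the simple root of the other. Multiplied by both roots, the two sides
  become the same alternating sum over the four-element group generated by the swaps.\<close>

lemma dd_far:
  assumes "Suc i < j \<or> Suc j < i" shows "dd i (dd j f) = dd j (dd i f)"
proof -
  have *: "simple_root i * simple_root j * dd i (dd j f) = f - swap_vars j f - swap_vars i f + swap_vars i (swap_vars j f)"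
    if "Suc i < j \<or> Suc j < i" for i j
  proof -
    have "simple_root i * simple_root j * dd i (dd j f) = simple_root j * (simple_root i * dd i (dd j f))" by (simp add: algebra_simps)
    also have "\<dots> = simple_root j * (dd j f - swap_vars i (dd j f))" by (simp only: dd_spec)
    also have "\<dots> = simple_root j * dd j f - swap_vars i (simple_root j * dd j f)"
      by (simp only: swap_vars_mult swap_vars_simple_root_far[OF that] right_diff_distrib)
    finally show ?thesis by (simp only: dd_spec swap_vars_diff) (simp add: algebra_simps)
  qed
  have "simple_root i * simple_root j * dd i (dd j f) = simple_root i * simple_root j * dd j (dd i f)"
  proof -
    have "simple_root j * simple_root i * dd j (dd i f) = f - swap_vars i f - swap_vars j f + swap_vars j (swap_vars i f)"
      by (rule *) (use assms in auto)
    also have "\<dots> = f - swap_vars j f - swap_vars i f + swap_vars i (swap_vars j f)"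
      by (simp add: swap_vars_far[OF assms])
    finally show ?thesis using *[OF assms] by (simp only: mult.commute)
  qed
  thus ?thesis by (metis mult_cancel_left simple_root_neq_0 no_zero_divisors)
qed

text \<open>Both sides of the braid relation reduce to this alternating sum over \<open>S\<^sub>3\<close>.\<close>

lemma antisymmetrizer:
  assumes "swap_vars i (simple_root j) = simple_root i + simple_root j" "swap_vars j (simple_root i) = simple_root i + simple_root j"
  shows "simple_root i * simple_root j * (simple_root i + simple_root j) * dd i (dd j (dd i f)) =
      f - swap_vars i f - swap_vars j f + swap_vars j (swap_vars i f) + swap_vars i (swap_vars j f)
      - swap_vars i (swap_vars j (swap_vars i f))"
proof -
  define a b where ab: "a = simple_root i" "b = simple_root j"
  define F1 F2 F3 where F: "F1 = dd i f" "F2 = dd j F1" "F3 = dd i F2"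
  have sw: "swap_vars i a = - a" "swap_vars i b = a + b" "swap_vars j a = a + b" "swap_vars j b = - b"
    using assms by (simp_all add: ab)
  have 1: "a * F1 = f - swap_vars i f" and 2: "b * F2 = F1 - swap_vars j F1" and 3: "a * F3 = F2 - swap_vars i F2"
    by (simp_all add: ab F dd_spec)
  have "swap_vars j (a * F1) = swap_vars j f - swap_vars j (swap_vars i f)" by (simp add: 1 swap_vars_diff)
  hence 4: "(a + b) * swap_vars j F1 = swap_vars j f - swap_vars j (swap_vars i f)" by (simp add: swap_vars_mult sw)
  have "a * b * (a + b) * F2 = a * (a + b) * (b * F2)" by (simp add: algebra_simps)
  also have "\<dots> = (a + b) * (a * F1) - a * ((a + b) * swap_vars j F1)"
    unfolding 2 by (simp add: algebra_simps)
  finally have 5: "a * b * (a + b) * F2 = (a + b) * (f - swap_vars i f) - a * (swap_vars j f - swap_vars j (swap_vars i f))"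
    by (simp only: 1 4)
  have "swap_vars i (a * b * (a + b) * F2) = b * (swap_vars i f - f) + a * (swap_vars i (swap_vars j f) - swap_vars i (swap_vars j (swap_vars i f)))"
    unfolding 5 by (simp add: swap_vars_mult swap_vars_diff swap_vars_add sw)
  hence 6: "a * b * (a + b) * swap_vars i F2 = - b * (swap_vars i f - f) - a * (swap_vars i (swap_vars j f) - swap_vars i (swap_vars j (swap_vars i f)))"
    by (simp add: swap_vars_mult swap_vars_add sw algebra_simps)
  have "a * (a * b * (a + b) * F3) = a * b * (a + b) * (a * F3)" by (simp only: ac_simps)
  also have "\<dots> = a * b * (a + b) * F2 - a * b * (a + b) * swap_vars i F2"
    unfolding 3 by (rule right_diff_distrib)
  also have "\<dots> = a * (f - swap_vars i f - swap_vars j f + swap_vars j (swap_vars i f) + swap_vars i (swap_vars j f)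
      - swap_vars i (swap_vars j (swap_vars i f)))"
    unfolding 5 6 by (simp add: algebra_simps)
  finally show ?thesis unfolding ab F by (metis mult_cancel_left simple_root_neq_0)
qed

text \<open>Exchanging \<open>i\<close> and \<open>Suc i\<close> returns the same alternating sum
  once \<open>swap_vars_braid\<close> identifies the two words for the longest element, and the
  common factor is nonzero.\<close>

lemma dd_braid: "dd i (dd (Suc i) (dd i f)) = dd (Suc i) (dd i (dd (Suc i) f))"
proof -
  have nz: "simple_root i + simple_root (Suc i) \<noteq> 0" by (simp add: simple_root_def X_inj)
  have 1: "simple_root i * simple_root (Suc i) * (simple_root i + simple_root (Suc i)) * dd i (dd (Suc i) (dd i f)) =
      f - swap_vars i f - swap_vars (Suc i) f + swap_vars (Suc i) (swap_vars i f) + swap_vars i (swap_vars (Suc i) f)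
      - swap_vars i (swap_vars (Suc i) (swap_vars i f))"
    by (rule antisymmetrizer[OF swap_vars_simple_root_Suc])
  have "simple_root i * simple_root (Suc i) * (simple_root i + simple_root (Suc i)) * dd (Suc i) (dd i (dd (Suc i) f)) =
      simple_root (Suc i) * simple_root i * (simple_root (Suc i) + simple_root i) * dd (Suc i) (dd i (dd (Suc i) f))"
    by (simp only: ac_simps)
  also have "\<dots> = f - swap_vars (Suc i) f - swap_vars i f + swap_vars i (swap_vars (Suc i) f) + swap_vars (Suc i) (swap_vars i f)
      - swap_vars (Suc i) (swap_vars i (swap_vars (Suc i) f))"
    by (rule antisymmetrizer) (simp_all only: swap_vars_simple_root_Suc add.commute)
  also have "\<dots> = f - swap_vars i f - swap_vars (Suc i) f + swap_vars (Suc i) (swap_vars i f) + swap_vars i (swap_vars (Suc i) f)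
      - swap_vars i (swap_vars (Suc i) (swap_vars i f))"
    by (simp add: swap_vars_braid)
  finally have "simple_root i * simple_root (Suc i) * (simple_root i + simple_root (Suc i)) * dd i (dd (Suc i) (dd i f)) =
      simple_root i * simple_root (Suc i) * (simple_root i + simple_root (Suc i)) * dd (Suc i) (dd i (dd (Suc i) f))"
    using 1 by (simp only:)
  thus ?thesis using nz by (metis mult_cancel_left simple_root_neq_0 no_zero_divisors)
qed

section \<open>Coefficients, degrees and variables of divided differences\<close>

lemma lookup_monom_mult:
  fixes g :: ipoly
  shows "lookup (single m 1 * g) e = (if \<forall>j. lookup m j \<le> lookup e j then lookup g (e - m) else 0)"
proof (induction g rule: poly_mapping_add_induct)
  case (single k v)
  have "m + k = e \<longleftrightarrow> (\<forall>j. lookup m j \<le> lookup e j) \<and> k = e - m"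
  proof (intro iffI conjI allI)
    assume "(\<forall>j. lookup m j \<le> lookup e j) \<and> k = e - m"
    thus "m + k = e" by (intro poly_mapping_eqI) (simp add: lookup_add minus_poly_mapping.rep_eq)
  qed (auto simp: lookup_add)
  thus ?case by (auto simp: mult_single lookup_single when_def)
qed (auto simp: distrib_left lookup_add)

text \<open>The equation (x_i - x_(i+1)) g = f - s_i f, read at the exponent
  \<open>e + single i 1\<close> and solved for the coefficient of g at \<open>e\<close>. The other
  unknown coefficient has a smaller exponent of x_(i+1), so the recursion terminates.\<close>

lemma lookup_dd_rec:
  "lookup (dd i f) e = (if lookup e (Suc i) = 0 then 0 else lookup (dd i f) (e + single i 1 - single (Suc i) 1))
     + lookup f (e + single i 1) - lookup f (swap_exp i (e + single i 1))"
proof -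
  let ?e = "e + single i 1"
  have "lookup (X i * dd i f) ?e = lookup (dd i f) e"
    unfolding X_def lookup_monom_mult by (auto simp: lookup_add)
  moreover have "lookup (X (Suc i) * dd i f) ?e =
      (if lookup e (Suc i) = 0 then 0 else lookup (dd i f) (?e - single (Suc i) 1))"
    unfolding X_def lookup_monom_mult by (auto simp: lookup_add lookup_single when_def)
  moreover have "lookup (simple_root i * dd i f) ?e = lookup f ?e - lookup f (swap_exp i ?e)"
    unfolding dd_spec by (simp add: lookup_minus)
  ultimately show ?thesis by (simp add: simple_root_def left_diff_distrib lookup_minus split: if_splits)
qed

text \<open>Transfers a property of exponents from \<open>f\<close> to \<open>dd i f\<close> along
  the recursion above. It is stated at \<open>e + single i 1\<close> because a divided difference
  lowers the degree by one; the third hypothesis accounts for a unit moved from x_(i+1) to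
  x_i.\<close>

lemma keys_dd:
  assumes f: "\<And>e. e \<in> keys f \<Longrightarrow> Q e"
    and sw: "\<And>e. Q (swap_exp i e) \<Longrightarrow> Q e"
    and shift: "\<And>e. lookup e (Suc i) \<noteq> 0 \<Longrightarrow> Q (e + single i 1 - single (Suc i) 1 + single i 1) \<Longrightarrow> Q (e + single i 1)"
    and e: "e \<in> keys (dd i f)"
  shows "Q (e + single i 1)"
  using e
proof (induction "lookup e (Suc i)" arbitrary: e)
  case 0
  have "lookup f (e + single i 1) \<noteq> 0 \<or> lookup f (swap_exp i (e + single i 1)) \<noteq> 0"
    using 0 lookup_dd_rec[of i f e] by (auto simp: in_keys_iff)
  thus ?case using f sw by (auto simp: in_keys_iff)
next
  case (Suc k)
  have "lookup f (e + single i 1) \<noteq> 0 \<or> lookup f (swap_exp i (e + single i 1)) \<noteq> 0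
     \<or> lookup (dd i f) (e + single i 1 - single (Suc i) 1) \<noteq> 0"
    using Suc.prems Suc.hyps(2) lookup_dd_rec[of i f e] by (auto simp: in_keys_iff)
  moreover have "k = lookup (e + single i 1 - single (Suc i) 1) (Suc i)"
    using Suc.hyps(2) by (simp add: minus_poly_mapping.rep_eq lookup_add lookup_single when_def)
  ultimately show ?case using f sw shift[of e] Suc.hyps by (auto simp: in_keys_iff)
qed

definition total_degree :: "(nat \<Rightarrow>\<^sub>0 nat) \<Rightarrow> nat" where
  "total_degree e = (\<Sum>j\<in>keys e. lookup e j)"

lemma total_degree_superset: "finite A \<Longrightarrow> keys e \<subseteq> A \<Longrightarrow> total_degree e = (\<Sum>j\<in>A. lookup e j)"
  unfolding total_degree_def by (intro sum.mono_neutral_left) (auto simp: in_keys_iff)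

lemma total_degree_add: "total_degree (d + e) = total_degree d + total_degree e"
proof -
  let ?A = "keys d \<union> keys e"
  have "total_degree (d + e) = (\<Sum>j\<in>?A. lookup (d + e) j)"
    by (rule total_degree_superset) (use keys_add[of d e] in auto)
  also have "\<dots> = total_degree d + total_degree e"
    by (simp add: lookup_add sum.distrib total_degree_superset[of ?A])
  finally show ?thesis .
qed

lemma total_degree_single [simp]: "total_degree (single j n) = n"
  by (simp add: total_degree_def)

lemma total_degree_swap_exp [simp]: "total_degree (swap_exp i e) = total_degree e"
  by (induction e rule: poly_mapping_add_induct) (simp_all add: swap_exp_single swap_exp_add total_degree_add)

lemma total_degree_eq_0: "total_degree e = 0 \<longleftrightarrow> e = 0"
proof
  assume "total_degree e = 0"
  hence "\<forall>j\<in>keys e. lookup e j = 0" by (simp add: total_degree_def)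
  thus "e = 0" by (intro poly_mapping_eqI) (auto simp: in_keys_iff)
qed (simp add: total_degree_def)

lemma shift_exp: "lookup e (Suc i) \<noteq> 0 \<Longrightarrow> e + single i 1 - single (Suc i) 1 + single (Suc i) 1 = e + single i (1::nat)"
  by (rule poly_mapping_eqI) (auto simp add: lookup_add minus_poly_mapping.rep_eq lookup_single when_def)

text \<open>The predicate \<open>P\<close> is arbitrary so that the lemma serves both homogeneous
  polynomials and degree bounds.\<close>

lemma dd_degree:
  assumes "\<And>e. e \<in> keys f \<Longrightarrow> P (total_degree e)" "e \<in> keys (dd i f)"
  shows "P (Suc (total_degree e))"
proof -
  have "P (total_degree (e + single i 1))"
  proof (rule keys_dd[of f _ i e])
    fix e :: "nat \<Rightarrow>\<^sub>0 nat"
    assume "lookup e (Suc i) \<noteq> 0" "P (total_degree (e + single i 1 - single (Suc i) 1 + single i 1))"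
    thus "P (total_degree (e + single i 1))"
      using arg_cong[OF shift_exp, of e i total_degree] by (simp add: total_degree_add)
  qed (use assms in auto)
  thus ?thesis by (simp add: total_degree_add)
qed

lemma dd_degree_0: assumes "\<And>e. e \<in> keys f \<Longrightarrow> total_degree e = 0" shows "dd i f = 0"
proof -
  have "e \<notin> keys (dd i f)" for e using dd_degree[of f "\<lambda>d. d = 0" e i] assms by auto
  thus ?thesis by (simp flip: keys_eq_empty) blast
qed

definition polys_in :: "nat set \<Rightarrow> ipoly set" where
  "polys_in S = {f. \<forall>e\<in>keys f. keys e \<subseteq> S}"

lemma polys_in_single: "keys e \<subseteq> S \<Longrightarrow> single e c \<in> polys_in S"
  by (auto simp: polys_in_def)

lemma polys_in_const [simp]: "single 0 c \<in> polys_in S"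
  by (auto simp: polys_in_def)

lemma polys_in_0 [simp]: "0 \<in> polys_in S" and polys_in_1 [simp]: "1 \<in> polys_in S"
  using polys_in_const[of 0] polys_in_const[of 1] by simp_all

lemma polys_in_add: "f \<in> polys_in S \<Longrightarrow> g \<in> polys_in S \<Longrightarrow> f + g \<in> polys_in S"
  unfolding polys_in_def using keys_add[of f g] by blast

lemma polys_in_diff: "f \<in> polys_in S \<Longrightarrow> g \<in> polys_in S \<Longrightarrow> f - g \<in> polys_in S"
  unfolding polys_in_def using keys_diff[of f g] by blast

lemma polys_in_mult: "f \<in> polys_in S \<Longrightarrow> g \<in> polys_in S \<Longrightarrow> f * g \<in> polys_in S"
  unfolding polys_in_def
proof (intro CollectI ballI subsetI)
  fix e j assume f: "f \<in> {f. \<forall>e\<in>keys f. keys e \<subseteq> S}" and g: "g \<in> {f. \<forall>e\<in>keys f. keys e \<subseteq> S}"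
    and e: "e \<in> keys (f * g)" and j: "j \<in> keys e"
  obtain a b where "e = a + b" "a \<in> keys f" "b \<in> keys g" using keys_mult[of f g] e by auto
  thus "j \<in> S" using f g j keys_add[of a b] by blast
qed

lemma polys_in_mono: "f \<in> polys_in S \<Longrightarrow> S \<subseteq> T \<Longrightarrow> f \<in> polys_in T"
  unfolding polys_in_def by blast

lemma polys_in_X: "i \<in> S \<Longrightarrow> X i \<in> polys_in S"
  unfolding X_def by (rule polys_in_single) simp

lemma polys_in_sum: "(\<And>i. i \<in> A \<Longrightarrow> f i \<in> polys_in S) \<Longrightarrow> (\<Sum>i\<in>A. f i) \<in> polys_in S"
  by (induction A rule: infinite_finite_induct) (auto intro: polys_in_add)

lemma polys_in_swap_vars:
  assumes "i \<in> S" "Suc i \<in> S" "f \<in> polys_in S" shows "swap_vars i f \<in> polys_in S"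
  unfolding polys_in_def
proof (clarify)
  fix e j assume e: "e \<in> keys (swap_vars i f)" and j: "j \<in> keys e"
  have "swap_exp i e \<in> keys f" "s i j \<in> keys (swap_exp i e)" using e j by (simp_all add: in_keys_iff)
  hence "s i j \<in> S" using assms(3) by (auto simp: polys_in_def)
  thus "j \<in> S" using assms by (auto simp: transpose_def split: if_splits)
qed

lemma polys_in_dd:
  assumes i: "i \<in> S" "Suc i \<in> S" and f: "f \<in> polys_in S" shows "dd i f \<in> polys_in S"
  unfolding polys_in_def
proof (clarify)
  fix e j assume e: "e \<in> keys (dd i f)" and j: "j \<in> keys e"
  have "keys (e + single i 1) \<subseteq> S"
  proof (rule keys_dd[OF _ _ _ e])
    fix e assume "e \<in> keys f" thus "keys e \<subseteq> S" using f by (auto simp: polys_in_def)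
  next
    fix e assume "keys (swap_exp i e) \<subseteq> S"
    hence "lookup e j \<noteq> 0 \<longrightarrow> s i j \<in> S" for j using lookup_swap_exp[of i e "s i j"] by (auto simp: in_keys_iff)
    moreover have "s i j \<in> S \<Longrightarrow> j \<in> S" for j using i by (auto simp: transpose_def split: if_splits)
    ultimately show "keys e \<subseteq> S" by (auto simp: in_keys_iff)
  next
    fix e :: "nat \<Rightarrow>\<^sub>0 nat" assume "keys (e + single i 1 - single (Suc i) 1 + single i 1) \<subseteq> S"
    hence h: "lookup (e + single i 1 - single (Suc i) 1 + single i 1) t \<noteq> 0 \<Longrightarrow> t \<in> S" for t
      by (meson in_keys_iff subsetD)
    show "keys (e + single i 1) \<subseteq> S"
    proof
      fix t assume "t \<in> keys (e + single i 1)"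
      thus "t \<in> S" using i h[of t]
        by (cases "t = i"; cases "t = Suc i") (auto simp: in_keys_iff lookup_add minus_poly_mapping.rep_eq lookup_single)
    qed
  qed
  thus "j \<in> S" using j by (auto simp: in_keys_iff lookup_add)
qed

lemma polys_in_symmetric:
  assumes "i \<notin> S" "Suc i \<notin> S" "f \<in> polys_in S" shows "swap_vars i f = f"
proof (rule poly_mapping_eqI)
  fix e
  show "lookup (swap_vars i f) e = lookup f e"
  proof (cases "lookup e i = 0 \<and> lookup e (Suc i) = 0")
    case True
    hence "swap_exp i e = e" by (intro poly_mapping_eqI) (auto simp: transpose_def)
    thus ?thesis by simp
  next
    case False
    have "lookup f e = 0" if "lookup e i \<noteq> 0 \<or> lookup e (Suc i) \<noteq> 0" for e
    proof (rule ccontr)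
      assume "lookup f e \<noteq> 0"
      hence "e \<in> keys f" by (simp add: in_keys_iff)
      hence "keys e \<subseteq> S" using assms(3) by (simp add: polys_in_def)
      moreover have "i \<in> keys e \<or> Suc i \<in> keys e" using that by (simp add: in_keys_iff)
      ultimately show False using assms(1,2) by blast
    qed
    from this[of e] this[of "swap_exp i e"] False show ?thesis by (simp add: disj_commute)
  qed
qed

text \<open>Exponents are nonnegative, so a product of monomials is constant only if both factors
  are.\<close>

lemma lookup_0_mult: "lookup (f * g) 0 = lookup f 0 * lookup (g :: ipoly) 0"
proof (induction f rule: poly_mapping_add_induct)
  case (single k v)
  have z: "k + l = 0 \<longleftrightarrow> k = 0 \<and> l = 0" for l
    by (metis add_eq_0_iff_both_eq_0 total_degree_add total_degree_eq_0 add.right_neutral)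
  show ?case
  proof (induction g rule: poly_mapping_add_induct)
    case (single l u)
    show ?case using z[of l] by (auto simp: mult_single lookup_single when_def)
  qed (simp add: distrib_left lookup_add)
qed (simp add: distrib_right lookup_add)

subsection \<open>Operators satisfying the nil-Coxeter relations\<close>

lemma descent_pos: "w \<in> S_infinity \<Longrightarrow> w (Suc i) < w i \<Longrightarrow> 1 \<le> i"
  using S_infinity_zero by (cases i) force+

lemma s_far: "Suc i < j \<Longrightarrow> s i \<circ> s j = s j \<circ> s i"
  by (rule ext) (auto simp: transpose_def)

lemma s_braid: "s i \<circ> s (Suc i) \<circ> s i = s (Suc i) \<circ> s i \<circ> s (Suc i)"
  by (rule ext) (auto simp: transpose_def)

text \<open>Used twice: with divided differences, evaluated at \<open>w\<^sub>0 w\<close>, it gives the Schubert polynomials; with their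
  transposes it gives the dual functionals.\<close>

inductive nil_act :: "(nat \<Rightarrow> 'a \<Rightarrow> 'a) \<Rightarrow> 'a \<Rightarrow> (nat \<Rightarrow> nat) \<Rightarrow> 'a \<Rightarrow> bool" for T a0 where
  id: "nil_act T a0 id a0"
| step: "w \<in> S_infinity \<Longrightarrow> 1 \<le> i \<Longrightarrow> w i < w (Suc i) \<Longrightarrow> nil_act T a0 w a \<Longrightarrow> nil_act T a0 (w \<circ> s i) (T i a)"

lemma nil_act_exists: assumes "w \<in> S_infinity" shows "\<exists>a. nil_act T a0 w a"
  using assms
proof (induction rule: S_infinity_descent_induct)
  case id show ?case by (rule exI, rule nil_act.id)
next
  case (descent w i)
  then obtain a where "nil_act T a0 (w \<circ> s i) a" by blast
  from nil_act.step[OF S_infinity_comp_s[OF descent(1,2)] descent(2) _ this] show ?case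
    using descent(3) unfolding comp_s_cancel by auto
qed

lemma nil_act_cases_descent:
  assumes "nil_act T a0 w a" "w \<noteq> id"
  obtains i b where "w \<in> S_infinity" "1 \<le> i" "w (Suc i) < w i" "nil_act T a0 (w \<circ> s i) b" "a = T i b"
  using assms
proof cases
  case (step v i b)
  show ?thesis
    by (rule that[of i b]) (use step S_infinity_comp_s in \<open>simp_all only: comp_s_cancel, auto\<close>)
qed simp

text \<open>Every step of \<open>nil_act\<close> increases the length, so only reduced words are
  followed, and any two reduced words of one permutation are linked by these two kinds of
  moves.\<close>

locale nil_coxeter =
  fixes T :: "nat \<Rightarrow> 'a \<Rightarrow> 'a" and a0 :: 'a
  assumes far: "Suc i < j \<Longrightarrow> T i (T j a) = T j (T i a)"
    and braid: "T i (T (Suc i) (T i a)) = T (Suc i) (T i (T (Suc i) a))"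
begin

lemma nil_act_descent_step:
  assumes "w \<in> S_infinity" "1 \<le> i" "w (Suc i) < w i" "nil_act T a0 (w \<circ> s i) a"
  shows "nil_act T a0 w (T i a)"
  using nil_act.step[OF S_infinity_comp_s[OF assms(1,2)] assms(2) _ assms(4)] assms(3)
  unfolding comp_s_cancel by auto

text \<open>Local confluence: below two descents of \<open>w\<close> lies a common element, w s_i
  s_j if they are far apart and w s_i s_(i+1) s_i if they are adjacent, and a value chosen there
  gives the same result at \<open>w\<close> along both sides.\<close>

lemma diamond:
  assumes w: "w \<in> S_infinity" and i: "1 \<le> i" "w (Suc i) < w i" and j: "w (Suc j) < w j" and ij: "i < j"
  obtains c d where "nil_act T a0 (w \<circ> s i) c" "nil_act T a0 (w \<circ> s j) d" "T i c = T j d"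
proof (cases "Suc i < j")
  case True
  have wi: "w \<circ> s i \<in> S_infinity" and wj: "w \<circ> s j \<in> S_infinity" using w i(1) ij S_infinity_comp_s by auto
  have comm: "w \<circ> s i \<circ> s j = w \<circ> s j \<circ> s i"
    unfolding comp_assoc by (rule arg_cong[OF s_far[OF True]])
  have "w \<circ> s i \<circ> s j \<in> S_infinity" using S_infinity_comp_s[OF wi] i(1) ij by simp
  from nil_act_exists[OF this, of T a0] obtain c where c: "nil_act T a0 (w \<circ> s i \<circ> s j) c" ..
  have "(w \<circ> s i) (Suc j) < (w \<circ> s i) j" "(w \<circ> s j) (Suc i) < (w \<circ> s j) i"
    using i j True by (simp_all add: s_other)
  note d = this
  have "nil_act T a0 (w \<circ> s i) (T j c)" "nil_act T a0 (w \<circ> s j) (T i c)"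
    by (rule nil_act_descent_step[OF wi _ d(1) c], use ij i(1) in simp)
      (rule nil_act_descent_step[OF wj i(1) d(2) c[unfolded comm]])
  thus ?thesis using that[OF _ _ far[OF True, of c]] by simp
next
  case False
  hence j_eq: "j = Suc i" using ij by simp
  let ?j = "Suc i"
  have S: "v \<circ> s i \<in> S_infinity" "v \<circ> s ?j \<in> S_infinity" if "v \<in> S_infinity" for v
    using that i(1) S_infinity_comp_s by auto
  have dec: "w (Suc i) < w i" "w (Suc (Suc i)) < w (Suc i)" using i j j_eq by auto
  have br: "w \<circ> s i \<circ> s ?j \<circ> s i = w \<circ> s ?j \<circ> s i \<circ> s ?j"
    unfolding comp_assoc by (rule arg_cong[OF s_braid[unfolded comp_assoc]])
  have "w \<circ> s i \<circ> s ?j \<circ> s i \<in> S_infinity" by (intro S w)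
  from nil_act_exists[OF this, of T a0] obtain c where c: "nil_act T a0 (w \<circ> s i \<circ> s ?j \<circ> s i) c" ..
  have d: "(w \<circ> s i \<circ> s ?j) (Suc i) < (w \<circ> s i \<circ> s ?j) i" "(w \<circ> s i) (Suc ?j) < (w \<circ> s i) ?j"
     "(w \<circ> s ?j \<circ> s i) (Suc ?j) < (w \<circ> s ?j \<circ> s i) ?j" "(w \<circ> s ?j) (Suc i) < (w \<circ> s ?j) i"
    using dec by (simp_all add: transpose_def)
  have j1: "1 \<le> ?j" by simp
  have 1: "nil_act T a0 (w \<circ> s i) (T ?j (T i c))"
    by (intro nil_act_descent_step[OF _ j1 d(2)] nil_act_descent_step[OF _ i(1) d(1)] S w c)
  have 2: "nil_act T a0 (w \<circ> s ?j) (T i (T ?j c))"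
    by (intro nil_act_descent_step[OF _ i(1) d(4)] nil_act_descent_step[OF _ j1 d(3)] S w c[unfolded br])
  show ?thesis by (rule that[unfolded j_eq, OF 1 2]) (rule braid)
qed

text \<open>Induction on the length with \<open>diamond\<close> as the confluence step; this
  replaces an appeal to Matsumoto's theorem on reduced words.\<close>

lemma nil_act_unique: "nil_act T a0 w a \<Longrightarrow> nil_act T a0 w b \<Longrightarrow> a = b"
proof (induction "perm_length w" arbitrary: w a b rule: less_induct)
  case less
  show ?case
  proof (cases "w = id")
    case True
    have "a = a0" if a: "nil_act T a0 id a" for a
      using a
    proof cases
      case (step v i b)
      \<comment> \<open>A step ending at \<open>id\<close> would force \<open>id\<close> to have a
        descent.\<close>
      from step(1) have "id (Suc i) = v i" "id i = v (Suc i)" by (metis comp_apply s_simps)+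
      thus ?thesis using step by simp
    qed
    thus ?thesis using less.prems True by blast
  next
    case False
    obtain i a' where w: "w \<in> S_infinity" and i: "1 \<le> i" "w (Suc i) < w i" and a: "nil_act T a0 (w \<circ> s i) a'" "a = T i a'"
      using nil_act_cases_descent[OF less.prems(1) False] by blast
    obtain j b' where j: "1 \<le> j" "w (Suc j) < w j" and b: "nil_act T a0 (w \<circ> s j) b'" "b = T j b'"
      using nil_act_cases_descent[OF less.prems(2) False] by blast
    have IH: "c = d" if "w (Suc k) < w k" "nil_act T a0 (w \<circ> s k) c" "nil_act T a0 (w \<circ> s k) d" for k c d
      using less.hyps[of "w \<circ> s k" c d] perm_length_comp_s_descent[OF w that(1)] that by simp
    have *: "T i a' = T j b'" if "i < j" "1 \<le> i" "w (Suc i) < w i" "w (Suc j) < w j"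
        "nil_act T a0 (w \<circ> s i) a'" "nil_act T a0 (w \<circ> s j) b'" for i j a' b'
      using diamond[OF w that(2,3,4,1)] IH that by metis
    show ?thesis
    proof (cases i j rule: linorder_cases)
      case equal
      thus ?thesis using IH[OF i(2) a(1)] a b by simp
    qed (use * i j a b in metis)+
  qed
qed

definition val :: "(nat \<Rightarrow> nat) \<Rightarrow> 'a" where "val w = (THE a. nil_act T a0 w a)"

lemma val_eq: "nil_act T a0 w a \<Longrightarrow> val w = a"
  unfolding val_def using nil_act_unique by blast

lemma nil_act_val: "w \<in> S_infinity \<Longrightarrow> nil_act T a0 w (val w)"
  using nil_act_exists val_eq by metis

lemma val_id [simp]: "val id = a0"
  by (rule val_eq[OF nil_act.id])

lemma val_descent: "w \<in> S_infinity \<Longrightarrow> w (Suc i) < w i \<Longrightarrow> val w = T i (val (w \<circ> s i))"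
  by (rule val_eq, rule nil_act_descent_step)
    (auto intro: nil_act_val S_infinity_comp_s dest: descent_pos)

lemma val_ascent: "w \<in> S_infinity \<Longrightarrow> 1 \<le> i \<Longrightarrow> w i < w (Suc i) \<Longrightarrow> val (w \<circ> s i) = T i (val w)"
  by (rule val_eq, rule nil_act.step) (auto intro: nil_act_val)

end

subsection \<open>Schubert polynomials\<close>

lemma longest_perm_permutes: "longest_perm m permutes {1..m}"
proof (rule bij_imp_permutes)
  show "bij_betw (longest_perm m) {1..m} {1..m}"
    by (rule bij_betwI[of _ _ _ "longest_perm m"]) (auto simp: longest_perm_def)
qed (auto simp: longest_perm_def)

lemma longest_perm_in_S_infinity: "longest_perm m \<in> S_infinity"
  using longest_perm_permutes permutes_in_S_infinity by blast

lemma longest_perm_invol [simp]: "longest_perm m (longest_perm m i) = i"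
  by (auto simp: longest_perm_def)

lemma lehmer_code_longest: "lehmer_code (longest_perm m) i = (if 1 \<le> i then m - i else 0)"
proof (cases "i \<in> {1..m}")
  case True
  have "{j. i < j \<and> longest_perm m j < longest_perm m i} = {i<..m}"
    using True by (auto simp: longest_perm_def split: if_splits)
  thus ?thesis using True by (simp add: lehmer_code_def)
next
  case False
  hence "i = 0 \<or> m \<le> i" by auto
  thus ?thesis using lehmer_code_zero[OF longest_perm_in_S_infinity] lehmer_code_beyond[OF longest_perm_permutes]
    by auto
qed

text \<open>Going down from position \<open>m\<close>, strict decrease forces the entry at
  \<open>i\<close> to be at least \<open>m - i\<close>, which is also the largest value
  allowed.\<close>

lemma decreasing_is_longest:
  assumes w: "w permutes {1..m}" and dec: "\<And>i. 1 \<le> i \<Longrightarrow> i < m \<Longrightarrow> lehmer_code w (Suc i) < lehmer_code w i"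
  shows "w = longest_perm m"
proof -
  have wS: "w \<in> S_infinity" using w permutes_in_S_infinity by blast
  have "lehmer_code w (m - k) \<ge> k" if "k < m" for k
    using that
  proof (induction k)
    case (Suc k)
    have "lehmer_code w (Suc (m - Suc k)) < lehmer_code w (m - Suc k)" using dec[of "m - Suc k"] Suc.prems by simp
    thus ?case using Suc by (simp add: Suc_diff_Suc)
  qed simp
  from this[of "m - i" for i] have ge: "lehmer_code w i \<ge> m - i" if "1 \<le> i" "i \<le> m" for i
    using that by (metis diff_diff_cancel diff_less less_le_trans zero_less_one order_less_le_trans)
  have "lehmer_code w i = lehmer_code (longest_perm m) i" for i
    using ge[of i] lehmer_code_le[OF w, of i] lehmer_code_zero[OF wS] by (cases "i \<le> m"; cases i) (auto simp: lehmer_code_longest intro: le_antisym)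
  thus ?thesis using lehmer_code_inj[OF wS longest_perm_in_S_infinity] by blast
qed

definition code_monomial :: "(nat \<Rightarrow> nat) \<Rightarrow> ipoly" where
  "code_monomial w = single (Abs_poly_mapping (lehmer_code w)) 1"

lemma lookup_code: assumes "w \<in> S_infinity" shows "lookup (Abs_poly_mapping (lehmer_code w)) = lehmer_code w"
proof (rule Abs_poly_mapping_inverse, clarify)
  obtain m where "w permutes {1..m}" using assms by (auto simp: S_infinity_def)
  hence "{i. lehmer_code w i \<noteq> 0} \<subseteq> {..m}" using lehmer_code_beyond by (metis (mono_tags) atMost_iff linorder_le_cases mem_Collect_eq subsetI)
  thus "finite {i. lehmer_code w i \<noteq> 0}" by (rule finite_subset) simp
qed

lemma code_monomial_longest: "code_monomial (longest_perm m) = (\<Prod>i\<in>{1..m}. X i ^ (m - i))"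
proof -
  have "Abs_poly_mapping (lehmer_code (longest_perm m)) = (\<Sum>i\<in>{1..m}. single i (m - i))"
  proof (rule poly_mapping_eqI)
    fix k
    show "lookup (Abs_poly_mapping (lehmer_code (longest_perm m))) k = lookup (\<Sum>i\<in>{1..m}. single i (m - i)) k"
      by (auto simp: lookup_code[OF longest_perm_in_S_infinity] lookup_sum lookup_single when_def lehmer_code_longest sum.delta)
  qed
  thus ?thesis by (simp add: code_monomial_def prod_X_power)
qed

definition dominant :: "(nat \<Rightarrow> nat) \<Rightarrow> bool" where
  "dominant w \<longleftrightarrow> (\<forall>i\<ge>1. lehmer_code w (Suc i) \<le> lehmer_code w i)"

text \<open>Raise the leftmost pair of equal neighbours: an entry before it is strictly larger, so
  the code stays weakly decreasing. The monomial of \<open>w\<close> is symmetric in x_i and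
  x_(i+1), that of \<open>w \<circ> s i\<close> is x_i times it, and \<open>dd i\<close> sends x_i
  to 1.\<close>

lemma dominant_raise:
  assumes w: "w permutes {1..m}" and dom: "dominant w" and ne: "w \<noteq> longest_perm m"
  obtains i where "1 \<le> i" "i < m" "w i < w (Suc i)" "dominant (w \<circ> s i)"
    "dd i (code_monomial (w \<circ> s i)) = code_monomial w"
proof -
  have wS: "w \<in> S_infinity" using w permutes_in_S_infinity by blast
  define P where "P i \<longleftrightarrow> 1 \<le> i \<and> i < m \<and> lehmer_code w i = lehmer_code w (Suc i)" for i
  have "\<exists>i. P i" using decreasing_is_longest[OF w] ne dom unfolding P_def dominant_def by (metis le_neq_implies_less)
  then obtain i where i: "P i" and least: "\<And>j. j < i \<Longrightarrow> \<not> P j" by (metis exists_least_iff)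
  from i have i1: "1 \<le> i" "i < m" "lehmer_code w i = lehmer_code w (Suc i)" by (auto simp: P_def)
  have asc: "w i < w (Suc i)" using ascent_iff_code[OF wS] i1 by simp
  have prev: "lehmer_code w i < lehmer_code w j" if "Suc j = i" "1 \<le> j" for j
    using least[of j] dom that i1 unfolding P_def dominant_def by (metis Suc_lessD le_neq_implies_less lessI)
  let ?v = "w \<circ> s i"
  have code: "lehmer_code ?v = (lehmer_code w)(i := Suc (lehmer_code w i))"
    unfolding lehmer_code_comp_s[OF wS asc] using i1 by auto
  have "dominant ?v" unfolding dominant_def code
    using dom prev by (auto simp: dominant_def le_SucI Suc_le_eq)
  moreover have "dd i (code_monomial ?v) = code_monomial w"
  proof (rule dd_unique)
    have vS: "?v \<in> S_infinity" using S_infinity_comp_s wS i1 by blast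
    let ?e = "Abs_poly_mapping (lehmer_code w)"
    have e: "Abs_poly_mapping (lehmer_code ?v) = single i 1 + ?e"
    proof (rule poly_mapping_eqI)
      fix k
      show "lookup (Abs_poly_mapping (lehmer_code ?v)) k = lookup (single i 1 + ?e) k"
        unfolding lookup_add lookup_code[OF vS] lookup_code[OF wS] unfolding code
        by (simp add: lookup_single when_def)
    qed
    have sw: "swap_exp i ?e = ?e"
      by (rule poly_mapping_eqI) (use i1 in \<open>auto simp: lookup_code wS transpose_def\<close>)
    show "simple_root i * code_monomial w = code_monomial ?v - swap_vars i (code_monomial ?v)"
      by (simp add: code_monomial_def e simple_root_def X_def left_diff_distrib mult_single swap_vars_single swap_exp_add sw swap_exp_single)
  qed
  ultimately show ?thesis using that[OF i1(1,2) asc] by blast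
qed

interpretation schub: nil_coxeter dd "code_monomial (longest_perm m)" for m
  by unfold_locales (auto intro: dd_far dd_braid)

text \<open>Descending from \<open>w\<^sub>0\<close> in \<open>S\<^sub>m\<close> by right multiplication turns ascents of \<open>w\<close> into descents of \<open>w\<^sub>0 w\<close>.
  Independence of \<open>m\<close> follows because \<open>w\<^sub>0\<close> of \<open>S\<^sub>n\<close> is dominant in every larger \<open>S\<^sub>m\<close>.\<close>

definition schub_level :: "nat \<Rightarrow> (nat \<Rightarrow> nat) \<Rightarrow> ipoly" where
  "schub_level m w = schub.val m (longest_perm m \<circ> w)"

lemma longest_less:
  assumes "w permutes {1..m}" "j \<in> {1..m}" "k \<in> {1..m}"
  shows "longest_perm m (w j) < longest_perm m (w k) \<longleftrightarrow> w k < w j"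
proof -
  have "w j \<in> {1..m}" "w k \<in> {1..m}" using permutes_in_image[OF assms(1)] assms(2,3) by auto
  thus ?thesis by (auto simp: longest_perm_def)
qed

lemma schub_level_ascent:
  assumes w: "w permutes {1..m}" and i: "1 \<le> i" "i < m" and lt: "w i < w (Suc i)"
  shows "schub_level m w = dd i (schub_level m (w \<circ> s i))"
proof -
  have "longest_perm m \<circ> w \<in> S_infinity"
    using permutes_compose[OF w longest_perm_permutes] permutes_in_S_infinity by blast
  moreover have "(longest_perm m \<circ> w) (Suc i) < (longest_perm m \<circ> w) i"
    using longest_less[OF w, of "Suc i" i] lt i by simp
  ultimately show ?thesis unfolding schub_level_def using schub.val_descent by (metis comp_assoc)
qed

text \<open>Ascents are available until the longest element is reached, and lengths in S_m are at
  most \<open>m * m\<close>.\<close>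

lemma ascent_induct [consumes 1, case_names longest ascent]:
  assumes "w permutes {1..m}" and "P (longest_perm m)"
    and step: "\<And>w i. w permutes {1..m} \<Longrightarrow> 1 \<le> i \<Longrightarrow> i < m \<Longrightarrow> w i < w (Suc i) \<Longrightarrow> P (w \<circ> s i) \<Longrightarrow> P w"
  shows "P w"
  using assms(1)
proof (induction "m * m - perm_length w" arbitrary: w rule: less_induct)
  case less
  have wS: "w \<in> S_infinity" using less.prems permutes_in_S_infinity by blast
  show ?case
  proof (cases "w = longest_perm m")
    case False
    then obtain i where i: "1 \<le> i" "i < m" "\<not> lehmer_code w (Suc i) < lehmer_code w i"
      using decreasing_is_longest[OF less.prems] by blast
    hence lt: "w i < w (Suc i)" using ascent_iff_code[OF wS] by simp
    have v: "w \<circ> s i permutes {1..m}" using permutes_comp_s less.prems i by blast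
    show ?thesis
      using step[OF less.prems i(1,2) lt] less.hyps[OF _ v] perm_length_comp_s[OF wS i(1) lt] perm_length_bound[OF v] by simp
  qed (use assms(2) in simp)
qed

text \<open>The climb from \<open>w\<close> to the longest element passes through dominant
  permutations only, so every divided difference on the way back takes a monomial to a
  monomial.\<close>

lemma schub_level_dominant:
  assumes "w permutes {1..m}" "dominant w" shows "schub_level m w = code_monomial w"
  using assms
proof (induction "m * m - perm_length w" arbitrary: w rule: less_induct)
  case less
  have wS: "w \<in> S_infinity" using less.prems permutes_in_S_infinity by blast
  show ?case
  proof (cases "w = longest_perm m")
    case True
    have "longest_perm m \<circ> longest_perm m = id" by auto
    thus ?thesis by (simp add: schub_level_def True)
  next
    case False
    then obtain i where i: "1 \<le> i" "i < m" "w i < w (Suc i)" "dominant (w \<circ> s i)"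
      "dd i (code_monomial (w \<circ> s i)) = code_monomial w" using dominant_raise[OF less.prems] by blast
    have v: "w \<circ> s i permutes {1..m}" using permutes_comp_s less.prems i by blast
    show ?thesis
      using schub_level_ascent[OF less.prems(1) i(1-3)] less.hyps[OF _ v i(4)] perm_length_comp_s[OF wS i(1,3)] perm_length_bound[OF v] i(5)
      by simp
  qed
qed

lemma dominant_longest: "dominant (longest_perm m)"
  by (simp add: dominant_def lehmer_code_longest diff_le_mono2)

text \<open>Holding for all large \<open>m\<close> at once is what allows derivations that start
  from longest elements of different S_n to be compared inside one S_m.\<close>

lemma is_schubert_level: "is_schubert w f \<Longrightarrow> \<exists>M. \<forall>m\<ge>M. w permutes {1..m} \<and> f = schub_level m w"
proof (induction rule: is_schubert.induct)
  case (longest n)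
  show ?case
  proof (intro exI allI impI conjI)
    fix m assume "n \<le> m"
    thus "longest_perm n permutes {1..m}" using longest_perm_permutes permutes_mono by blast
    from schub_level_dominant[OF this dominant_longest]
    show "(\<Prod>i\<in>{1..n}. X i ^ (n - i)) = schub_level m (longest_perm n)" by (simp add: code_monomial_longest)
  qed
next
  case (ascent i w f)
  then obtain M where M: "\<And>m. m \<ge> M \<Longrightarrow> w \<circ> s i permutes {1..m} \<and> f = schub_level m (w \<circ> s i)" by blast
  show ?case
  proof (intro exI allI impI)
    fix m assume m: "m \<ge> max M (Suc i)"
    have "w \<circ> s i \<circ> s i permutes {1..m}" using permutes_comp_s[OF _ ascent(1), of "w \<circ> s i" m] M[of m] m by auto
    hence w: "w permutes {1..m}" unfolding comp_s_cancel .
    thus "w permutes {1..m} \<and> dd i f = schub_level m w"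
      using schub_level_ascent[OF w ascent(1) _ ascent(2)] M[of m] m by simp
  qed
qed

lemma is_schubert_unique: assumes "is_schubert w f" "is_schubert w g" shows "f = g"
proof -
  obtain M M' where M: "\<And>m. m \<ge> M \<Longrightarrow> f = schub_level m w" "\<And>m. m \<ge> M' \<Longrightarrow> g = schub_level m w"
    using is_schubert_level assms by metis
  show ?thesis using M(1)[of "max M M'"] M(2)[of "max M M'"] by simp
qed

lemma is_schubert_exists: assumes "w \<in> S_infinity" shows "\<exists>f. is_schubert w f"
proof -
  obtain m where "w permutes {1..m}" using assms by (auto simp: S_infinity_def)
  thus ?thesis
  proof (induction rule: ascent_induct)
    case longest thus ?case using is_schubert.longest by blast
  next
    case (ascent w i) thus ?case using is_schubert.ascent by blast
  qed
qed

lemma schubert_eq: "is_schubert w f \<Longrightarrow> schubert w = f"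
  unfolding schubert_def using is_schubert_unique by blast

lemma is_schubert_schubert: "w \<in> S_infinity \<Longrightarrow> is_schubert w (schubert w)"
  using is_schubert_exists schubert_eq by metis

lemma schubert_id [simp]: "schubert id = 1"
proof -
  have "longest_perm 0 = id" by (auto simp: longest_perm_def)
  thus ?thesis using schubert_eq[OF is_schubert.longest[of 0]] by simp
qed

lemma schubert_ascent:
  "w \<in> S_infinity \<Longrightarrow> 1 \<le> i \<Longrightarrow> w i < w (Suc i) \<Longrightarrow> schubert w = dd i (schubert (w \<circ> s i))"
  by (intro schubert_eq is_schubert.ascent is_schubert_schubert S_infinity_comp_s)

lemma dd_schubert:
  assumes w: "w \<in> S_infinity" and i: "1 \<le> i"
  shows "dd i (schubert w) = (if w (Suc i) < w i then schubert (w \<circ> s i) else 0)"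
proof (cases "w (Suc i) < w i")
  case True
  thus ?thesis using schubert_ascent[OF S_infinity_comp_s[OF w i] i, unfolded comp_s_cancel] by simp
next
  case False
  hence "w i < w (Suc i)" using S_infinity_neq[OF w, of i "Suc i"] by simp
  thus ?thesis using schubert_ascent[OF w i] False by simp
qed

lemma schubert_dominant: assumes "w \<in> S_infinity" "dominant w" shows "schubert w = code_monomial w"
proof -
  obtain M where M: "\<forall>m\<ge>M. w permutes {1..m} \<and> schubert w = schub_level m w"
    using is_schubert_level[OF is_schubert_schubert[OF assms(1)]] by blast
  thus ?thesis using schub_level_dominant[of w M] assms(2) by auto
qed

lemma schubert_degree: assumes "w \<in> S_infinity" "e \<in> keys (schubert w)" shows "total_degree e = perm_length w"
proof -
  obtain m where "w permutes {1..m}" using assms by (auto simp: S_infinity_def)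
  hence "\<forall>e\<in>keys (schubert w). total_degree e = perm_length w"
  proof (induction rule: ascent_induct)
    case longest
    have "schubert (longest_perm m) = code_monomial (longest_perm m)"
      by (rule schubert_dominant[OF longest_perm_in_S_infinity dominant_longest])
    moreover have "total_degree (Abs_poly_mapping (lehmer_code (longest_perm m))) = perm_length (longest_perm m)"
      by (simp add: total_degree_def perm_length_def lookup_code[OF longest_perm_in_S_infinity] keys.rep_eq)
    ultimately show ?case by (simp add: code_monomial_def)
  next
    case (ascent w i)
    have wS: "w \<in> S_infinity" using ascent(1) permutes_in_S_infinity by blast
    show ?case
    proof
      fix e assume e: "e \<in> keys (schubert w)"
      have "Suc (total_degree e) = perm_length (w \<circ> s i)"
        by (rule dd_degree[of "schubert (w \<circ> s i)" "\<lambda>d. d = perm_length (w \<circ> s i)" e i])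
          (rule ascent.IH[rule_format], assumption, rule e[unfolded schubert_ascent[OF wS ascent(2,4)]])
      thus "total_degree e = perm_length w" using perm_length_comp_s[OF wS ascent(2,4)] by simp
    qed
  qed
  thus ?thesis using assms(2) by blast
qed

lemma schubert_polys_in: assumes "w \<in> S_infinity" shows "schubert w \<in> polys_in {1..}"
proof -
  obtain m where "w permutes {1..m}" using assms by (auto simp: S_infinity_def)
  thus ?thesis
  proof (induction rule: ascent_induct)
    case longest
    have "keys (Abs_poly_mapping (lehmer_code (longest_perm m))) \<subseteq> {1..}"
      by (auto simp: in_keys_iff lookup_code[OF longest_perm_in_S_infinity] lehmer_code_longest split: if_splits)
    thus ?case using schubert_dominant[OF longest_perm_in_S_infinity dominant_longest]
      by (simp add: code_monomial_def polys_in_single)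
  next
    case (ascent w i)
    have "dd i (schubert (w \<circ> s i)) \<in> polys_in {1..}"
      by (rule polys_in_dd[OF _ _ ascent.IH]) (use ascent(2) in auto)
    thus ?case using schubert_ascent[OF permutes_in_S_infinity[OF ascent(1)] ascent(2,4)] by simp
  qed
qed

subsection \<open>Coefficient functionals\<close>

text \<open>Precomposition reverses the order of the operators, and both relations are stable under
  reversal.\<close>

interpretation coef: nil_coxeter "\<lambda>i \<phi> f. \<phi> (dd i f)" "\<lambda>f. lookup f 0"
  by unfold_locales (auto simp: dd_far dd_braid)

text \<open>The constant term of the divided difference indexed by \<open>w\<close>; a descent taken
  from the right end of \<open>w\<close> supplies the operator that is applied to the polynomial
  before all others.\<close>

definition dual_fun :: "(nat \<Rightarrow> nat) \<Rightarrow> ipoly \<Rightarrow> int" where "dual_fun = coef.val"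

lemma dual_fun_id [simp]: "dual_fun id f = lookup f 0"
  by (simp add: dual_fun_def)

lemma dual_fun_descent: "w \<in> S_infinity \<Longrightarrow> w (Suc i) < w i \<Longrightarrow> dual_fun w f = dual_fun (w \<circ> s i) (dd i f)"
  unfolding dual_fun_def by (subst coef.val_descent) auto

text \<open>At a descent of \<open>w\<close> the composition contains \<open>dd i\<close> twice in a
  row and vanishes.\<close>

lemma dual_fun_dd:
  assumes w: "w \<in> S_infinity" and i: "1 \<le> i"
  shows "dual_fun w (dd i f) = (if w i < w (Suc i) then dual_fun (w \<circ> s i) f else 0)"
proof (cases "w i < w (Suc i)")
  case True
  thus ?thesis using coef.val_ascent[OF w i True] by (simp add: dual_fun_def)
next
  case False
  hence "w (Suc i) < w i" using S_infinity_neq[OF w, of i "Suc i"] by simp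
  have z: "dual_fun v 0 = 0" if "v \<in> S_infinity" for v
    using that
  proof (induction rule: S_infinity_descent_induct)
    case (descent w i)
    show ?case unfolding dual_fun_descent[OF descent(1,3)] dd_0 by (rule descent.IH)
  qed (simp only: dual_fun_id lookup_zero)
  show ?thesis using dual_fun_descent[OF w \<open>w (Suc i) < w i\<close>, of "dd i f"] z[OF S_infinity_comp_s[OF w i]] False by simp
qed

lemma dual_fun_add: "w \<in> S_infinity \<Longrightarrow> dual_fun w (f + g) = dual_fun w f + dual_fun w g"
proof (induction arbitrary: f g rule: S_infinity_descent_induct)
  case (descent w i)
  show ?case unfolding dual_fun_descent[OF descent(1,3)] dd_add by (rule descent.IH)
qed (simp only: dual_fun_id lookup_add)

lemma dual_fun_0 [simp]: "w \<in> S_infinity \<Longrightarrow> dual_fun w 0 = 0"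
  using dual_fun_add[of w 0 0] by simp

lemma dual_fun_diff: "w \<in> S_infinity \<Longrightarrow> dual_fun w (f - g) = dual_fun w f - dual_fun w g"
  using dual_fun_add[of w "f - g" g] by simp

lemma dual_fun_sum: "w \<in> S_infinity \<Longrightarrow> dual_fun w (\<Sum>i\<in>A. f i) = (\<Sum>i\<in>A. dual_fun w (f i))"
  by (induction A rule: infinite_finite_induct) (simp_all add: dual_fun_add)

lemma dual_fun_of_int_mult: assumes "w \<in> S_infinity" shows "dual_fun w (of_int c * f) = c * dual_fun w f"
proof -
  have "dual_fun w (of_nat n * f) = of_nat n * dual_fun w f" for n
    by (induction n) (simp_all add: assms dual_fun_add algebra_simps)
  moreover have "dual_fun w (- f) = - dual_fun w f" for f using dual_fun_diff[OF assms, of 0 f] assms by simp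
  ultimately show ?thesis by (cases c rule: int_cases2) simp_all
qed

text \<open>Both permutations lose the same \<open>s i\<close> at a descent of \<open>w\<close>; if
  \<open>v\<close> has no descent there, \<open>dd i\<close> kills its Schubert polynomial. At the
  identity, homogeneity of positive degree kills the constant term.\<close>

lemma dual_fun_schubert:
  assumes "w \<in> S_infinity" "v \<in> S_infinity" shows "dual_fun w (schubert v) = (if v = w then 1 else 0)"
  using assms
proof (induction w arbitrary: v rule: S_infinity_descent_induct)
  case id
  show ?case
  proof (cases "v = id")
    case False
    then obtain i where "v (Suc i) < v i" using obtain_descent[OF id] by blast
    hence "perm_length v > 0" using perm_length_comp_s_descent[OF id] by simp
    hence "0 \<notin> keys (schubert v)" using schubert_degree[OF id, of 0] by (auto simp: total_degree_def)
    hence "lookup (schubert v) 0 = 0" by (simp add: in_keys_iff)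
    thus ?thesis unfolding dual_fun_id using False by argo
  next
    case True
    show ?thesis unfolding True dual_fun_id schubert_id by (simp only: lookup_one_zero if_True refl)
  qed
next
  case (descent w i)
  have IH: "dual_fun (w \<circ> s i) (schubert (v \<circ> s i)) = (if v \<circ> s i = w \<circ> s i then 1 else 0)"
    by (rule descent.IH[OF S_infinity_comp_s[OF descent.prems descent.hyps(2)]])
  have eq: "v \<circ> s i = w \<circ> s i \<longleftrightarrow> v = w" by (metis comp_s_cancel)
  have "\<not> v (Suc i) < v i \<Longrightarrow> v \<noteq> w" using descent.hyps by blast
  moreover have "dual_fun (w \<circ> s i) 0 = 0" by (rule dual_fun_0[OF S_infinity_comp_s[OF descent.hyps(1,2)]])
  ultimately show ?case
    unfolding dual_fun_descent[OF descent.hyps(1,3)] dd_schubert[OF descent.prems descent.hyps(2)]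
    using IH[unfolded eq] by (cases "v (Suc i) < v i") (simp_all only: if_True if_False split: if_split, blast+)
qed

lemma dual_fun_degree:
  assumes "w \<in> S_infinity" "\<And>e. e \<in> keys f \<Longrightarrow> total_degree e \<le> d" "dual_fun w f \<noteq> 0"
  shows "perm_length w \<le> d"
  using assms
proof (induction w arbitrary: f d rule: S_infinity_descent_induct)
  case (descent w i)
  have nz: "dd i f \<noteq> 0" using descent dual_fun_descent[OF descent.hyps(1,3)] by (metis S_infinity_comp_s dual_fun_0)
  hence "d \<noteq> 0" using dd_degree_0[of f i] descent.prems(1) by (metis le_zero_eq)
  then obtain d' where d: "d = Suc d'" by (cases d) auto
  have "total_degree e \<le> d'" if "e \<in> keys (dd i f)" for e
    using dd_degree[of f "\<lambda>k. k \<le> d" e i] descent.prems(1) that d by auto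
  moreover have "dual_fun (w \<circ> s i) (dd i f) \<noteq> 0"
    using descent.prems(2) dual_fun_descent[OF descent.hyps(1,3), of f] by argo
  ultimately have "perm_length (w \<circ> s i) \<le> d'" by (rule descent.IH)
  thus ?case unfolding d perm_length_comp_s_descent[OF descent.hyps(1,3)] by (rule Suc_le_mono[THEN iffD2])
qed (simp only: perm_length_id le0)

text \<open>If the functional of \<open>w\<close> is nonzero on \<open>f\<close>, then
  \<open>w\<close> increases beyond the last variable of \<open>f\<close>, where divided differences
  of \<open>f\<close> vanish, and its length is at most the degree of \<open>f\<close>. So its code
  lies in a finite set.\<close>

lemma dual_fun_finite_support: "finite {w \<in> S_infinity. dual_fun w f \<noteq> 0}"
proof -
  define V where "V = (\<Union>e\<in>keys f. keys e)"
  have "finite V" by (simp add: V_def)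
  then obtain n where n: "V \<subseteq> {..n}" by (meson finite_nat_iff_bounded_le)
  have "finite (total_degree ` keys f)" by simp
  then obtain d where d: "\<And>e. e \<in> keys f \<Longrightarrow> total_degree e \<le> d"
    by (metis finite_nat_set_iff_bounded_le image_eqI)
  have f: "f \<in> polys_in {..n}" using n by (auto simp: polys_in_def V_def)
  define C where "C = {c :: nat \<Rightarrow> nat. (\<forall>i. (i \<in> {..n} \<longrightarrow> c i \<in> {..d}) \<and> (i \<notin> {..n} \<longrightarrow> c i = 0))}"
  have "finite C" unfolding C_def by (rule finite_set_of_finite_funs) auto
  moreover have "lehmer_code w \<in> C" if w: "w \<in> S_infinity" "dual_fun w f \<noteq> 0" for w
  proof -
    have asc: "w i < w (Suc i)" if "i > n" for i
    proof (rule ccontr)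
      assume "\<not> w i < w (Suc i)"
      hence "w (Suc i) < w i" using S_infinity_neq[OF w(1), of i "Suc i"] by simp
      moreover have "dd i f = 0" using polys_in_symmetric[OF _ _ f, of i] that by (simp add: dd_eq_0_iff)
      ultimately show False using dual_fun_descent[OF w(1), of i f] w(2) dual_fun_0[OF S_infinity_comp_s[OF w(1), of i]] that
        by simp
    qed
    have "w i < w j" if "n < i" "i < j" for i j
      using that(2,1)
    proof (induction j rule: less_Suc_induct)
      case (1 i) thus ?case using asc by simp
    next
      case (2 i j k) thus ?case by (meson less_trans)
    qed
    hence "lehmer_code w i = 0" if "n < i" for i
      using that unfolding lehmer_code_def by (metis (mono_tags, lifting) card.empty empty_Collect_eq less_asym)
    moreover have "lehmer_code w i \<le> d" for i
    proof -
      obtain m where m: "w permutes {1..m}" "m \<ge> Suc i" using S_infinity_eventually[OF w(1)] by blast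
      have "lehmer_code w i \<le> (\<Sum>i<m. lehmer_code w i)"
        using m(2) by (intro member_le_sum) auto
      also have "\<dots> \<le> d" using dual_fun_degree[OF w(1) d w(2)] perm_length_eq[OF m(1)] by simp
      finally show ?thesis .
    qed
    ultimately show ?thesis by (auto simp: C_def)
  qed
  hence "lehmer_code ` {w \<in> S_infinity. dual_fun w f \<noteq> 0} \<subseteq> C" by auto
  ultimately have "finite (lehmer_code ` {w \<in> S_infinity. dual_fun w f \<noteq> 0})" by (rule finite_subset[rotated])
  thus ?thesis by (rule finite_imageD) (auto intro: inj_onI lehmer_code_inj)
qed

text \<open>If x_j were the last variable to occur, symmetry under s_j would produce a monomial
  containing x_(j+1).\<close>

lemma symmetric_is_const:
  assumes f: "f \<in> polys_in {1..}" and sym: "\<And>i. 1 \<le> i \<Longrightarrow> swap_vars i f = f" and "lookup f 0 = 0"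
  shows "f = 0"
proof (rule ccontr)
  assume "f \<noteq> 0"
  then obtain e where e: "e \<in> keys f" by (metis keys_eq_empty ex_in_conv)
  define V where "V = (\<Union>e\<in>keys f. keys e)"
  have fin: "finite V" by (simp add: V_def)
  have "e \<noteq> 0" using e assms(3) by (auto simp: in_keys_iff)
  hence "keys e \<noteq> {}" by (metis keys.rep_eq lookup_zero poly_mapping_eqI in_keys_iff empty_iff)
  hence ne: "V \<noteq> {}" using e by (auto simp: V_def)
  define j where "j = Max V"
  have "j \<in> V" using Max_in[OF fin ne] by (simp add: j_def)
  then obtain e' where e': "e' \<in> keys f" "j \<in> keys e'" by (auto simp: V_def)
  have j: "1 \<le> j" using f e' by (auto simp: polys_in_def)
  have "lookup f (swap_exp j e') = lookup f e'" using arg_cong[OF sym[OF j], of "\<lambda>f. lookup f e'"] by simp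
  hence "swap_exp j e' \<in> keys f" using e' by (simp add: in_keys_iff)
  moreover have "Suc j \<in> keys (swap_exp j e')" using e' by (simp add: in_keys_iff)
  ultimately have "Suc j \<in> V" by (auto simp: V_def)
  thus False using Max_ge[OF fin] j_def by fastforce
qed

text \<open>By induction on the degree all divided differences vanish, so the polynomial is symmetric in infinitely
  many variables, hence constant.\<close>

lemma dual_fun_all_zero:
  assumes "f \<in> polys_in {1..}" "\<And>w. w \<in> S_infinity \<Longrightarrow> dual_fun w f = 0" shows "f = 0"
proof -
  have "finite (total_degree ` keys f)" by simp
  then obtain d where d: "\<And>e. e \<in> keys f \<Longrightarrow> total_degree e \<le> d"
    by (metis finite_nat_set_iff_bounded_le image_eqI)
  from assms d show ?thesis
  proof (induction d arbitrary: f)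
    case 0
    hence "dd i f = 0" for i using dd_degree_0[of f i] by simp
    moreover have "dual_fun id f = 0" by (rule 0(2)[OF id_in_S_infinity])
    ultimately show ?case unfolding dual_fun_id using symmetric_is_const[OF 0(1)] by (simp add: dd_eq_0_iff)
  next
    case (Suc d)
    have "dd i f = 0" if i: "1 \<le> i" for i
    proof (rule Suc.IH)
      show "dd i f \<in> polys_in {1..}" using polys_in_dd Suc.prems(1) i by auto
      show "dual_fun w (dd i f) = 0" if "w \<in> S_infinity" for w
        using dual_fun_dd[OF that i, of f] Suc.prems(2)[OF S_infinity_comp_s[OF that i]] by argo
      show "total_degree e \<le> d" if "e \<in> keys (dd i f)" for e
        using dd_degree[of f "\<lambda>k. k \<le> Suc d" e i] Suc.prems(3) that by auto
    qed
    moreover have "dual_fun id f = 0" by (rule Suc.prems(2)[OF id_in_S_infinity])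
    ultimately show ?case unfolding dual_fun_id using symmetric_is_const[OF Suc.prems(1)] by (simp add: dd_eq_0_iff)
  qed
qed

text \<open>The difference between the product and the candidate expansion is annihilated by every
  functional, which gives existence. Applying the functionals to any expansion recovers its
  coefficients, which gives the uniqueness that the definite description requires.\<close>

lemma schubert_coeff_eq_dual_fun:
  assumes u: "u \<in> S_infinity" and v: "v \<in> S_infinity" and w: "w \<in> S_infinity"
  shows "schubert_coeff u v w = dual_fun w (schubert u * schubert v)"
proof -
  define f where "f = schubert u * schubert v"
  have f: "f \<in> polys_in {1..}" unfolding f_def using polys_in_mult schubert_polys_in u v by blast
  define h where "h w = (if w \<in> S_infinity then dual_fun w f else 0)" for w
  have "{w. h w \<noteq> 0} = {w \<in> S_infinity. dual_fun w f \<noteq> 0}" by (auto simp: h_def)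
  hence fin: "finite {w. h w \<noteq> 0}" using dual_fun_finite_support[of f] by simp
  define c where "c = Abs_poly_mapping h"
  have look: "lookup c w = h w" for w using fin by (simp add: c_def)
  have expand: "dual_fun w (\<Sum>w\<in>keys c. of_int (lookup c w) * schubert w) = lookup c w"
    if "w \<in> S_infinity" "keys c \<subseteq> S_infinity" for c :: "(nat \<Rightarrow> nat) \<Rightarrow>\<^sub>0 int" and w
  proof -
    have "dual_fun w (\<Sum>w\<in>keys c. of_int (lookup c w) * schubert w) = (\<Sum>x\<in>keys c. if w = x then lookup c x else 0)"
      unfolding dual_fun_sum[OF that(1)] using that
      by (intro sum.cong) (auto simp: dual_fun_of_int_mult dual_fun_schubert subset_iff)
    also have "\<dots> = lookup c w" by (simp add: sum.delta' in_keys_iff)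
    finally show ?thesis .
  qed
  have kc: "keys c \<subseteq> S_infinity" by (auto simp: in_keys_iff look h_def split: if_splits)
  have const: "of_int k = (single 0 k :: ipoly)" for k by (simp flip: single_of_int)
  have "f - (\<Sum>w\<in>keys c. of_int (lookup c w) * schubert w) = 0"
  proof (rule dual_fun_all_zero)
    show "f - (\<Sum>w\<in>keys c. of_int (lookup c w) * schubert w) \<in> polys_in {1..}"
      using kc unfolding const
      by (intro polys_in_diff f polys_in_sum polys_in_mult polys_in_const schubert_polys_in) auto
    show "dual_fun w (f - (\<Sum>w\<in>keys c. of_int (lookup c w) * schubert w)) = 0" if "w \<in> S_infinity" for w
      using that expand[OF that kc] by (simp add: dual_fun_diff look h_def)
  qed
  hence eq: "f = (\<Sum>w\<in>keys c. of_int (lookup c w) * schubert w)" by simp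
  have "schubert_expansion u v = c" unfolding schubert_expansion_def f_def[symmetric]
  proof (rule the_equality)
    fix c' assume c': "keys c' \<subseteq> S_infinity \<and> f = (\<Sum>w\<in>keys c'. of_int (lookup c' w) * schubert w)"
    show "c' = c"
    proof (rule poly_mapping_eqI)
      fix x show "lookup c' x = lookup c x"
      proof (cases "x \<in> S_infinity")
        case True
        thus ?thesis using expand[OF True, of c'] expand[OF True kc] c' eq by argo
      next
        case False
        hence "x \<notin> keys c'" "x \<notin> keys c" using c' kc by blast+
        thus ?thesis by (simp add: in_keys_iff)
      qed
    qed
  qed (use kc eq in blast)
  thus ?thesis using w by (simp add: schubert_coeff_def look h_def f_def)
qed

subsection \<open>Piecewise quasi-polynomials\<close>

text \<open>A point \<open>y\<close> is an environment with infinitely many integer coordinates, so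
  that parameter, exponents and summation variables can be substituted into one another.\<close>

inductive affine_form :: "((nat \<Rightarrow> int) \<Rightarrow> int) \<Rightarrow> bool" where
  const: "affine_form (\<lambda>y. c)"
| var: "affine_form (\<lambda>y. y i)"
| add: "affine_form f \<Longrightarrow> affine_form g \<Longrightarrow> affine_form (\<lambda>y. f y + g y)"
| scale: "affine_form f \<Longrightarrow> affine_form (\<lambda>y. c * f y)"

lemma affine_form_diff: assumes "affine_form f" "affine_form g" shows "affine_form (\<lambda>y. f y - g y)"
  using affine_form.add[OF assms(1) affine_form.scale[OF assms(2), of "-1"]] by simp

lemma affine_form_uminus: assumes "affine_form f" shows "affine_form (\<lambda>y. - f y)"
  using affine_form.scale[OF assms, of "-1"] by simp

lemma affine_form_subst:
  assumes "affine_form f" and \<sigma>: "\<And>i. affine_form (\<lambda>y. \<sigma> y i)"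
  shows "affine_form (\<lambda>y. f (\<sigma> y))"
  using assms(1)
proof (induction rule: affine_form.induct)
  case (var i) show ?case by (rule \<sigma>)
qed (intro affine_form.intros | assumption)+

lemma affine_form_fun_upd_var: "affine_form g \<Longrightarrow> affine_form (\<lambda>y. (y(i := g y)) j)"
  by (cases "j = i") (simp_all add: affine_form.var)

text \<open>Isolates the slope in one coordinate, the form in which a summation variable meets an
  affine form.\<close>

lemma affine_form_line:
  assumes "affine_form f" shows "\<exists>a. \<forall>y k. f (y(i := k)) = a * k + f (y(i := 0))"
  using assms
proof (induction rule: affine_form.induct)
  case (const c) show ?case by (rule exI[of _ 0]) simp
next
  case (var j)
  show ?case by (rule exI[of _ "if j = i then 1 else 0"]) simp
next
  case (add f g)
  then obtain a b where ab: "\<And>y k. f (y(i := k)) = a * k + f (y(i := 0))" "\<And>y k. g (y(i := k)) = b * k + g (y(i := 0))" by blast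
  have "f (y(i := k)) + g (y(i := k)) = (a + b) * k + (f (y(i := 0)) + g (y(i := 0)))" for y k
    by (simp add: ab(1)[of y k] ab(2)[of y k] algebra_simps)
  thus ?case by blast
next
  case (scale f c)
  then obtain a where a: "\<And>y k. f (y(i := k)) = a * k + f (y(i := 0))" by blast
  have "c * f (y(i := k)) = (c * a) * k + c * f (y(i := 0))" for y k
    by (simp add: a[of y k] algebra_simps)
  thus ?case by blast
qed

inductive pw_basic :: "((nat \<Rightarrow> int) \<Rightarrow> rat) \<Rightarrow> bool" where
  const: "pw_basic (\<lambda>y. c)"
| linear: "affine_form l \<Longrightarrow> pw_basic (\<lambda>y. of_int (l y))"
| nonneg: "affine_form l \<Longrightarrow> pw_basic (\<lambda>y. of_bool (0 \<le> l y))"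
| dvd: "affine_form l \<Longrightarrow> 0 < m \<Longrightarrow> pw_basic (\<lambda>y. of_bool (m dvd l y))"

text \<open>The algebra generated by \<open>pw_basic\<close>, built by multiplying with one basic
  factor at a time because summation absorbs the factors one by one.\<close>

inductive pw_quasi :: "((nat \<Rightarrow> int) \<Rightarrow> rat) \<Rightarrow> bool" where
  one: "pw_quasi (\<lambda>y. 1)"
| add: "pw_quasi F \<Longrightarrow> pw_quasi G \<Longrightarrow> pw_quasi (\<lambda>y. F y + G y)"
| mult_pw_basic: "pw_basic b \<Longrightarrow> pw_quasi F \<Longrightarrow> pw_quasi (\<lambda>y. b y * F y)"

lemma pw_quasi_pw_basic: "pw_basic b \<Longrightarrow> pw_quasi b"
  using pw_quasi.mult_pw_basic[OF _ pw_quasi.one, of b] by simp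

lemma pw_quasi_const: "pw_quasi (\<lambda>y. c)"
  by (rule pw_quasi_pw_basic[OF pw_basic.const])

lemma pw_quasi_mult: "pw_quasi F \<Longrightarrow> pw_quasi G \<Longrightarrow> pw_quasi (\<lambda>y. F y * G y)"
proof (induction rule: pw_quasi.induct)
  case (add F1 F2)
  have "pw_quasi (\<lambda>y. F1 y * G y + F2 y * G y)" by (intro pw_quasi.add add.IH add.prems)
  thus ?case by (simp add: distrib_right)
next
  case (mult_pw_basic b F)
  have "pw_quasi (\<lambda>y. b y * (F y * G y))" by (intro pw_quasi.mult_pw_basic mult_pw_basic)
  thus ?case by (simp add: mult.assoc)
qed simp

lemma pw_quasi_diff: assumes "pw_quasi F" "pw_quasi G" shows "pw_quasi (\<lambda>y. F y - G y)"
  using pw_quasi.add[OF assms(1) pw_quasi_mult[OF pw_quasi_const[of "-1"] assms(2)]] by simp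

lemma pw_quasi_sum: "(\<And>i. i \<in> A \<Longrightarrow> pw_quasi (F i)) \<Longrightarrow> pw_quasi (\<lambda>y. \<Sum>i\<in>A. F i y)"
  by (induction A rule: infinite_finite_induct) (auto intro: pw_quasi_const pw_quasi.add)

lemma pw_quasi_prod: "(\<And>i. i \<in> A \<Longrightarrow> pw_quasi (F i)) \<Longrightarrow> pw_quasi (\<lambda>y. \<Prod>i\<in>A. F i y)"
  by (induction A rule: infinite_finite_induct) (auto intro: pw_quasi_const pw_quasi_mult)

lemma pw_quasi_poly: "pw_quasi F \<Longrightarrow> pw_quasi (\<lambda>y. poly p (F y))"
  by (induction p) (auto intro: pw_quasi_const pw_quasi_mult pw_quasi.add)

lemma pw_basic_subst:
  assumes "pw_basic b" and \<sigma>: "\<And>i. affine_form (\<lambda>y. \<sigma> y i)"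
  shows "pw_basic (\<lambda>y. b (\<sigma> y))"
  using assms(1) by cases (auto intro!: pw_basic.intros affine_form_subst[OF _ \<sigma>])

lemma pw_quasi_subst:
  assumes "pw_quasi F" and \<sigma>: "\<And>i. affine_form (\<lambda>y. \<sigma> y i)"
  shows "pw_quasi (\<lambda>y. F (\<sigma> y))"
  using assms(1) by (induction rule: pw_quasi.induct) (auto intro: pw_quasi.intros pw_basic_subst[OF _ \<sigma>])

section \<open>Summation of powers over arithmetic progressions\<close>

lemma antidifference_power: "\<exists>P :: rat poly. \<forall>x. poly P x - poly P (x - 1) = x ^ n"
proof (induction n rule: less_induct)
  case (less n)
  then obtain Q :: "nat \<Rightarrow> rat poly" where Q: "\<And>j x. j < n \<Longrightarrow> poly (Q j) x - poly (Q j) (x - 1) = x ^ j"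
    by metis
  \<comment> \<open>By the binomial theorem x^(n+1) - (x - 1)^(n+1) is (n + 1) x^n minus lower
    powers with the coefficients \<open>c j\<close>; the \<open>Q j\<close> from the induction
    hypothesis cancel those.\<close>
  define c :: "nat \<Rightarrow> rat" where "c j = of_nat (Suc n choose j) * (-1) ^ (Suc n - j)" for j
  define P where "P = smult (1 / of_nat (Suc n)) (monom 1 (Suc n) + (\<Sum>j<n. smult (c j) (Q j)))"
  have "poly P x - poly P (x - 1) = x ^ n" for x
  proof -
    have "(x - 1) ^ Suc n = (\<Sum>j\<le>Suc n. c j * x ^ j)"
      using binomial_ring[of x "-1" "Suc n"] by (simp add: c_def mult_ac)
    also have "\<dots> = (\<Sum>j<n. c j * x ^ j) + c n * x ^ n + c (Suc n) * x ^ Suc n"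
      by (simp add: lessThan_Suc_atMost[symmetric])
    finally have pow: "(x - 1) ^ Suc n = (\<Sum>j<n. c j * x ^ j) - of_nat (Suc n) * x ^ n + x ^ Suc n"
      by (simp add: c_def algebra_simps)
    have "of_nat (Suc n) * (poly P x - poly P (x - 1))
        = x ^ Suc n - (x - 1) ^ Suc n + (\<Sum>j<n. c j * (poly (Q j) x - poly (Q j) (x - 1)))"
      by (simp add: P_def poly_sum poly_monom field_simps sum_subtractf del: of_nat_Suc power_Suc)
    also have "\<dots> = x ^ Suc n - (x - 1) ^ Suc n + (\<Sum>j<n. c j * x ^ j)"
      using Q by simp
    also have "\<dots> = of_nat (Suc n) * x ^ n" unfolding pow by simp
    finally show ?thesis by (simp del: of_nat_Suc)
  qed
  thus ?case by blast
qed

lemma antidifference: "\<exists>P :: rat poly. \<forall>x. poly P x - poly P (x - 1) = poly p x"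
proof -
  obtain Q :: "nat \<Rightarrow> rat poly" where Q: "\<And>j x. poly (Q j) x - poly (Q j) (x - 1) = x ^ j"
    using antidifference_power by metis
  have "poly (\<Sum>i\<le>degree p. smult (coeff p i) (Q i)) x - poly (\<Sum>i\<le>degree p. smult (coeff p i) (Q i)) (x - 1) = poly p x" for x
    by (simp add: poly_sum poly_altdef[of p] flip: sum_subtractf right_diff_distrib Q)
  thus ?thesis by blast
qed

lemma telescope_int:
  fixes P :: "rat poly"
  assumes "\<And>x. poly P x - poly P (x - 1) = poly p x" "V \<le> W"
  shows "(\<Sum>q\<in>{V<..W}. poly p (of_int q)) = poly P (of_int W) - poly P (of_int V)"
  using assms(2)
proof (induction W rule: int_ge_induct)
  case (step W)
  have "{V<..W + 1} = insert (W + 1) {V<..W}" using step by auto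
  thus ?case using step assms(1)[of "of_int (W + 1)"] by simp
qed simp

text \<open>On the residue class u \<equiv> \<rho> modulo D the quotient is (u - \<rho>) / D, and
  divisibility indicators select the class.\<close>

lemma pw_quasi_div:
  assumes u: "affine_form u" and D: "0 < D" shows "pw_quasi (\<lambda>y. of_int (u y div D))"
proof -
  have "of_int (u y div D) = (\<Sum>\<rho>\<in>{0..<D}. of_bool (D dvd u y - \<rho>) * (of_int (u y - \<rho>) * (1 / of_int D)) :: rat)" for y
  proof -
    have "D dvd u y - \<rho> \<longleftrightarrow> \<rho> = u y mod D" if "\<rho> \<in> {0..<D}" for \<rho>
      using that D by (metis atLeastLessThan_iff mod_eq_dvd_iff mod_pos_pos_trivial)
    hence "(\<Sum>\<rho>\<in>{0..<D}. of_bool (D dvd u y - \<rho>) * (of_int (u y - \<rho>) * (1 / of_int D)) :: rat)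
        = (\<Sum>\<rho>\<in>{0..<D}. if \<rho> = u y mod D then of_int (u y - \<rho>) * (1 / of_int D) else 0)"
      by (intro sum.cong) auto
    also have "\<dots> = of_int (u y - u y mod D) * (1 / of_int D)"
      using D by (simp add: sum.delta)
    also have "u y - u y mod D = D * (u y div D)" by (simp add: minus_mod_eq_mult_div)
    finally show ?thesis using D by simp
  qed
  moreover have "pw_quasi (\<lambda>y. \<Sum>\<rho>\<in>{0..<D}. of_bool (D dvd u y - \<rho>) * (of_int (u y - \<rho>) * (1 / of_int D)))"
    by (intro pw_quasi_sum pw_quasi_mult pw_quasi_const pw_quasi_pw_basic pw_basic.dvd pw_basic.linear affine_form_diff u affine_form.const D)
  ultimately show ?thesis by simp
qed

lemma int_le_div_iff: assumes "0 < (D::int)" shows "q \<le> u div D \<longleftrightarrow> D * q \<le> u"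
proof
  assume "q \<le> u div D"
  hence "D * q \<le> D * (u div D)" using assms by simp
  also have "\<dots> \<le> u" using assms by (simp add: minus_mod_eq_mult_div[symmetric])
  finally show "D * q \<le> u" .
next
  assume "D * q \<le> u"
  from zdiv_mono1[OF this assms] show "q \<le> u div D" using assms by simp
qed

definition progression :: "int \<Rightarrow> int \<Rightarrow> int \<Rightarrow> int \<Rightarrow> int \<Rightarrow> int set" where
  "progression c L U m r = {k. L \<le> c * k \<and> c * k \<le> U \<and> m dvd k - r}"

lemma finite_progression: assumes "0 < c" shows "finite (progression c L U m r)"
proof (rule finite_subset)
  show "progression c L U m r \<subseteq> {- \<bar>L\<bar>..\<bar>U\<bar>}"
  proof
    fix k assume "k \<in> progression c L U m r"
    hence k: "L \<le> c * k" "c * k \<le> U" by (auto simp: progression_def)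
    have "k \<ge> - \<bar>L\<bar>"
    proof (rule ccontr)
      assume "\<not> k \<ge> - \<bar>L\<bar>"
      hence "k < 0" "k < L" by auto
      moreover have "c * k \<le> 1 * k" using assms \<open>k < 0\<close> by (intro mult_right_mono_neg) auto
      ultimately show False using k by simp
    qed
    moreover have "k \<le> \<bar>U\<bar>"
    proof (rule ccontr)
      assume "\<not> k \<le> \<bar>U\<bar>"
      hence "k > 0" "k > U" by auto
      moreover have "1 * k \<le> c * k" using assms \<open>k > 0\<close> by (intro mult_right_mono) auto
      ultimately show False using k by simp
    qed
    ultimately show "k \<in> {- \<bar>L\<bar>..\<bar>U\<bar>}" by simp
  qed
qed simp

text \<open>Writing k = m q + r turns the range into the integers q with V < q \<le> W, where both
  bounds are floors of affine forms divided by D, and an antidifference telescopes.\<close>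

lemma pw_quasi_sum_power:
  assumes L: "affine_form L" and U: "affine_form U" and c: "0 < c" and m: "0 < m"
  shows "pw_quasi (\<lambda>y. \<Sum>k\<in>progression c (L y) (U y) m r. of_int k ^ p)"
proof -
  define D where "D = c * m"
  have D: "0 < D" using c m by (simp add: D_def)
  define pp :: "rat poly" where "pp = [:of_int r, of_int m:] ^ p"
  obtain P where P: "\<And>x. poly P x - poly P (x - 1) = poly pp x" using antidifference by blast
  \<comment> \<open>The subtracted 1 makes the lower bound strict: D q \<ge> L - c r means that D q
    exceeds L - c r - 1.\<close>
  define V where "V y = (L y - c * r - 1) div D" for y
  define W where "W y = (U y - c * r) div D" for y
  \<comment> \<open>The indicator guards the empty range: there V may exceed W, and the telescoped
    difference need not vanish.\<close>
  have "(\<Sum>k\<in>progression c (L y) (U y) m r. of_int k ^ p) = of_bool (0 \<le> U y - L y) * (poly P (of_int (W y)) - poly P (of_int (V y)))" for y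
  proof (cases "L y \<le> U y")
    case True
    have eq: "progression c (L y) (U y) m r = (\<lambda>q. m * q + r) ` {V y<..W y}"
    proof (intro set_eqI iffI)
      fix k assume "k \<in> progression c (L y) (U y) m r"
      hence k: "L y \<le> c * k" "c * k \<le> U y" "m dvd k - r" by (auto simp: progression_def)
      then obtain q where q: "k - r = m * q" by (auto simp: dvd_def)
      hence kq: "k = m * q + r" by simp
      have "D * q = c * k - c * r" by (simp add: D_def kq algebra_simps)
      hence "q \<le> W y" "\<not> q \<le> V y" using k D unfolding W_def V_def
        by (simp_all add: int_le_div_iff)
      thus "k \<in> (\<lambda>q. m * q + r) ` {V y<..W y}" using kq by auto
    next
      fix k assume "k \<in> (\<lambda>q. m * q + r) ` {V y<..W y}"
      then obtain q where kq: "k = m * q + r" and "q \<in> {V y<..W y}" by blast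
      hence q: "\<not> q \<le> V y" "q \<le> W y" by auto
      have "D * q = c * k - c * r" by (simp add: D_def kq algebra_simps)
      moreover have "D * q \<le> U y - c * r" "\<not> D * q \<le> L y - c * r - 1"
        using q D unfolding W_def V_def by (simp_all add: int_le_div_iff)
      ultimately show "k \<in> progression c (L y) (U y) m r" by (simp add: progression_def kq)
    qed
    have "inj_on (\<lambda>q. m * q + r) {V y<..W y}" using m by (auto simp: inj_on_def)
    hence "(\<Sum>k\<in>progression c (L y) (U y) m r. of_int k ^ p) = (\<Sum>q\<in>{V y<..W y}. poly pp (of_int q))"
      unfolding eq by (subst sum.reindex) (auto simp: pp_def poly_power algebra_simps)
    also have "\<dots> = poly P (of_int (W y)) - poly P (of_int (V y))"
      by (rule telescope_int[OF P]) (use True D in \<open>auto simp: V_def W_def intro!: zdiv_mono1\<close>)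
    finally show ?thesis using True by simp
  next
    case False
    hence "progression c (L y) (U y) m r = {}" by (auto simp: progression_def)
    thus ?thesis using False by simp
  qed
  moreover have "pw_quasi (\<lambda>y. of_bool (0 \<le> U y - L y) * (poly P (of_int (W y)) - poly P (of_int (V y))))"
    unfolding V_def W_def
    by (intro pw_quasi_mult pw_quasi_diff pw_quasi_poly pw_quasi_div pw_quasi_pw_basic[OF pw_basic.nonneg] affine_form_diff L U affine_form.const affine_form.scale D)
  ultimately show ?thesis by simp
qed

text \<open>The summation range carries the coefficient \<open>c\<close> so that an inequality \<open>a k + l \<ge> 0\<close> can be absorbed into
  the bounds after scaling, without dividing.\<close>

lemma pw_quasi_sum_progression:
  assumes "pw_quasi F" "pw_quasi A" "affine_form L" "affine_form U" "0 < c" "0 < m"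
  shows "pw_quasi (\<lambda>y. A y * (\<Sum>k\<in>progression c (L y) (U y) m r. of_int k ^ p * F (y(i := k))))"
  using assms
proof (induction arbitrary: A L U c m r p rule: pw_quasi.induct)
  case one
  show ?case using pw_quasi_mult[OF one(1) pw_quasi_sum_power[OF one(2-5)]] by simp
next
  case (add F G)
  from pw_quasi.add[OF add.IH(1)[OF add.prems] add.IH(2)[OF add.prems]]
  show ?case by (simp add: distrib_left sum.distrib)
next
  case (mult_pw_basic b F)
  note IH = mult_pw_basic.IH and prems = mult_pw_basic.prems
  have upd0: "affine_form (\<lambda>y. l (y(i := 0)))" if "affine_form l" for l
    by (rule affine_form_subst[OF that]) (intro affine_form_fun_upd_var affine_form.const)
  note fin = finite_progression[OF prems(4)]
  \<comment> \<open>The factor \<open>b\<close> is traded for a change in the arbitrary data: a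
    factor free of \<open>k\<close> moves into \<open>A\<close>, a linear one raises
    \<open>p\<close>, an inequality changes the bounds, a congruence refines the modulus.\<close>
  show ?case using mult_pw_basic.hyps(1)
  proof cases
    case (const d)
    have "pw_quasi (\<lambda>y. A y * d * (\<Sum>k\<in>progression c (L y) (U y) m r. of_int k ^ p * F (y(i := k))))"
      by (intro IH pw_quasi_mult pw_quasi_const prems)
    moreover have "A y * d * (\<Sum>k\<in>progression c (L y) (U y) m r. of_int k ^ p * F (y(i := k)))
        = A y * (\<Sum>k\<in>progression c (L y) (U y) m r. of_int k ^ p * (b (y(i := k)) * F (y(i := k))))" for y
      unfolding mult.assoc sum_distrib_left[of d] by (simp add: const mult_ac)
    ultimately show ?thesis by (simp only:)
  next
    case (linear l)
    obtain a where a: "\<And>y k. l (y(i := k)) = a * k + l (y(i := 0))" using affine_form_line[OF linear(2)] by blast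
    have b: "b (y(i := k)) = of_int (a * k + l (y(i := 0)))" for y k unfolding linear(1) by (subst a) (rule refl)
    have "pw_quasi (\<lambda>y. A y * of_int a * (\<Sum>k\<in>progression c (L y) (U y) m r. of_int k ^ Suc p * F (y(i := k)))
        + A y * of_int (l (y(i := 0))) * (\<Sum>k\<in>progression c (L y) (U y) m r. of_int k ^ p * F (y(i := k))))"
      by (intro pw_quasi.add IH pw_quasi_mult pw_quasi_const prems pw_quasi_pw_basic[OF pw_basic.linear] upd0 linear)
    moreover have "A y * of_int a * (\<Sum>k\<in>progression c (L y) (U y) m r. of_int k ^ Suc p * F (y(i := k)))
        + A y * of_int (l (y(i := 0))) * (\<Sum>k\<in>progression c (L y) (U y) m r. of_int k ^ p * F (y(i := k)))
        = A y * (\<Sum>k\<in>progression c (L y) (U y) m r. of_int k ^ p * (b (y(i := k)) * F (y(i := k))))" for y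
      unfolding sum_distrib_left sum.distrib[symmetric]
      by (intro sum.cong refl) (simp add: b algebra_simps)
    ultimately show ?thesis by (simp only:)
  next
    case (nonneg l)
    obtain a where a: "\<And>y k. l (y(i := k)) = a * k + l (y(i := 0))" using affine_form_line[OF nonneg(2)] by blast
    define l0 where "l0 y = l (y(i := 0))" for y
    have l0: "affine_form l0" unfolding l0_def by (rule upd0[OF nonneg(2)])
    have b: "b (y(i := k)) = of_bool (0 \<le> a * k + l0 y)" for y k by (simp add: nonneg(1) a[of y k] l0_def)
    have filt: "(\<Sum>k\<in>progression c (L y) (U y) m r. of_int k ^ p * (b (y(i := k)) * F (y(i := k))))
        = (\<Sum>k\<in>{k \<in> progression c (L y) (U y) m r. 0 \<le> a * k + l0 y}. of_int k ^ p * F (y(i := k)))" for y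
      by (subst sum.inter_filter[OF fin]) (auto simp: b intro!: sum.cong)
    consider "a = 0" | "a > 0" | "a < 0" by linarith
    then show ?thesis
    proof cases
      case 1
      have "pw_quasi (\<lambda>y. A y * of_bool (0 \<le> l0 y) * (\<Sum>k\<in>progression c (L y) (U y) m r. of_int k ^ p * F (y(i := k))))"
        by (intro IH pw_quasi_mult prems pw_quasi_pw_basic[OF pw_basic.nonneg] l0)
      moreover have "A y * of_bool (0 \<le> l0 y) * (\<Sum>k\<in>progression c (L y) (U y) m r. of_int k ^ p * F (y(i := k)))
         = A y * (\<Sum>k\<in>progression c (L y) (U y) m r. of_int k ^ p * (b (y(i := k)) * F (y(i := k))))" for y
        by (auto simp: b 1)
      ultimately show ?thesis by (simp only:)
    next
      case 2
      have le: "x \<le> y \<longleftrightarrow> a * x \<le> a * y" for x y using 2 by simp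
      have lec: "x \<le> y \<longleftrightarrow> c * x \<le> c * y" for x y using prems(4) by simp
      \<comment> \<open>After scaling, both lower bounds limit \<open>a * c * k\<close>; the case
        split keeps the larger one.\<close>
      have set_eq: "{k \<in> progression c (L y) (U y) m r. 0 \<le> a * k + l0 y} =
          (if 0 \<le> a * L y + c * l0 y then progression (a * c) (a * L y) (a * U y) m r else progression (a * c) (- c * l0 y) (a * U y) m r)" for y
      proof -
        have "0 \<le> a * k + l0 y \<longleftrightarrow> - c * l0 y \<le> a * c * k" for k
        proof -
          have "c * (a * k + l0 y) = a * c * k - (- c * l0 y)" by (simp add: algebra_simps)
          thus ?thesis using lec[of 0 "a * k + l0 y"] by (simp only: mult_zero_right diff_ge_0_iff_ge)
        qed
        moreover have "L y \<le> c * k \<longleftrightarrow> a * L y \<le> a * c * k" "c * k \<le> U y \<longleftrightarrow> a * c * k \<le> a * U y" for k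
          unfolding le[of "L y"] le[of _ "U y"] by (simp_all add: mult.assoc)
        ultimately show ?thesis by (auto simp: progression_def)
      qed
      \<comment> \<open>Over the integers the negation of \<open>0 \<le> x\<close> is
        \<open>0 \<le> - x - 1\<close>, so the complementary case is again selected by a basic
        factor.\<close>
      have "pw_quasi (\<lambda>y. A y * of_bool (0 \<le> a * L y + c * l0 y) * (\<Sum>k\<in>progression (a * c) (a * L y) (a * U y) m r. of_int k ^ p * F (y(i := k)))
         + A y * of_bool (0 \<le> - (a * L y + c * l0 y) - 1) * (\<Sum>k\<in>progression (a * c) (- c * l0 y) (a * U y) m r. of_int k ^ p * F (y(i := k))))"
        by (intro pw_quasi.add IH pw_quasi_mult prems pw_quasi_pw_basic[OF pw_basic.nonneg] affine_form.add affine_form_diff affine_form_uminus affine_form.scale affine_form.const l0 mult_pos_pos 2)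
      moreover have "A y * of_bool (0 \<le> a * L y + c * l0 y) * (\<Sum>k\<in>progression (a * c) (a * L y) (a * U y) m r. of_int k ^ p * F (y(i := k)))
         + A y * of_bool (0 \<le> - (a * L y + c * l0 y) - 1) * (\<Sum>k\<in>progression (a * c) (- c * l0 y) (a * U y) m r. of_int k ^ p * F (y(i := k)))
         = A y * (\<Sum>k\<in>progression c (L y) (U y) m r. of_int k ^ p * (b (y(i := k)) * F (y(i := k))))" for y
        unfolding filt set_eq by auto
      ultimately show ?thesis by (simp only:)
    next
      case 3
      define a' where "a' = - a"
      have a': "0 < a'" using 3 by (simp add: a'_def)
      have le: "x \<le> y \<longleftrightarrow> a' * x \<le> a' * y" for x y using a' by simp
      have lec: "x \<le> y \<longleftrightarrow> c * x \<le> c * y" for x y using prems(4) by simp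
      \<comment> \<open>With negative slope the inequality bounds \<open>k\<close> from above, and
        the smaller of the two upper bounds is kept.\<close>
      have set_eq: "{k \<in> progression c (L y) (U y) m r. 0 \<le> a * k + l0 y} =
          (if 0 \<le> c * l0 y - a' * U y then progression (a' * c) (a' * L y) (a' * U y) m r else progression (a' * c) (a' * L y) (c * l0 y) m r)" for y
      proof -
        have "0 \<le> a * k + l0 y \<longleftrightarrow> a' * c * k \<le> c * l0 y" for k
        proof -
          have "c * (a * k + l0 y) = c * l0 y - a' * c * k" by (simp add: algebra_simps a'_def)
          thus ?thesis using lec[of 0 "a * k + l0 y"] by (simp only: mult_zero_right diff_ge_0_iff_ge)
        qed
        moreover have "L y \<le> c * k \<longleftrightarrow> a' * L y \<le> a' * c * k" "c * k \<le> U y \<longleftrightarrow> a' * c * k \<le> a' * U y" for k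
          unfolding le[of "L y"] le[of _ "U y"] by (simp_all add: mult.assoc)
        ultimately show ?thesis by (auto simp: progression_def)
      qed
      have "pw_quasi (\<lambda>y. A y * of_bool (0 \<le> c * l0 y - a' * U y) * (\<Sum>k\<in>progression (a' * c) (a' * L y) (a' * U y) m r. of_int k ^ p * F (y(i := k)))
         + A y * of_bool (0 \<le> - (c * l0 y - a' * U y) - 1) * (\<Sum>k\<in>progression (a' * c) (a' * L y) (c * l0 y) m r. of_int k ^ p * F (y(i := k))))"
        by (intro pw_quasi.add IH pw_quasi_mult prems pw_quasi_pw_basic[OF pw_basic.nonneg] affine_form.add affine_form_diff affine_form_uminus affine_form.scale affine_form.const l0 mult_pos_pos a')
      moreover have "A y * of_bool (0 \<le> c * l0 y - a' * U y) * (\<Sum>k\<in>progression (a' * c) (a' * L y) (a' * U y) m r. of_int k ^ p * F (y(i := k)))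
         + A y * of_bool (0 \<le> - (c * l0 y - a' * U y) - 1) * (\<Sum>k\<in>progression (a' * c) (a' * L y) (c * l0 y) m r. of_int k ^ p * F (y(i := k)))
         = A y * (\<Sum>k\<in>progression c (L y) (U y) m r. of_int k ^ p * (b (y(i := k)) * F (y(i := k))))" for y
        unfolding filt set_eq by auto
      ultimately show ?thesis by (simp only:)
    qed
  next
    case (dvd l d)
    obtain a where a: "\<And>y k. l (y(i := k)) = a * k + l (y(i := 0))" using affine_form_line[OF dvd(2)] by blast
    define l0 where "l0 y = l (y(i := 0))" for y
    have l0: "affine_form l0" unfolding l0_def by (rule upd0[OF dvd(2)])
    have b: "b (y(i := k)) = of_bool (d dvd a * k + l0 y)" for y k by (simp add: dvd(1) a[of y k] l0_def)
    have md: "0 < m * d" using prems(5) dvd(3) by simp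
    \<comment> \<open>A residue modulo \<open>m * d\<close> fixes \<open>k\<close> modulo
      \<open>m\<close> and modulo \<open>d\<close>, so on each class both congruences are decided by
      \<open>\<rho>\<close> and \<open>y\<close> alone.\<close>
    have "pw_quasi (\<lambda>y. \<Sum>\<rho>\<in>{0..<m * d}. A y * of_bool (d dvd a * \<rho> + l0 y) * of_bool (m dvd \<rho> - r) *
        (\<Sum>k\<in>progression c (L y) (U y) (m * d) \<rho>. of_int k ^ p * F (y(i := k))))"
      by (intro pw_quasi_sum IH pw_quasi_mult prems pw_quasi_const pw_quasi_pw_basic[OF pw_basic.dvd] affine_form.add affine_form.const l0 md dvd(3))
    moreover have "(\<Sum>\<rho>\<in>{0..<m * d}. A y * of_bool (d dvd a * \<rho> + l0 y) * of_bool (m dvd \<rho> - r) *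
        (\<Sum>k\<in>progression c (L y) (U y) (m * d) \<rho>. of_int k ^ p * F (y(i := k))))
        = A y * (\<Sum>k\<in>progression c (L y) (U y) m r. of_int k ^ p * (b (y(i := k)) * F (y(i := k))))" (is "?lhs = _") for y
    proof -
      let ?S = "progression c (L y) (U y) m r"
      have "(\<Sum>k\<in>?S. of_int k ^ p * (b (y(i := k)) * F (y(i := k)))) =
          (\<Sum>\<rho>\<in>{0..<m * d}. \<Sum>k\<in>{k \<in> ?S. k mod (m * d) = \<rho>}. of_int k ^ p * (b (y(i := k)) * F (y(i := k))))"
        using md by (intro sum.group[symmetric] fin) auto
      also have "\<dots> = (\<Sum>\<rho>\<in>{0..<m * d}. of_bool (d dvd a * \<rho> + l0 y) * of_bool (m dvd \<rho> - r) *
          (\<Sum>k\<in>progression c (L y) (U y) (m * d) \<rho>. of_int k ^ p * F (y(i := k))))"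
      proof (intro sum.cong refl)
        fix \<rho> assume \<rho>: "\<rho> \<in> {0..<m * d}"
        have modeq: "k mod (m * d) = \<rho> \<longleftrightarrow> m * d dvd k - \<rho>" for k
          using \<rho> by (metis atLeastLessThan_iff mod_eq_dvd_iff mod_pos_pos_trivial)
        have m_iff: "m dvd k - r \<longleftrightarrow> m dvd \<rho> - r" if "m * d dvd k - \<rho>" for k
        proof -
          have 1: "m dvd k - \<rho>" by (rule dvd_mult_left[OF that])
          have 2: "k - r = (k - \<rho>) + (\<rho> - r)" by simp
          show ?thesis unfolding 2 by (rule dvd_add_right_iff[OF 1])
        qed
        have d_iff: "d dvd a * k + l0 y \<longleftrightarrow> d dvd a * \<rho> + l0 y" if "m * d dvd k - \<rho>" for k
        proof -
          have 1: "d dvd a * (k - \<rho>)" by (rule dvd_mult, rule dvd_mult_right[OF that])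
          have 2: "a * k + l0 y = a * (k - \<rho>) + (a * \<rho> + l0 y)" by (simp add: algebra_simps)
          show ?thesis unfolding 2 by (rule dvd_add_right_iff[OF 1])
        qed
        have set_eq: "{k \<in> ?S. k mod (m * d) = \<rho>} = (if m dvd \<rho> - r then progression c (L y) (U y) (m * d) \<rho> else {})"
        proof (rule set_eqI)
          fix k
          show "k \<in> {k \<in> ?S. k mod (m * d) = \<rho>} \<longleftrightarrow> k \<in> (if m dvd \<rho> - r then progression c (L y) (U y) (m * d) \<rho> else {})"
            unfolding mem_Collect_eq modeq progression_def using m_iff[of k] by (cases "m dvd \<rho> - r") (simp_all, blast+)
        qed
        show "(\<Sum>k\<in>{k \<in> ?S. k mod (m * d) = \<rho>}. of_int k ^ p * (b (y(i := k)) * F (y(i := k)))) =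
          of_bool (d dvd a * \<rho> + l0 y) * of_bool (m dvd \<rho> - r) * (\<Sum>k\<in>progression c (L y) (U y) (m * d) \<rho>. of_int k ^ p * F (y(i := k)))"
        proof (cases "m dvd \<rho> - r")
          case True
          have "(\<Sum>k\<in>progression c (L y) (U y) (m * d) \<rho>. of_int k ^ p * (b (y(i := k)) * F (y(i := k))))
             = (\<Sum>k\<in>progression c (L y) (U y) (m * d) \<rho>. of_bool (d dvd a * \<rho> + l0 y) * (of_int k ^ p * F (y(i := k))))"
          proof (intro sum.cong refl)
            fix k assume "k \<in> progression c (L y) (U y) (m * d) \<rho>"
            hence "m * d dvd k - \<rho>" by (simp only: progression_def mem_Collect_eq)
            from d_iff[OF this] show "of_int k ^ p * (b (y(i := k)) * F (y(i := k))) =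
                of_bool (d dvd a * \<rho> + l0 y) * (of_int k ^ p * F (y(i := k)))"
              by (simp only: b mult.left_commute)
          qed
          thus ?thesis unfolding set_eq if_P[OF True] by (simp only: True of_bool_eq mult_1_right sum_distrib_left)
        qed (simp add: set_eq)
      qed
      finally show ?thesis by (simp add: sum_distrib_left mult.assoc)
    qed
    ultimately show ?thesis by (simp only:)
  qed
qed

lemma pw_quasi_sum_upto:
  assumes "pw_quasi F" "affine_form l" shows "pw_quasi (\<lambda>y. \<Sum>k\<in>{0..l y}. F (y(i := k)))"
proof -
  have "progression 1 0 (l y) 1 0 = {0..l y}" for y by (auto simp: progression_def)
  thus ?thesis using pw_quasi_sum_progression[where i = i and p = 0 and r = 0, OF assms(1) pw_quasi_const[of 1] affine_form.const[of 0] assms(2), of 1 1] by simp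
qed

section \<open>Quasi-polynomials in one parameter\<close>

definition quasi_poly :: "(nat \<Rightarrow> rat) \<Rightarrow> bool" where
  "quasi_poly f \<longleftrightarrow> (\<exists>m\<ge>1. \<exists>g. \<forall>\<^sub>F N in sequentially. f N = poly (g (N mod m)) (of_nat N))"

lemma quasi_poly_poly: "quasi_poly (\<lambda>N. poly p (of_nat N))"
  unfolding quasi_poly_def by (intro exI[of _ 1] conjI exI[of _ "\<lambda>_. p"]) auto

lemma quasi_poly_const: "quasi_poly (\<lambda>N. c)"
  using quasi_poly_poly[of "[:c:]"] by simp

lemma quasi_poly_cong: "quasi_poly f \<Longrightarrow> (\<forall>\<^sub>F N in sequentially. f N = g N) \<Longrightarrow> quasi_poly g"
  unfolding quasi_poly_def by (elim exE conjE, intro exI conjI, assumption) (erule (1) eventually_elim2, simp)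

lemma quasi_poly_binop:
  assumes "quasi_poly f" "quasi_poly f'" and h: "\<And>p q x. poly (H p q) x = h (poly p x) (poly q x)"
  shows "quasi_poly (\<lambda>N. h (f N) (f' N))"
proof -
  obtain m g where 1: "m \<ge> 1" "\<forall>\<^sub>F N in sequentially. f N = poly (g (N mod m)) (of_nat N)"
    using assms(1) by (auto simp: quasi_poly_def)
  obtain m' g' where 2: "m' \<ge> 1" "\<forall>\<^sub>F N in sequentially. f' N = poly (g' (N mod m')) (of_nat N)"
    using assms(2) by (auto simp: quasi_poly_def)
  have "\<forall>\<^sub>F N in sequentially. h (f N) (f' N) = poly (H (g (N mod (m * m') mod m)) (g' (N mod (m * m') mod m'))) (of_nat N)"
    using 1(2) 2(2) by eventually_elim (simp add: h mod_mod_cancel)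
  thus ?thesis unfolding quasi_poly_def
    by (intro exI[of _ "m * m'"] conjI exI[of _ "\<lambda>i. H (g (i mod m)) (g' (i mod m'))"]) (use 1 2 in auto)
qed

lemma quasi_poly_add: "quasi_poly f \<Longrightarrow> quasi_poly g \<Longrightarrow> quasi_poly (\<lambda>N. f N + g N)"
  by (rule quasi_poly_binop[of _ _ "(+)"]) auto

lemma quasi_poly_mult: "quasi_poly f \<Longrightarrow> quasi_poly g \<Longrightarrow> quasi_poly (\<lambda>N. f N * g N)"
  by (rule quasi_poly_binop[of _ _ "(*)"]) auto

lemma affine_eventually_nonneg:
  fixes a b :: int
  shows "(\<forall>\<^sub>F N in sequentially. 0 \<le> a * int N + b) \<or> (\<forall>\<^sub>F N in sequentially. a * int N + b < 0)"
proof -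
  consider "a = 0" | "a > 0" | "a < 0" by linarith
  then show ?thesis
  proof cases
    case 2
    have "0 \<le> a * int N + b" if "N \<ge> nat \<bar>b\<bar>" for N
    proof -
      have "1 * int N \<le> a * int N" using 2 by (intro mult_right_mono) auto
      thus ?thesis using that by linarith
    qed
    thus ?thesis by (auto simp: eventually_sequentially)
  next
    case 3
    have "a * int N + b < 0" if "N \<ge> Suc (nat \<bar>b\<bar>)" for N
    proof -
      have "a * int N \<le> (-1) * int N" using 3 by (intro mult_right_mono) auto
      thus ?thesis using that by linarith
    qed
    thus ?thesis by (auto simp: eventually_sequentially)
  qed (cases "b \<ge> 0", auto)
qed

text \<open>The environment that remains when no variables are left: coordinate 0 carries the
  parameter, and everything else is 0.\<close>

definition time_env :: "nat \<Rightarrow> nat \<Rightarrow> int" where "time_env N = (\<lambda>i. 0)(0 := int N)"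

lemma quasi_poly_pw_basic: assumes "pw_basic b" shows "quasi_poly (\<lambda>N. b (time_env N))"
proof -
  have line: "\<exists>a c. \<forall>N. l (time_env N) = a * int N + c" if "affine_form l" for l
    using affine_form_line[OF that, of 0] unfolding time_env_def by blast
  show ?thesis using assms
  proof cases
    case (const c)
    thus ?thesis using quasi_poly_const by simp
  next
    case (linear l)
    then obtain a c where "\<And>N. l (time_env N) = a * int N + c" using line by blast
    thus ?thesis using quasi_poly_poly[of "[:of_int c, of_int a:]"] linear by (simp add: algebra_simps)
  next
    case (nonneg l)
    then obtain a c where l: "\<And>N. l (time_env N) = a * int N + c" using line by blast
    from affine_eventually_nonneg[of a c] show ?thesis
    proof
      assume "\<forall>\<^sub>F N in sequentially. 0 \<le> a * int N + c"
      hence "\<forall>\<^sub>F N in sequentially. 1 = b (time_env N)" by eventually_elim (simp add: nonneg(1) l)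
      thus ?thesis by (rule quasi_poly_cong[OF quasi_poly_const])
    next
      assume "\<forall>\<^sub>F N in sequentially. a * int N + c < 0"
      hence "\<forall>\<^sub>F N in sequentially. 0 = b (time_env N)" by eventually_elim (simp add: nonneg(1) l)
      thus ?thesis by (rule quasi_poly_cong[OF quasi_poly_const])
    qed
  next
    case (dvd l m)
    then obtain a c where l: "\<And>N. l (time_env N) = a * int N + c" using line by blast
    have "b (time_env N) = poly [:of_bool (m dvd a * int (N mod nat m) + c):] (of_nat N)" for N
    proof -
      have "a * int N + c - (a * int (N mod nat m) + c) = m * (a * (int N div m))"
        using dvd(3) by (simp add: zmod_int minus_mod_eq_mult_div algebra_simps flip: right_diff_distrib)
      hence "m dvd a * int N + c \<longleftrightarrow> m dvd a * int (N mod nat m) + c"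
        by (metis dvd_triv_left dvd_diff_right_iff dvd_add_right_iff diff_add_cancel)
      thus ?thesis by (simp add: dvd(1) l)
    qed
    thus ?thesis unfolding quasi_poly_def
      by (intro exI[of _ "nat m"] conjI exI[of _ "\<lambda>i. [:of_bool (m dvd a * int i + c):]"]) (use dvd(3) in auto)
  qed
qed

lemma quasi_poly_pw_quasi: "pw_quasi F \<Longrightarrow> quasi_poly (\<lambda>N. F (time_env N))"
  by (induction rule: pw_quasi.induct) (auto intro: quasi_poly_const quasi_poly_add quasi_poly_mult quasi_poly_pw_basic)

lemma quasi_poly_imp_eventually_quasi_polynomial:
  assumes "quasi_poly (\<lambda>N. of_int (f N))" shows "eventually_quasi_polynomial f"
proof -
  obtain m g where m: "m \<ge> 1" and "\<forall>\<^sub>F N in sequentially. (of_int (f N) :: rat) = poly (g (N mod m)) (of_nat N)"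
    using assms by (auto simp: quasi_poly_def)
  then obtain M where "\<And>N. N \<ge> M \<Longrightarrow> (of_int (f N) :: rat) = poly (g (N mod m)) (of_nat N)"
    by (auto simp: eventually_sequentially)
  thus ?thesis unfolding eventually_quasi_polynomial_def using m
    by (intro exI[of _ m] exI[of _ "max 1 M"] exI[of _ g]) auto
qed

subsection \<open>Rationality of the generating function\<close>

lemma is_rational_fps_add:
  assumes "is_rational_fps F" "is_rational_fps G" shows "is_rational_fps (F + G)"
proof -
  obtain p q p' q' where *: "q \<noteq> 0" "fps_of_poly q * F = fps_of_poly p" "q' \<noteq> 0" "fps_of_poly q' * G = fps_of_poly p'"
    using assms by (auto simp: is_rational_fps_def)
  have "fps_of_poly (q * q') * (F + G) = fps_of_poly q' * (fps_of_poly q * F) + fps_of_poly q * (fps_of_poly q' * G)"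
    by (simp add: fps_of_poly_mult algebra_simps)
  also have "\<dots> = fps_of_poly (q' * p + q * p')" by (simp add: * fps_of_poly_mult fps_of_poly_add)
  finally show ?thesis using * unfolding is_rational_fps_def by (intro exI[of _ "q' * p + q * p'"] exI[of _ "q * q'"]) auto
qed

lemma is_rational_fps_of_poly: "is_rational_fps (fps_of_poly p)"
  unfolding is_rational_fps_def by (rule exI[of _ p], rule exI[of _ 1]) simp

lemma is_rational_fps_const_mult: assumes "is_rational_fps F" shows "is_rational_fps (fps_const c * F)"
proof -
  obtain p q where "q \<noteq> 0" "fps_of_poly q * F = fps_of_poly p" using assms by (auto simp: is_rational_fps_def)
  hence "fps_of_poly q * (fps_const c * F) = fps_of_poly (smult c p)"
    by (simp add: fps_of_poly_smult mult.left_commute)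
  thus ?thesis using \<open>q \<noteq> 0\<close> unfolding is_rational_fps_def by blast
qed

lemma is_rational_fps_sum:
  "(\<And>i. i \<in> A \<Longrightarrow> is_rational_fps (F i)) \<Longrightarrow> is_rational_fps (\<Sum>i\<in>A. F i)"
  by (induction A rule: infinite_finite_induct) (auto intro: is_rational_fps_add is_rational_fps_of_poly[of 0, simplified])

text \<open>The operator x d/dx multiplies the coefficient of x^N by N; by the quotient rule it
  squares the denominator.\<close>

lemma is_rational_fps_theta: assumes "is_rational_fps F" shows "is_rational_fps (fps_X * fps_deriv F)"
proof -
  obtain p q where q: "q \<noteq> 0" "fps_of_poly q * F = fps_of_poly p" using assms by (auto simp: is_rational_fps_def)
  have d: "fps_of_poly (pderiv q) * F + fps_of_poly q * fps_deriv F = fps_of_poly (pderiv p)"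
    using arg_cong[OF q(2), of fps_deriv] by (simp add: fps_of_poly_pderiv add.commute)
  have "fps_of_poly (q * q) * (fps_X * fps_deriv F) = fps_X * (fps_of_poly q * (fps_of_poly q * fps_deriv F))"
    by (simp add: fps_of_poly_mult mult_ac)
  also have "fps_of_poly q * fps_deriv F = fps_of_poly (pderiv p) - fps_of_poly (pderiv q) * F" using d by (simp add: algebra_simps)
  also have "fps_X * (fps_of_poly q * (fps_of_poly (pderiv p) - fps_of_poly (pderiv q) * F))
      = fps_X * (fps_of_poly q * fps_of_poly (pderiv p) - fps_of_poly (pderiv q) * (fps_of_poly q * F))"
    by (simp add: algebra_simps)
  also have "\<dots> = fps_of_poly ([:0, 1:] * (q * pderiv p - pderiv q * p))"
    by (simp only: q(2) fps_of_poly_mult fps_of_poly_diff) (simp add: fps_of_poly_fps_X)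
  finally show ?thesis using q(1) unfolding is_rational_fps_def by (metis no_zero_divisors)
qed

text \<open>For k = 0 this is x^i / (1 - x^m); each further factor N comes from x d/dx.\<close>

lemma is_rational_fps_progression:
  assumes "m \<ge> 1" "i < m"
  shows "is_rational_fps (Abs_fps (\<lambda>N. of_bool (N mod m = i) * of_nat N ^ k :: rat))"
proof (induction k)
  case 0
  have "fps_of_poly (1 - monom 1 m) * Abs_fps (\<lambda>N. of_bool (N mod m = i) * of_nat N ^ 0) = (fps_of_poly (monom 1 i) :: rat fps)"
  proof (rule fps_ext)
    fix N
    have "N mod m = (N - m) mod m" if "m \<le> N" using that by (metis le_mod_geq)
    thus "fps_nth (fps_of_poly (1 - monom 1 m) * Abs_fps (\<lambda>N. of_bool (N mod m = i) * of_nat N ^ 0)) N = fps_nth (fps_of_poly (monom 1 i) :: rat fps) N"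
      using assms
      by (cases "m \<le> N") (auto simp: fps_of_poly_diff fps_of_poly_monom' left_diff_distrib fps_X_power_mult_nth fps_of_poly_nth coeff_monom simp flip: not_le)
  qed
  moreover have "(1 :: rat poly) - monom 1 m \<noteq> 0"
  proof
    assume "(1 :: rat poly) - monom 1 m = 0"
    hence "coeff ((1 :: rat poly) - monom 1 m) 0 = 0" by simp
    thus False using assms by (simp add: coeff_monom)
  qed
  ultimately show ?case unfolding is_rational_fps_def by blast
next
  case (Suc k)
  have "fps_X * fps_deriv (Abs_fps (\<lambda>N. of_bool (N mod m = i) * of_nat N ^ k)) =
      (Abs_fps (\<lambda>N. of_bool (N mod m = i) * of_nat N ^ Suc k) :: rat fps)"
    by (rule fps_ext) (auto simp: fps_X_mult_nth)
  thus ?case using is_rational_fps_theta[OF Suc] by metis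
qed

lemma quasi_poly_imp_rational:
  assumes "quasi_poly f" shows "is_rational_fps (Abs_fps f)"
proof -
  obtain m g where m: "m \<ge> 1" and "\<forall>\<^sub>F N in sequentially. f N = poly (g (N mod m)) (of_nat N)"
    using assms by (auto simp: quasi_poly_def)
  then obtain M where M: "\<And>N. N \<ge> M \<Longrightarrow> f N = poly (g (N mod m)) (of_nat N)"
    by (auto simp: eventually_sequentially)
  define G where "G = (\<Sum>i<m. \<Sum>k\<le>degree (g i). fps_const (coeff (g i) k) * Abs_fps (\<lambda>N. of_bool (N mod m = i) * of_nat N ^ k))"
  have G: "fps_nth G N = poly (g (N mod m)) (of_nat N)" for N
  proof -
    have "fps_nth G N = (\<Sum>i<m. if i = N mod m then poly (g i) (of_nat N) else 0)"
      unfolding G_def fps_sum_nth by (intro sum.cong refl) (auto simp: poly_altdef)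
    thus ?thesis using m by (simp add: sum.delta)
  qed
  \<comment> \<open>The polynomial that corrects the finitely many values below the threshold
    \<open>M\<close>.\<close>
  define C where "C = (\<Sum>N<M. monom (f N - fps_nth G N) N)"
  have C: "coeff C N = (if N < M then f N - fps_nth G N else 0)" for N
    unfolding C_def coeff_sum by (auto simp: coeff_monom sum.delta if_distrib cong: if_cong)
  have "Abs_fps f = G + fps_of_poly C"
    by (rule fps_ext) (use C G M in \<open>auto simp: fps_of_poly_nth not_less\<close>)
  moreover have "is_rational_fps G" unfolding G_def
    by (intro is_rational_fps_sum is_rational_fps_const_mult is_rational_fps_progression m) simp
  ultimately show ?thesis using is_rational_fps_add is_rational_fps_of_poly by metis
qed

subsection \<open>Complete homogeneous polynomials\<close>

fun complete_hom :: "nat \<Rightarrow> nat \<Rightarrow> ipoly" where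
  "complete_hom m 0 = 1"
| "complete_hom 0 (Suc j) = 0"
| "complete_hom (Suc m) (Suc j) = complete_hom m (Suc j) + X (Suc m) * complete_hom (Suc m) j"

lemma complete_hom_polys_in: "complete_hom m j \<in> polys_in {1..m}"
proof (induction m j rule: complete_hom.induct)
  case (3 m j)
  thus ?case by (auto intro!: polys_in_add polys_in_mult polys_in_X elim: polys_in_mono)
qed simp_all

lemma lookup_complete_hom_0: "lookup (complete_hom m j) 0 = (if j = 0 then 1 else 0)"
proof (induction m j rule: complete_hom.induct)
  case (3 m j)
  have "single (Suc m) (1::nat) \<noteq> 0"
  proof
    assume "single (Suc m) (1::nat) = 0"
    from arg_cong[OF this, of "\<lambda>e. lookup e (Suc m)"] show False by simp
  qed
  hence "lookup (X (Suc m)) 0 = 0" unfolding X_def by (rule lookup_single_not_eq)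
  thus ?case using 3 by (simp add: lookup_add lookup_0_mult)
qed simp_all

text \<open>In generating functions this is 1/(1 - a t) - 1/(1 - b t) = (a - b) t / ((1 - a t)(1 - b
  t)) for the last variable a and the next variable b; it is checked by induction on the
  degree.\<close>

lemma complete_hom_diff_swap: "complete_hom (Suc m) (Suc j) - swap_vars (Suc m) (complete_hom (Suc m) (Suc j)) = simple_root (Suc m) * complete_hom (Suc (Suc m)) j"
proof (induction j)
  have sw: "swap_vars (Suc m) (complete_hom m j) = complete_hom m j" for j
    by (rule polys_in_symmetric[OF _ _ complete_hom_polys_in]) auto
  {
    case 0
    show ?case using sw[of "Suc 0"] by (simp add: swap_vars_add swap_vars_mult swap_vars_X simple_root_def)
  next
    case (Suc j)
    let ?A = "complete_hom (Suc m) (Suc j)" and ?m = "Suc m"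
    have "complete_hom ?m (Suc (Suc j)) - swap_vars ?m (complete_hom ?m (Suc (Suc j)))
        = X ?m * ?A - X (Suc ?m) * swap_vars ?m ?A"
      unfolding complete_hom.simps(3)[of m "Suc j"] by (simp only: swap_vars_add swap_vars_mult sw swap_vars_X s_simps) simp
    also have "\<dots> = simple_root ?m * ?A + X (Suc ?m) * (?A - swap_vars ?m ?A)"
      by (simp only: simple_root_def algebra_simps)
    also have "\<dots> = simple_root ?m * (?A + X (Suc ?m) * complete_hom (Suc ?m) j)"
      unfolding Suc by (simp only: algebra_simps)
    finally show ?case by (simp only: complete_hom.simps(3)[of ?m j])
  }
qed

lemma dd_complete_hom: assumes "1 \<le> m" shows "dd m (complete_hom m (Suc j)) = complete_hom (Suc m) j"
proof -
  obtain m' where "m = Suc m'" using assms by (cases m) auto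
  thus ?thesis using complete_hom_diff_swap[of m' j] by (intro dd_unique) (simp only:)
qed

text \<open>For the last pair of variables the polynomial is itself a divided difference, namely of
  the complete homogeneous polynomial of degree one higher in one variable fewer, and images of
  divided differences are symmetric.\<close>

lemma swap_vars_complete_hom: "1 \<le> i \<Longrightarrow> i < m \<Longrightarrow> swap_vars i (complete_hom m j) = complete_hom m j"
proof (induction m j rule: complete_hom.induct)
  case (3 m j)
  show ?case
  proof (cases "i = m")
    case True
    show ?thesis using dd_complete_hom[of i "Suc j"] swap_vars_dd[of i "complete_hom i (Suc (Suc j))"] 3(3) True by simp
  next
    case False
    hence "i < m" using 3 by simp
    thus ?thesis using 3 False by (simp add: swap_vars_add swap_vars_mult swap_vars_X s_other)
  qed
qed simp_all

text \<open>The generating function \<open>(1 - x\<^sub>1 t) .. (1 - x\<^sub>n t)\<close>, inverse to that of the complete homogeneous polynomials.\<close>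

primrec signed_elem :: "nat \<Rightarrow> ipoly fps" where
  "signed_elem 0 = 1"
| "signed_elem (Suc n) = signed_elem n * (1 - fps_const (X (Suc n)) * fps_X)"

lemma signed_elem_Suc_nth:
  "fps_nth (signed_elem (Suc n)) r = fps_nth (signed_elem n) r - (if r = 0 then 0 else X (Suc n) * fps_nth (signed_elem n) (r - 1))"
proof -
  have "signed_elem (Suc n) = signed_elem n - fps_const (X (Suc n)) * (fps_X * signed_elem n)" by (simp add: algebra_simps)
  thus ?thesis by (simp del: signed_elem.simps)
qed

lemma signed_elem_nth_0: "n < r \<Longrightarrow> fps_nth (signed_elem n) r = 0"
proof (induction n arbitrary: r)
  case (Suc n)
  thus ?case unfolding signed_elem_Suc_nth by simp
qed simp

lemma signed_elem_nth_polys_in: "fps_nth (signed_elem n) r \<in> polys_in {1..n}"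
proof (induction n arbitrary: r)
  case (Suc n)
  have "fps_nth (signed_elem n) r \<in> polys_in {1..Suc n}" for r using polys_in_mono[OF Suc] by auto
  thus ?case unfolding signed_elem_Suc_nth by (auto intro!: polys_in_diff polys_in_mult polys_in_X)
qed (simp add: fps_one_nth)

text \<open>As series in t, 1/(1 - x_(n+1) t) is (1 - x_1 t) .. (1 - x_n t) times the generating
  function of the complete homogeneous polynomials in n + 1 variables.\<close>

lemma X_power_complete_hom: "X (Suc n) ^ e = (\<Sum>r\<le>e. fps_nth (signed_elem n) r * complete_hom (Suc n) (e - r))"
proof -
  define hh where "hh m = Abs_fps (complete_hom m)" for m
  have hh: "hh (Suc m) * (1 - fps_const (X (Suc m)) * fps_X) = hh m" for m
  proof (rule fps_ext)
    fix j
    have "hh (Suc m) * (1 - fps_const (X (Suc m)) * fps_X) = hh (Suc m) - fps_const (X (Suc m)) * (fps_X * hh (Suc m))"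
      by (simp add: algebra_simps)
    thus "fps_nth (hh (Suc m) * (1 - fps_const (X (Suc m)) * fps_X)) j = fps_nth (hh m) j"
      by (cases j) (simp_all add: hh_def)
  qed
  have "complete_hom 0 j = fps_nth 1 j" for j by (cases j) simp_all
  hence "hh 0 = 1" by (intro fps_ext) (simp add: hh_def)
  have 1: "signed_elem n * hh n = 1"
  proof (induction n)
    case (Suc n)
    have "signed_elem (Suc n) * hh (Suc n) = signed_elem n * (hh (Suc n) * (1 - fps_const (X (Suc n)) * fps_X))"
      by (simp add: mult_ac)
    thus ?case using Suc by (simp only: hh)
  qed (simp add: \<open>hh 0 = 1\<close>)
  define geo where "geo = Abs_fps (\<lambda>e. X (Suc n) ^ e)"
  have geo: "geo * (1 - fps_const (X (Suc n)) * fps_X) = 1"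
  proof (rule fps_ext)
    fix j
    have "geo * (1 - fps_const (X (Suc n)) * fps_X) = geo - fps_const (X (Suc n)) * (fps_X * geo)"
      by (simp add: algebra_simps)
    thus "fps_nth (geo * (1 - fps_const (X (Suc n)) * fps_X)) j = fps_nth 1 j"
      by (cases j) (simp_all add: geo_def)
  qed
  have "geo = geo * (signed_elem n * (hh (Suc n) * (1 - fps_const (X (Suc n)) * fps_X)))" by (simp only: hh 1 mult_1_right)
  also have "\<dots> = (geo * (1 - fps_const (X (Suc n)) * fps_X)) * (signed_elem n * hh (Suc n))" by (simp only: mult_ac)
  finally have "geo = signed_elem n * hh (Suc n)" by (simp only: geo mult_1_left)
  from arg_cong[OF this, of "\<lambda>F. fps_nth F e"] show ?thesis
    by (simp add: geo_def hh_def fps_mult_nth atLeast0AtMost)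
qed

subsection \<open>Peeling off the last variable\<close>

text \<open>The coefficient of x_n^k in \<open>f\<close>, as a polynomial free of x_n.\<close>

definition slice :: "nat \<Rightarrow> nat \<Rightarrow> ipoly \<Rightarrow> ipoly" where
  "slice n k f = Abs_poly_mapping (\<lambda>d. if lookup d n = 0 then lookup f (d + single n k) else 0)"

lemma lookup_slice: "lookup (slice n k f) d = (if lookup d n = 0 then lookup f (d + single n k) else 0)"
proof -
  have "{d. (if lookup d n = 0 then lookup f (d + single n k) else 0) \<noteq> 0} \<subseteq> (\<lambda>e. e - single n k) ` keys f"
  proof
    fix d assume "d \<in> {d. (if lookup d n = 0 then lookup f (d + single n k) else 0) \<noteq> 0}"
    hence "d + single n k \<in> keys f" by (auto simp: in_keys_iff split: if_splits)
    thus "d \<in> (\<lambda>e. e - single n k) ` keys f" by (rule rev_image_eqI) simp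
  qed
  from finite_subset[OF this] show ?thesis by (simp add: slice_def)
qed

lemma slice_polys_in: assumes "f \<in> polys_in {1..Suc n}" shows "slice (Suc n) k f \<in> polys_in {1..n}"
  unfolding polys_in_def
proof clarify
  fix e j assume "e \<in> keys (slice (Suc n) k f)" and j: "j \<in> keys e"
  hence *: "lookup e (Suc n) = 0" "e + single (Suc n) k \<in> keys f"
    by (auto simp: in_keys_iff lookup_slice split: if_splits)
  have "j \<in> keys (e + single (Suc n) k)" using j by (simp add: in_keys_iff lookup_add)
  hence "j \<in> {1..Suc n}" using assms *(2) unfolding polys_in_def by blast
  moreover have "j \<noteq> Suc n" using * j by (auto simp: in_keys_iff)
  ultimately show "j \<in> {1..n}" by auto
qed

lemma slice_sum:
  assumes "\<And>e. e \<in> keys f \<Longrightarrow> lookup e n \<le> d"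
  shows "f = (\<Sum>e\<le>d. X n ^ e * slice n e f)"
proof (rule poly_mapping_eqI)
  fix t
  have "lookup (X n ^ e * slice n e f) t = (if e = lookup t n then lookup f t else 0)" for e
  proof -
    have "(\<forall>j. lookup (single n e) j \<le> lookup t j) \<longleftrightarrow> e \<le> lookup t n"
      by (auto simp: lookup_single when_def)
    moreover have "e = lookup t n \<Longrightarrow> t - single n e + single n e = t"
      by (rule poly_mapping_eqI) (auto simp: lookup_add minus_poly_mapping.rep_eq lookup_single when_def)
    ultimately show ?thesis
      unfolding X_power lookup_monom_mult lookup_slice by (auto simp: minus_poly_mapping.rep_eq)
  qed
  hence "lookup (\<Sum>e\<le>d. X n ^ e * slice n e f) t = (if lookup t n \<le> d then lookup f t else 0)"
    by (simp add: lookup_sum sum.delta)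
  thus "lookup f t = lookup (\<Sum>e\<le>d. X n ^ e * slice n e f) t"
    using assms[of t] by (auto simp: in_keys_iff)
qed

text \<open>A factor symmetric in x_1, .., x_m commutes with all divided differences that a
  permutation of {1..m} uses, and in the end only its constant term is seen.\<close>

lemma dual_fun_symmetric_mult:
  assumes "w \<in> S_infinity" "w permutes {1..m}" and sym: "\<And>i. 1 \<le> i \<Longrightarrow> i < m \<Longrightarrow> swap_vars i h = h"
  shows "dual_fun w (h * g) = lookup h 0 * dual_fun w g"
  using assms(1,2)
proof (induction arbitrary: g rule: S_infinity_descent_induct)
  case id
  show ?case unfolding dual_fun_id by (rule lookup_0_mult)
next
  case (descent w i)
  have i: "i < m" using descent_bound[OF descent.prems descent.hyps(3)] by simp
  show ?case
    unfolding dual_fun_descent[OF descent.hyps(1,3)] dd_symmetric_mult[OF sym[OF descent.hyps(2) i]]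
    by (rule descent.IH) (rule permutes_comp_s[OF descent.prems descent.hyps(2) i])
qed

text \<open>The entry \<open>k\<close> at position \<open>l\<close> moves right, losing 1 at each
  step, until it disappears. Each step applies \<open>dd l\<close>, which lowers the degree of the
  complete homogeneous factor and adjoins x_(l+1), while \<open>g\<close> involves only x_1, .., x_n
  and passes through.\<close>

lemma peel_chain:
  assumes "w \<in> S_infinity" "n < l" "\<And>i. n < i \<Longrightarrow> lehmer_code w i = (if i = l then k else 0)"
  shows "\<exists>w'\<in>S_infinity. (\<forall>i. lehmer_code w' i = (if i \<le> n then lehmer_code w i else 0)) \<and>
     (\<forall>j. \<forall>g\<in>polys_in {1..n}. dual_fun w (complete_hom l j * g) = (if j < k then 0 else dual_fun w' (complete_hom (l + k) (j - k) * g)))"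
  using assms
proof (induction k arbitrary: w l)
  case 0
  thus ?case by (intro bexI[of _ w]) auto
next
  case (Suc k)
  have desc: "w (Suc l) < w l" using descent_iff_code[OF Suc.prems(1)] Suc.prems(2,3) by simp
  have l: "1 \<le> l" using Suc.prems(2) by simp
  have v: "w \<circ> s l \<in> S_infinity" by (rule S_infinity_comp_s[OF Suc.prems(1) l])
  have code: "lehmer_code (w \<circ> s l) i = (if i = Suc l then k else 0)" if "n < i" for i
    unfolding lehmer_code_comp_s_descent[OF Suc.prems(1) desc] using Suc.prems(2,3) that by simp
  have code': "lehmer_code (w \<circ> s l) i = lehmer_code w i" if "i \<le> n" for i
    unfolding lehmer_code_comp_s_descent[OF Suc.prems(1) desc] using Suc.prems(2) that by simp
  have "n < Suc l" using Suc.prems(2) by simp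
  from Suc.IH[OF v this code] obtain w' where w': "w' \<in> S_infinity"
    "\<And>i. lehmer_code w' i = (if i \<le> n then lehmer_code (w \<circ> s l) i else 0)"
    "\<And>j g. g \<in> polys_in {1..n} \<Longrightarrow> dual_fun (w \<circ> s l) (complete_hom (Suc l) j * g) = (if j < k then 0 else dual_fun w' (complete_hom (Suc l + k) (j - k) * g))"
    by blast
  have "dual_fun w (complete_hom l j * g) = (if j < Suc k then 0 else dual_fun w' (complete_hom (l + Suc k) (j - Suc k) * g))"
    if g: "g \<in> polys_in {1..n}" for j g
  proof -
    have "swap_vars l g = g" by (rule polys_in_symmetric[OF _ _ g]) (use Suc.prems(2) in auto)
    hence "dd l (complete_hom l j * g) = g * dd l (complete_hom l j)"
      using dd_symmetric_mult by (metis mult.commute)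
    hence eq: "dual_fun w (complete_hom l j * g) = dual_fun (w \<circ> s l) (dd l (complete_hom l j) * g)"
      unfolding dual_fun_descent[OF Suc.prems(1) desc] by (simp only: mult.commute)
    show ?thesis
    proof (cases j)
      case 0
      thus ?thesis unfolding eq using dual_fun_0[OF v] by simp
    next
      case (Suc j')
      show ?thesis unfolding eq unfolding Suc dd_complete_hom[OF l] w'(3)[OF g] by simp
    qed
  qed
  moreover have "lehmer_code w' i = (if i \<le> n then lehmer_code w i else 0)" for i
    unfolding w'(2) by (simp add: code')
  ultimately show ?case using w'(1) by blast
qed

text \<open>The complete homogeneous polynomials that survive \<open>peel_chain\<close> are symmetric in all variables on which
  \<open>w'\<close> acts, so they pass through the functional of \<open>w'\<close> and contribute only their constant terms.\<close>

lemma peel: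
  assumes w: "w \<in> S_infinity" and z: "\<And>i. Suc n < i \<Longrightarrow> lehmer_code w i = 0"
    and le: "\<And>i. 1 \<le> i \<Longrightarrow> i \<le> n \<Longrightarrow> lehmer_code w i \<le> lehmer_code w (Suc n)"
  shows "\<exists>w'\<in>S_infinity. (\<forall>i. lehmer_code w' i = (if i \<le> n then lehmer_code w i else 0)) \<and>
     (\<forall>f\<in>polys_in {1..Suc n}. dual_fun w f =
        (\<Sum>r\<le>n. dual_fun w' (fps_nth (signed_elem n) r * slice (Suc n) (lehmer_code w (Suc n) + r) f)))"
proof -
  define k where "k = lehmer_code w (Suc n)"
  have "lehmer_code w i = (if i = Suc n then k else 0)" if "n < i" for i
    using z[of i] that by (auto simp: k_def)
  from peel_chain[OF w lessI this] obtain w' where w': "w' \<in> S_infinity"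
      and code: "\<And>i. lehmer_code w' i = (if i \<le> n then lehmer_code w i else 0)"
      and chain: "\<And>j g. g \<in> polys_in {1..n} \<Longrightarrow> dual_fun w (complete_hom (Suc n) j * g) = (if j < k then 0 else dual_fun w' (complete_hom (Suc n + k) (j - k) * g))"
    by blast
  \<comment> \<open>Maximality of the last entry enters here: c_i \<le> k \<le> n + 1 + k - i for i
    \<le> n.\<close>
  have perm: "w' permutes {1..Suc n + k}"
  proof (rule permutes_from_code[OF w'])
    fix i :: nat assume "1 \<le> i"
    thus "lehmer_code w' i \<le> Suc n + k - i" using le[of i] unfolding code k_def by (cases "i \<le> n") auto
  qed
  have coeff_k: "dual_fun w (complete_hom (Suc n) j * g) = (if j = k then dual_fun w' g else 0)" if g: "g \<in> polys_in {1..n}" for j g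
  proof -
    have "dual_fun w' (complete_hom (Suc n + k) i * g) = lookup (complete_hom (Suc n + k) i) 0 * dual_fun w' g" for i
      by (rule dual_fun_symmetric_mult[OF w' perm]) (rule swap_vars_complete_hom)
    thus ?thesis unfolding chain[OF g] lookup_complete_hom_0 by auto
  qed
  have "dual_fun w f = (\<Sum>r\<le>n. dual_fun w' (fps_nth (signed_elem n) r * slice (Suc n) (k + r) f))" if f: "f \<in> polys_in {1..Suc n}" for f
  proof -
    let ?g = "\<lambda>r e. fps_nth (signed_elem n) r * slice (Suc n) e f"
    have g: "?g r e \<in> polys_in {1..n}" for r e
      by (intro polys_in_mult signed_elem_nth_polys_in slice_polys_in f)
    have "finite ((\<lambda>e. lookup e (Suc n)) ` keys f)" by simp
    then obtain d0 where d0: "\<And>e. e \<in> keys f \<Longrightarrow> lookup e (Suc n) \<le> d0"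
      by (metis (no_types, lifting) finite_nat_set_iff_bounded_le image_eqI)
    \<comment> \<open>The degree bound is enlarged so that the summation range contains all of
      \<open>{k..k + n}\<close>.\<close>
    define d where "d = max d0 (k + n)"
    have d: "\<And>e. e \<in> keys f \<Longrightarrow> lookup e (Suc n) \<le> d" using d0 by (fastforce simp: d_def)
    have "f = (\<Sum>e\<le>d. X (Suc n) ^ e * slice (Suc n) e f)" by (rule slice_sum[OF d])
    also have "\<dots> = (\<Sum>e\<le>d. \<Sum>r\<le>e. complete_hom (Suc n) (e - r) * ?g r e)"
      unfolding X_power_complete_hom sum_distrib_right by (intro sum.cong refl) (simp only: mult_ac)
    finally have "dual_fun w f = dual_fun w (\<Sum>e\<le>d. \<Sum>r\<le>e. complete_hom (Suc n) (e - r) * ?g r e)" by (rule arg_cong)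
    also have "\<dots> = (\<Sum>e\<le>d. \<Sum>r\<le>e. if e - r = k then dual_fun w' (?g r e) else 0)"
      by (simp only: dual_fun_sum[OF w] coeff_k[OF g])
    also have "\<dots> = (\<Sum>e\<le>d. if k \<le> e then dual_fun w' (?g (e - k) e) else 0)"
    proof (intro sum.cong refl)
      fix e
      have "(\<Sum>r\<le>e. if e - r = k then dual_fun w' (?g r e) else 0) = (\<Sum>r\<le>e. if r = e - k \<and> k \<le> e then dual_fun w' (?g r e) else 0)"
        by (intro sum.cong refl if_cong) auto
      thus "(\<Sum>r\<le>e. if e - r = k then dual_fun w' (?g r e) else 0) = (if k \<le> e then dual_fun w' (?g (e - k) e) else 0)"
        by (cases "k \<le> e") (simp_all add: sum.delta)
    qed
    \<comment> \<open>\<open>signed_elem n\<close> has degree at most \<open>n\<close> in the series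
      variable, so only exponents with \<open>e - k \<le> n\<close> contribute.\<close>
    also have "\<dots> = (\<Sum>e\<in>{k..k + n}. if k \<le> e then dual_fun w' (?g (e - k) e) else 0)"
    proof (rule sum.mono_neutral_right)
      show "\<forall>e\<in>{..d} - {k..k + n}. (if k \<le> e then dual_fun w' (?g (e - k) e) else 0) = 0"
        using signed_elem_nth_0[of n] dual_fun_0[OF w'] by auto
    qed (auto simp: d_def)
    also have "\<dots> = (\<Sum>r\<le>n. dual_fun w' (?g r (k + r)))"
      by (rule sum.reindex_bij_witness[of _ "\<lambda>r. k + r" "\<lambda>e. e - k"]) auto
    finally show ?thesis .
  qed
  thus ?thesis using w' code unfolding k_def by blast
qed

subsection \<open>Coefficient arrays\<close>

definition exponent :: "nat \<Rightarrow> (nat \<Rightarrow> int) \<Rightarrow> (nat \<Rightarrow>\<^sub>0 nat)" where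
  "exponent n y = Abs_poly_mapping (\<lambda>i. if i \<in> {1..n} then nat (y i) else 0)"

lemma lookup_exponent: "lookup (exponent n y) i = (if i \<in> {1..n} then nat (y i) else 0)"
proof -
  have "finite {i. (if i \<in> {1..n} then nat (y i) else 0) \<noteq> 0}" by (rule finite_subset[of _ "{1..n}"]) auto
  thus ?thesis by (simp add: exponent_def)
qed

text \<open>Coefficients are extended by 0 to negative exponents, so that multiplication by a
  monomial becomes a translation of \<open>y\<close> without boundary cases.\<close>

definition coeff_array :: "nat \<Rightarrow> ipoly \<Rightarrow> (nat \<Rightarrow> int) \<Rightarrow> int" where
  "coeff_array n f y = (if \<forall>i\<in>{1..n}. 0 \<le> y i then lookup f (exponent n y) else 0)"

lemma coeff_array_cong: assumes "\<And>i. i \<in> {1..n} \<Longrightarrow> y i = y' i" shows "coeff_array n f y = coeff_array n f y'"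
proof -
  have "exponent n y = exponent n y'" by (rule poly_mapping_eqI) (simp add: lookup_exponent assms)
  thus ?thesis using assms by (simp add: coeff_array_def)
qed

lemma coeff_array_add: "coeff_array n (f + g) y = coeff_array n f y + coeff_array n g y"
  and coeff_array_diff: "coeff_array n (f - g) y = coeff_array n f y - coeff_array n g y"
  by (simp_all add: coeff_array_def lookup_add lookup_minus)

lemma coeff_array_const_mult: "coeff_array n (single 0 c * f) y = c * coeff_array n f y"
proof -
  have "lookup (single 0 c * f) e = c * lookup f e" for e
    by (induction f rule: poly_mapping_add_induct)
      (auto simp: mult_single lookup_single when_def distrib_left lookup_add)
  thus ?thesis by (simp add: coeff_array_def)
qed

lemma coeff_array_monom_mult:
  assumes "keys m \<subseteq> {1..n}" shows "coeff_array n (single m 1 * f) y = coeff_array n f (\<lambda>i. y i - int (lookup m i))"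
proof (cases "\<forall>i\<in>{1..n}. 0 \<le> y i")
  case True
  have m: "lookup m j = 0" if "j \<notin> {1..n}" for j using assms that by (meson in_keys_iff subsetD)
  have "(\<forall>j. lookup m j \<le> lookup (exponent n y) j) \<longleftrightarrow> (\<forall>i\<in>{1..n}. 0 \<le> y i - int (lookup m i))"
  proof (intro iffI allI ballI)
    fix i assume "\<forall>j. lookup m j \<le> lookup (exponent n y) j" "i \<in> {1..n}"
    hence "lookup m i \<le> nat (y i)" by (metis lookup_exponent)
    thus "0 \<le> y i - int (lookup m i)" using True \<open>i \<in> {1..n}\<close> by (metis diff_ge_0_iff_ge int_nat_eq of_nat_mono)
  next
    fix j assume *: "\<forall>i\<in>{1..n}. 0 \<le> y i - int (lookup m i)"
    show "lookup m j \<le> lookup (exponent n y) j"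
    proof (cases "j \<in> {1..n}")
      case True
      hence "int (lookup m j) \<le> y j" using * by (metis diff_ge_0_iff_ge)
      thus ?thesis unfolding lookup_exponent if_P[OF True] by linarith
    qed (simp add: m)
  qed
  moreover have "exponent n y - m = exponent n (\<lambda>i. y i - int (lookup m i))"
    by (rule poly_mapping_eqI) (auto simp: minus_poly_mapping.rep_eq lookup_exponent m)
  ultimately show ?thesis using True by (simp add: coeff_array_def lookup_monom_mult)
next
  case False
  hence "\<not> (\<forall>i\<in>{1..n}. 0 \<le> y i - int (lookup m i))" by (smt (verit) of_nat_0_le_iff)
  thus ?thesis using False by (simp only: coeff_array_def if_False)
qed

lemma coeff_array_X_mult: "i \<in> {1..n} \<Longrightarrow> coeff_array n (X i * f) y = coeff_array n f (y(i := y i - 1))"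
  unfolding X_def by (subst coeff_array_monom_mult) (auto intro!: coeff_array_cong simp: lookup_single when_def)

lemma coeff_array_swap_vars:
  assumes "i \<in> {1..n}" "Suc i \<in> {1..n}" shows "coeff_array n (swap_vars i f) y = coeff_array n f (\<lambda>j. y (s i j))"
proof -
  have s: "s i j \<in> {1..n} \<longleftrightarrow> j \<in> {1..n}" for j using assms by (auto simp: transpose_def)
  have "swap_exp i (exponent n y) = exponent n (\<lambda>j. y (s i j))"
    by (rule poly_mapping_eqI) (simp only: lookup_swap_exp lookup_exponent s)
  moreover have "(\<forall>j\<in>{1..n}. 0 \<le> y (s i j)) \<longleftrightarrow> (\<forall>j\<in>{1..n}. 0 \<le> y j)"
    using s by (metis s_simps(3))
  ultimately show ?thesis by (simp only: coeff_array_def lookup_swap_vars)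
qed

text \<open>Counterpart of \<open>lookup_dd_rec\<close>; its boundary case disappears because arrays
  vanish at negative exponents.\<close>

lemma coeff_array_dd_rec:
  assumes i: "i \<in> {1..n}" "Suc i \<in> {1..n}"
  shows "coeff_array n (dd i f) y = coeff_array n (dd i f) (y(i := y i + 1, Suc i := y (Suc i) - 1))
      + coeff_array n f (y(i := y i + 1)) - coeff_array n f (y(i := y (Suc i), Suc i := y i + 1))"
proof -
  let ?y = "y(i := y i + 1)"
  have "coeff_array n (simple_root i * dd i f) ?y = coeff_array n f ?y - coeff_array n (swap_vars i f) ?y"
    by (simp only: dd_spec coeff_array_diff)
  moreover have "coeff_array n (swap_vars i f) ?y = coeff_array n f (y(i := y (Suc i), Suc i := y i + 1))"
    unfolding coeff_array_swap_vars[OF i] by (rule coeff_array_cong) (simp add: transpose_def)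
  moreover have "coeff_array n (simple_root i * dd i f) ?y = coeff_array n (dd i f) y - coeff_array n (dd i f) (y(i := y i + 1, Suc i := y (Suc i) - 1))"
    unfolding simple_root_def left_diff_distrib coeff_array_diff coeff_array_X_mult[OF i(1)] coeff_array_X_mult[OF i(2)] by simp
  ultimately show ?thesis by simp
qed

text \<open>Iterating the recursion moves one unit at a time from x_(i+1) to x_i until the exponent
  of x_(i+1) is negative, where the array is 0. This is the source of the bounded summations over
  affine ranges.\<close>

lemma coeff_array_dd:
  assumes i: "i \<in> {1..n}" "Suc i \<in> {1..n}"
  shows "coeff_array n (dd i f) y = (\<Sum>k\<in>{0..y (Suc i)}.
      coeff_array n f (y(i := y i + 1 + k, Suc i := y (Suc i) - k)) - coeff_array n f (y(i := y (Suc i) - k, Suc i := y i + 1 + k)))"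
proof (induction "nat (y (Suc i) + 1)" arbitrary: y)
  case 0
  hence "y (Suc i) < 0" by simp
  hence "\<not> (\<forall>j\<in>{1..n}. 0 \<le> y j)" using i(2) by (meson not_le)
  hence "coeff_array n (dd i f) y = 0" unfolding coeff_array_def by (rule if_not_P)
  thus ?case using \<open>y (Suc i) < 0\<close> by simp
next
  case (Suc m)
  define T where "T = (\<lambda>y k. coeff_array n f (y(i := y i + 1 + k, Suc i := y (Suc i) - k)) - coeff_array n f (y(i := y (Suc i) - k, Suc i := y i + 1 + k)))"
  let ?y = "y(i := y i + 1, Suc i := y (Suc i) - 1)"
  have ge: "0 \<le> y (Suc i)" using Suc.hyps(2) by simp
  have shift: "T ?y k = T y (k + 1)" for k
    unfolding T_def by (intro arg_cong2[where f = "(-)"] coeff_array_cong) (auto simp: algebra_simps)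
  have "coeff_array n (dd i f) ?y = (\<Sum>k\<in>{0..y (Suc i) - 1}. T ?y k)"
    using Suc.hyps(1)[of ?y] Suc.hyps(2) unfolding T_def by simp
  also have "\<dots> = (\<Sum>k\<in>{1..y (Suc i)}. T y k)"
    by (rule sum.reindex_bij_witness[of _ "\<lambda>k. k - 1" "\<lambda>k. k + 1"]) (auto simp: shift)
  finally have "coeff_array n (dd i f) y = (\<Sum>k\<in>{1..y (Suc i)}. T y k) + T y 0"
    unfolding coeff_array_dd_rec[OF i, of f y] by (simp add: T_def fun_upd_idem[of y "Suc i"]) (metis fun_upd_triv fun_upd_twist n_not_Suc_n)
  moreover have "{0..y (Suc i)} = insert 0 {1..y (Suc i)}" using ge by auto
  ultimately show ?case unfolding T_def by simp
qed

lemma coeff_array_slice: "coeff_array n (slice (Suc n) k f) y = coeff_array (Suc n) f (y(Suc n := int k))"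
proof -
  have "exponent n y + single (Suc n) k = exponent (Suc n) (y(Suc n := int k))"
    by (rule poly_mapping_eqI) (auto simp: lookup_add lookup_exponent lookup_single when_def)
  moreover have "(\<forall>i\<in>{1..Suc n}. 0 \<le> (y(Suc n := int k)) i) \<longleftrightarrow> (\<forall>i\<in>{1..n}. 0 \<le> y i)"
    by (auto simp: le_Suc_eq)
  ultimately show ?thesis unfolding coeff_array_def lookup_slice by (simp add: lookup_exponent)
qed

lemma coeff_array_0: "coeff_array 0 f y = lookup f 0"
proof -
  have "exponent 0 y = 0" by (rule poly_mapping_eqI) (simp add: lookup_exponent)
  thus ?thesis by (simp add: coeff_array_def)
qed

text \<open>Coordinate \<open>0\<close> of \<open>y\<close> holds the parameter \<open>N\<close>, coordinates \<open>1..n\<close> the exponents; the remaining ones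
  serve as summation variables. Arrays vanish at negative exponents.\<close>

definition family :: "nat \<Rightarrow> (nat \<Rightarrow> ipoly) \<Rightarrow> bool" where
  "family n f \<longleftrightarrow> (\<exists>F. pw_quasi F \<and> (\<forall>\<^sub>F N in sequentially. f N \<in> polys_in {1..n} \<and>
     (\<forall>y. y 0 = int N \<longrightarrow> F y = of_int (coeff_array n (f N) y))))"

lemma familyI:
  assumes "pw_quasi F" "\<forall>\<^sub>F N in sequentially. f N \<in> polys_in {1..n} \<and> (\<forall>y. y 0 = int N \<longrightarrow> F y = of_int (coeff_array n (f N) y))"
  shows "family n f"
  using assms unfolding family_def by blast

lemma familyE:
  assumes "family n f"
  obtains F where "pw_quasi F" "\<forall>\<^sub>F N in sequentially. f N \<in> polys_in {1..n} \<and> (\<forall>y. y 0 = int N \<longrightarrow> F y = of_int (coeff_array n (f N) y))"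
  using assms unfolding family_def by blast

lemma family_cong:
  assumes "family n f" "\<forall>\<^sub>F N in sequentially. f N = g N" shows "family n g"
proof -
  obtain F where F: "pw_quasi F" "\<forall>\<^sub>F N in sequentially. f N \<in> polys_in {1..n} \<and> (\<forall>y. y 0 = int N \<longrightarrow> F y = of_int (coeff_array n (f N) y))"
    using familyE[OF assms(1)] by blast
  show ?thesis by (rule familyI[OF F(1)]) (use F(2) assms(2) in eventually_elim, simp)
qed

lemma family_add: assumes "family n f" "family n g" shows "family n (\<lambda>N. f N + g N)"
proof -
  obtain F where F: "pw_quasi F" "\<forall>\<^sub>F N in sequentially. f N \<in> polys_in {1..n} \<and> (\<forall>y. y 0 = int N \<longrightarrow> F y = of_int (coeff_array n (f N) y))"
    using familyE[OF assms(1)] by blast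
  obtain G where G: "pw_quasi G" "\<forall>\<^sub>F N in sequentially. g N \<in> polys_in {1..n} \<and> (\<forall>y. y 0 = int N \<longrightarrow> G y = of_int (coeff_array n (g N) y))"
    using familyE[OF assms(2)] by blast
  show ?thesis by (rule familyI[OF pw_quasi.add[OF F(1) G(1)]])
      (use F(2) G(2) in eventually_elim, simp add: coeff_array_add polys_in_add)
qed

lemma family_const_mult: assumes "family n f" shows "family n (\<lambda>N. single 0 c * f N)"
proof -
  obtain F where F: "pw_quasi F" "\<forall>\<^sub>F N in sequentially. f N \<in> polys_in {1..n} \<and> (\<forall>y. y 0 = int N \<longrightarrow> F y = of_int (coeff_array n (f N) y))"
    using familyE[OF assms(1)] by blast
  show ?thesis by (rule familyI[OF pw_quasi_mult[OF pw_quasi_const[of "of_int c"] F(1)]])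
      (use F(2) in eventually_elim, simp add: coeff_array_const_mult polys_in_mult)
qed

lemma family_one: "family n (\<lambda>N. 1)"
proof -
  define F :: "(nat \<Rightarrow> int) \<Rightarrow> rat" where "F y = (\<Prod>i\<in>{1..n}. of_bool (0 \<le> y i) * of_bool (0 \<le> - y i))" for y
  have "pw_quasi F" unfolding F_def
    by (intro pw_quasi_prod pw_quasi_mult pw_quasi_pw_basic[OF pw_basic.nonneg] affine_form.var affine_form_uminus)
  moreover have "F y = of_int (coeff_array n 1 y)" for y
  proof (cases "\<forall>i\<in>{1..n}. y i = 0")
    case True
    hence "exponent n y = 0" by (intro poly_mapping_eqI) (simp add: lookup_exponent)
    thus ?thesis using True by (simp add: F_def coeff_array_def)
  next
    case False
    then obtain i where i: "i \<in> {1..n}" "y i \<noteq> 0" by blast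
    have "F y = 0" unfolding F_def using i by (intro prod_zero) auto
    moreover have "coeff_array n 1 y = 0"
    proof (cases "\<forall>i\<in>{1..n}. 0 \<le> y i")
      case True
      hence "0 \<le> y i" using i(1) by blast
      hence "lookup (exponent n y) i \<noteq> 0" using i by (simp add: lookup_exponent)
      hence "exponent n y \<noteq> 0" by auto
      thus ?thesis by (simp add: coeff_array_def lookup_one)
    qed (auto simp: coeff_array_def)
    ultimately show ?thesis by simp
  qed
  ultimately show ?thesis by (intro familyI[of F]) auto
qed

text \<open>With the parameter in coordinate 0, a shift by exponents affine in \<open>N\<close> is
  an affine substitution in \<open>y\<close>.\<close>

lemma family_monom_mult:
  assumes "family n f"
    and m: "\<forall>\<^sub>F N in sequentially. keys (m N) \<subseteq> {1..n} \<and> (\<forall>i\<in>{1..n}. int (lookup (m N) i) = p i * int N + q i)"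
  shows "family n (\<lambda>N. single (m N) 1 * f N)"
proof -
  obtain F where F: "pw_quasi F" "\<forall>\<^sub>F N in sequentially. f N \<in> polys_in {1..n} \<and> (\<forall>y. y 0 = int N \<longrightarrow> F y = of_int (coeff_array n (f N) y))"
    using familyE[OF assms(1)] by blast
  define \<sigma> where "\<sigma> y i = (if i \<in> {1..n} then y i - (p i * y 0 + q i) else y i)" for y :: "nat \<Rightarrow> int" and i
  have "affine_form (\<lambda>y. \<sigma> y i)" for i
    by (cases "i \<in> {1..n}") (auto simp: \<sigma>_def intro!: affine_form.intros affine_form_diff)
  hence "pw_quasi (\<lambda>y. F (\<sigma> y))" by (rule pw_quasi_subst[OF F(1)])
  moreover have "\<forall>\<^sub>F N in sequentially. single (m N) 1 * f N \<in> polys_in {1..n} \<and>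
      (\<forall>y. y 0 = int N \<longrightarrow> F (\<sigma> y) = of_int (coeff_array n (single (m N) 1 * f N) y))"
    using F(2) m
  proof eventually_elim
    case (elim N)
    show ?case
    proof (intro conjI allI impI)
      show "single (m N) 1 * f N \<in> polys_in {1..n}" using elim by (intro polys_in_mult polys_in_single) auto
      fix y :: "nat \<Rightarrow> int" assume y: "y 0 = int N"
      have "F (\<sigma> y) = of_int (coeff_array n (f N) (\<sigma> y))" using elim y by (simp add: \<sigma>_def)
      also have "coeff_array n (f N) (\<sigma> y) = coeff_array n (f N) (\<lambda>i. y i - int (lookup (m N) i))"
        by (rule coeff_array_cong) (use elim y in \<open>simp add: \<sigma>_def\<close>)
      finally show "F (\<sigma> y) = of_int (coeff_array n (single (m N) 1 * f N) y)"
        using elim by (simp add: coeff_array_monom_mult)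
    qed
  qed
  ultimately show ?thesis by (rule familyI)
qed

lemma family_poly_mult:
  assumes "family n f" "g \<in> polys_in {1..n}" shows "family n (\<lambda>N. g * f N)"
proof -
  have "finite A \<Longrightarrow> A \<subseteq> keys g \<Longrightarrow> family n (\<lambda>N. (\<Sum>e\<in>A. single e (lookup g e)) * f N)" for A
  proof (induction A rule: finite_induct)
    case empty
    show ?case using family_const_mult[OF assms(1), of 0] by simp
  next
    case (insert e A)
    have "keys e \<subseteq> {1..n}" using insert.prems assms(2) by (auto simp: polys_in_def)
    hence "family n (\<lambda>N. single e 1 * f N)"
      by (intro family_monom_mult[OF assms(1), of "\<lambda>_. e" "\<lambda>_. 0" "\<lambda>i. int (lookup e i)"]) auto
    from family_const_mult[OF this, of "lookup g e"]
    have "family n (\<lambda>N. single e (lookup g e) * f N)"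
      by (simp add: mult_single flip: mult.assoc)
    from family_add[OF this insert.IH] show ?case using insert by (simp add: distrib_right)
  qed
  from this[OF finite_keys order_refl] show ?thesis by (simp flip: poly_mapping_sum_singles)
qed

lemma family_swap_vars:
  assumes "family n f" "i \<in> {1..n}" "Suc i \<in> {1..n}" shows "family n (\<lambda>N. swap_vars i (f N))"
proof -
  obtain F where F: "pw_quasi F" "\<forall>\<^sub>F N in sequentially. f N \<in> polys_in {1..n} \<and> (\<forall>y. y 0 = int N \<longrightarrow> F y = of_int (coeff_array n (f N) y))"
    using familyE[OF assms(1)] by blast
  have "pw_quasi (\<lambda>y. F (\<lambda>j. y (s i j)))" by (rule pw_quasi_subst[OF F(1)]) (rule affine_form.var)
  moreover have "\<forall>\<^sub>F N in sequentially. swap_vars i (f N) \<in> polys_in {1..n} \<and>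
      (\<forall>y. y 0 = int N \<longrightarrow> F (\<lambda>j. y (s i j)) = of_int (coeff_array n (swap_vars i (f N)) y))"
    using F(2)
  proof eventually_elim
    case (elim N)
    have "s i 0 = 0" using assms(2) by (simp add: s_other)
    thus ?case using elim coeff_array_swap_vars[OF assms(2,3)] polys_in_swap_vars[OF assms(2,3)] by simp
  qed
  ultimately show ?thesis by (rule familyI)
qed

lemma family_dd:
  assumes "family n f" and i: "i \<in> {1..n}" "Suc i \<in> {1..n}" shows "family n (\<lambda>N. dd i (f N))"
proof -
  obtain F where F: "pw_quasi F" "\<forall>\<^sub>F N in sequentially. f N \<in> polys_in {1..n} \<and> (\<forall>y. y 0 = int N \<longrightarrow> F y = of_int (coeff_array n (f N) y))"
    using familyE[OF assms(1)] by blast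
  \<comment> \<open>Arrays in \<open>n\<close> variables do not look at coordinate
    \<open>n + 1\<close>, so it can carry the summation variable.\<close>
  define z where "z = Suc n"
  have z: "z \<noteq> 0" "z \<noteq> i" "z \<noteq> Suc i" "z \<notin> {1..n}" using i by (auto simp: z_def)
  define \<sigma>1 where "\<sigma>1 y = y(i := y i + 1 + y z, Suc i := y (Suc i) - y z)" for y :: "nat \<Rightarrow> int"
  define \<sigma>2 where "\<sigma>2 y = y(i := y (Suc i) - y z, Suc i := y i + 1 + y z)" for y :: "nat \<Rightarrow> int"
  have 1: "affine_form (\<lambda>y. \<sigma>1 y j)" for j
    unfolding \<sigma>1_def by (cases "j = i"; cases "j = Suc i") (auto intro!: affine_form.intros affine_form_diff)
  have 2: "affine_form (\<lambda>y. \<sigma>2 y j)" for j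
    unfolding \<sigma>2_def by (cases "j = i"; cases "j = Suc i") (auto intro!: affine_form.intros affine_form_diff)
  define G where "G y = (\<Sum>k\<in>{0..y (Suc i)}. F (\<sigma>1 (y(z := k))) - F (\<sigma>2 (y(z := k))))" for y
  have "pw_quasi G" unfolding G_def
    by (rule pw_quasi_sum_upto[OF pw_quasi_diff[OF pw_quasi_subst[OF F(1) 1] pw_quasi_subst[OF F(1) 2]]]) (rule affine_form.var)
  moreover have "\<forall>\<^sub>F N in sequentially. dd i (f N) \<in> polys_in {1..n} \<and> (\<forall>y. y 0 = int N \<longrightarrow> G y = of_int (coeff_array n (dd i (f N)) y))"
    using F(2)
  proof eventually_elim
    case (elim N)
    show ?case
    proof (intro conjI allI impI)
      show "dd i (f N) \<in> polys_in {1..n}" using elim i by (intro polys_in_dd) auto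
      fix y :: "nat \<Rightarrow> int" assume y: "y 0 = int N"
      have "\<sigma>1 (y(z := k)) 0 = int N" "\<sigma>2 (y(z := k)) 0 = int N" for k
        using y z i by (auto simp: \<sigma>1_def \<sigma>2_def)
      hence "G y = (\<Sum>k\<in>{0..y (Suc i)}. of_int (coeff_array n (f N) (\<sigma>1 (y(z := k))) - coeff_array n (f N) (\<sigma>2 (y(z := k)))))"
        unfolding G_def using elim by simp
      also have "\<dots> = of_int (coeff_array n (dd i (f N)) y)"
        unfolding coeff_array_dd[OF i] of_int_sum
        by (intro sum.cong refl arg_cong[where f = of_int] arg_cong2[where f = "(-)"] coeff_array_cong)
          (use z in \<open>auto simp: \<sigma>1_def \<sigma>2_def\<close>)
      finally show "G y = of_int (coeff_array n (dd i (f N)) y)" .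
    qed
  qed
  ultimately show ?thesis by (rule familyI)
qed

lemma family_slice:
  assumes "family (Suc n) f" and k: "\<forall>\<^sub>F N in sequentially. int (k N) = p * int N + q"
  shows "family n (\<lambda>N. slice (Suc n) (k N) (f N))"
proof -
  obtain F where F: "pw_quasi F" "\<forall>\<^sub>F N in sequentially. f N \<in> polys_in {1..Suc n} \<and> (\<forall>y. y 0 = int N \<longrightarrow> F y = of_int (coeff_array (Suc n) (f N) y))"
    using familyE[OF assms(1)] by blast
  have "pw_quasi (\<lambda>y. F (y(Suc n := p * y 0 + q)))"
    by (rule pw_quasi_subst[OF F(1)]) (intro affine_form_fun_upd_var affine_form.intros)
  moreover have "\<forall>\<^sub>F N in sequentially. slice (Suc n) (k N) (f N) \<in> polys_in {1..n} \<and>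
     (\<forall>y. y 0 = int N \<longrightarrow> F (y(Suc n := p * y 0 + q)) = of_int (coeff_array n (slice (Suc n) (k N) (f N)) y))"
    using F(2) k by eventually_elim (rule conjI, rule slice_polys_in, blast, simp add: coeff_array_slice)
  ultimately show ?thesis by (rule familyI)
qed

subsection \<open>Permutations with affine codes\<close>

definition affine_code :: "nat \<Rightarrow> (nat \<Rightarrow> int) \<Rightarrow> (nat \<Rightarrow> int) \<Rightarrow> (nat \<Rightarrow> nat \<Rightarrow> nat) \<Rightarrow> bool" where
  "affine_code n p q w \<longleftrightarrow> (\<forall>\<^sub>F N in sequentially. w N \<in> S_infinity \<and>
     (\<forall>i\<ge>1. int (lehmer_code (w N) i) = (if i \<le> n then p i * int N + q i else 0)))"

text \<open>This dichotomy makes the course of both sortings independent of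
  \<open>N\<close>.\<close>

lemma affine_compare:
  fixes p q :: "nat \<Rightarrow> int"
  obtains "\<forall>\<^sub>F N in sequentially. p i * int N + q i \<le> p j * int N + q j"
  | "\<forall>\<^sub>F N in sequentially. p j * int N + q j < p i * int N + q i"
proof -
  have eq: "0 \<le> (p j - p i) * int N + (q j - q i) \<longleftrightarrow> p i * int N + q i \<le> p j * int N + q j"
    "(p j - p i) * int N + (q j - q i) < 0 \<longleftrightarrow> p j * int N + q j < p i * int N + q i" for N
    by (auto simp: left_diff_distrib)
  show ?thesis using affine_eventually_nonneg[of "p j - p i" "q j - q i"] that unfolding eq by blast
qed

lemma affine_code_ascent:
  assumes w: "affine_code n p q w" and i: "1 \<le> i" "i < n"
    and lt: "\<forall>\<^sub>F N in sequentially. p i * int N + q i \<le> p (Suc i) * int N + q (Suc i)"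
  shows "affine_code n (p(i := p (Suc i), Suc i := p i)) (q(i := q (Suc i) + 1, Suc i := q i)) (\<lambda>N. w N \<circ> s i)"
    and "\<forall>\<^sub>F N in sequentially. w N \<in> S_infinity \<and> w N i < w N (Suc i)"
proof -
  have *: "\<forall>\<^sub>F N in sequentially. w N \<in> S_infinity \<and> w N i < w N (Suc i) \<and>
     (\<forall>j\<ge>1. int (lehmer_code (w N) j) = (if j \<le> n then p j * int N + q j else 0))"
    using w[unfolded affine_code_def] lt
  proof eventually_elim
    case (elim N)
    hence "int (lehmer_code (w N) i) \<le> int (lehmer_code (w N) (Suc i))" using i by simp
    hence "lehmer_code (w N) i \<le> lehmer_code (w N) (Suc i)" by simp
    thus ?case using elim ascent_iff_code by blast
  qed
  thus "\<forall>\<^sub>F N in sequentially. w N \<in> S_infinity \<and> w N i < w N (Suc i)" by eventually_elim simp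
  show "affine_code n (p(i := p (Suc i), Suc i := p i)) (q(i := q (Suc i) + 1, Suc i := q i)) (\<lambda>N. w N \<circ> s i)"
    unfolding affine_code_def using *
  proof eventually_elim
    case (elim N)
    hence code: "lehmer_code (w N \<circ> s i) = (lehmer_code (w N))(i := Suc (lehmer_code (w N) (Suc i)), Suc i := lehmer_code (w N) i)"
      by (intro lehmer_code_comp_s) auto
    show ?case unfolding code using elim S_infinity_comp_s[OF _ i(1)] i by auto
  qed
qed

lemma affine_code_descent:
  assumes w: "affine_code n p q w" and i: "1 \<le> i" "i < n"
    and lt: "\<forall>\<^sub>F N in sequentially. p (Suc i) * int N + q (Suc i) < p i * int N + q i"
  shows "affine_code n (p(i := p (Suc i), Suc i := p i)) (q(i := q (Suc i), Suc i := q i - 1)) (\<lambda>N. w N \<circ> s i)"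
    and "\<forall>\<^sub>F N in sequentially. w N \<in> S_infinity \<and> w N (Suc i) < w N i"
proof -
  have *: "\<forall>\<^sub>F N in sequentially. w N \<in> S_infinity \<and> w N (Suc i) < w N i \<and>
     (\<forall>j\<ge>1. int (lehmer_code (w N) j) = (if j \<le> n then p j * int N + q j else 0))"
    using w[unfolded affine_code_def] lt
  proof eventually_elim
    case (elim N)
    hence "int (lehmer_code (w N) (Suc i)) < int (lehmer_code (w N) i)" using i by simp
    hence "lehmer_code (w N) (Suc i) < lehmer_code (w N) i" by simp
    thus ?case using elim descent_iff_code by blast
  qed
  thus "\<forall>\<^sub>F N in sequentially. w N \<in> S_infinity \<and> w N (Suc i) < w N i" by eventually_elim simp
  show "affine_code n (p(i := p (Suc i), Suc i := p i)) (q(i := q (Suc i), Suc i := q i - 1)) (\<lambda>N. w N \<circ> s i)"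
    unfolding affine_code_def using *
  proof eventually_elim
    case (elim N)
    hence code: "lehmer_code (w N \<circ> s i) = (lehmer_code (w N))(i := lehmer_code (w N) (Suc i), Suc i := lehmer_code (w N) i - 1)"
      by (intro lehmer_code_comp_s_descent) auto
    \<comment> \<open>The strict comparison makes the entry positive, so subtracting 1 in the
      naturals agrees with subtracting 1 in the integers.\<close>
    have "lehmer_code (w N) (Suc i) < lehmer_code (w N) i" using elim descent_iff_code by blast
    thus ?case unfolding code using elim S_infinity_comp_s[OF _ i(1)] i by (auto simp: of_nat_diff)
  qed
qed

text \<open>Multiplying by a divided difference is reduced to applying one, so no convolution of arrays is needed.\<close>

lemma family_mult_dd:
  assumes mult: "\<And>f. family n f \<Longrightarrow> family n (\<lambda>N. f N * h N)"
    and i: "i \<in> {1..n}" "Suc i \<in> {1..n}" and f: "family n f"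
  shows "family n (\<lambda>N. f N * dd i (h N))"
proof -
  have "f N * dd i (h N) = dd i (swap_vars i (f N) * h N) + dd i (f N) * h N" for N
    by (simp add: dd_Leibniz dd_swap_vars)
  moreover have "family n (\<lambda>N. dd i (swap_vars i (f N) * h N) + dd i (f N) * h N)"
    by (intro family_add family_dd mult family_swap_vars f i)
  ultimately show ?thesis by simp
qed

text \<open>The Schubert polynomial is here the monomial of the code, whose exponents are affine in
  \<open>N\<close>.\<close>

lemma family_mult_dominant:
  assumes w: "affine_code n p q w" and f: "family n f"
    and dec: "\<And>i. 1 \<le> i \<Longrightarrow> i < n \<Longrightarrow> \<forall>\<^sub>F N in sequentially. p (Suc i) * int N + q (Suc i) \<le> p i * int N + q i"
  shows "family n (\<lambda>N. f N * schubert (w N))"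
proof -
  have "\<forall>\<^sub>F N in sequentially. \<forall>i\<in>{1..<n}. p (Suc i) * int N + q (Suc i) \<le> p i * int N + q i"
    by (intro eventually_ball_finite ballI dec) auto
  with w[unfolded affine_code_def]
  have ev: "\<forall>\<^sub>F N in sequentially. w N \<in> S_infinity \<and> dominant (w N) \<and>
     (\<forall>i\<ge>1. int (lehmer_code (w N) i) = (if i \<le> n then p i * int N + q i else 0))"
  proof eventually_elim
    case (elim N)
    have "lehmer_code (w N) (Suc i) \<le> lehmer_code (w N) i" if "1 \<le> i" for i
    proof (cases "i < n")
      case True
      hence "int (lehmer_code (w N) (Suc i)) \<le> int (lehmer_code (w N) i)" using elim that by simp
      thus ?thesis by simp
    next
      case False
      hence "int (lehmer_code (w N) (Suc i)) = 0" using elim that by simp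
      thus ?thesis by simp
    qed
    thus ?case using elim by (simp add: dominant_def)
  qed
  have "\<forall>\<^sub>F N in sequentially. keys (Abs_poly_mapping (lehmer_code (w N))) \<subseteq> {1..n} \<and>
      (\<forall>i\<in>{1..n}. int (lookup (Abs_poly_mapping (lehmer_code (w N))) i) = p i * int N + q i)"
    using ev
  proof eventually_elim
    case (elim N)
    hence wN: "w N \<in> S_infinity" by simp
    have zero: "lehmer_code (w N) i = 0" if "i \<notin> {1..n}" for i
    proof (cases "i = 0")
      case True thus ?thesis using lehmer_code_zero[OF wN] by simp
    next
      case False
      hence "int (lehmer_code (w N) i) = 0" using elim that by auto
      thus ?thesis by simp
    qed
    have "keys (Abs_poly_mapping (lehmer_code (w N))) \<subseteq> {1..n}"
    proof
      fix j assume "j \<in> keys (Abs_poly_mapping (lehmer_code (w N)))"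
      hence "lehmer_code (w N) j \<noteq> 0" by (simp add: in_keys_iff lookup_code[OF wN])
      thus "j \<in> {1..n}" using zero[of j] by argo
    qed
    moreover have "\<forall>i\<in>{1..n}. int (lehmer_code (w N) i) = p i * int N + q i" using elim by simp
    ultimately show ?case unfolding lookup_code[OF wN] by (rule conjI)
  qed
  from family_monom_mult[OF f this]
  show ?thesis
  proof (rule family_cong)
    show "\<forall>\<^sub>F N in sequentially. single (Abs_poly_mapping (lehmer_code (w N))) 1 * f N = f N * schubert (w N)"
      using ev
    proof eventually_elim
      case (elim N)
      hence "schubert (w N) = code_monomial (w N)" by (intro schubert_dominant) auto
      thus ?case by (simp only: code_monomial_def mult.commute)
    qed
  qed
qed

text \<open>Ascending steps increase the inversions among the first \<open>n\<close> positions,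
  which never exceed \<open>n * n\<close>; the auxiliary \<open>k\<close> bounds the number of steps
  still possible. Each step exhibits the Schubert polynomial as a divided difference, to which
  \<open>family_mult_dd\<close> applies.\<close>

lemma family_mult_schubert:
  assumes "affine_code n p q w" "family n f" shows "family n (\<lambda>N. f N * schubert (w N))"
proof -
  have "\<forall>\<^sub>F N in sequentially. n * n < inv_upto n (w N) + k \<Longrightarrow> affine_code n p q w \<Longrightarrow> family n f
     \<Longrightarrow> family n (\<lambda>N. f N * schubert (w N))" for k p q w f
  proof (induction k arbitrary: p q w f)
    case 0
    \<comment> \<open>For \<open>k = 0\<close> the hypothesis asks for more than
      \<open>n * n\<close> inversions, which is impossible.\<close>
    from 0(1) have "\<forall>\<^sub>F N in sequentially. False" by (rule eventually_mono) (use inv_upto_le[of n] in \<open>simp add: not_less[symmetric]\<close>)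
    thus ?case by simp
  next
    case (Suc k)
    show ?case
    proof (cases "\<exists>i. 1 \<le> i \<and> i < n \<and> (\<forall>\<^sub>F N in sequentially. p i * int N + q i < p (Suc i) * int N + q (Suc i))")
      case True
      then obtain i where i: "1 \<le> i" "i < n"
        and less: "\<forall>\<^sub>F N in sequentially. p i * int N + q i < p (Suc i) * int N + q (Suc i)" by blast
      have lt: "\<forall>\<^sub>F N in sequentially. p i * int N + q i \<le> p (Suc i) * int N + q (Suc i)"
        by (rule eventually_mono[OF less]) simp
      note asc = affine_code_ascent[OF Suc.prems(2) i lt]
      have "\<forall>\<^sub>F N in sequentially. n * n < inv_upto n (w N \<circ> s i) + k"
        using Suc.prems(1) asc(2)
      proof eventually_elim
        case (elim N)
        have "inv_upto n (w N \<circ> s i) = Suc (inv_upto n (w N))"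
          using elim by (intro inv_upto_comp_s[OF i]) simp
        thus ?case using elim by simp
      qed
      note IH = Suc.IH[OF this asc(1)]
      have "family n (\<lambda>N. f N * dd i (schubert (w N \<circ> s i)))"
        by (rule family_mult_dd[OF IH _ _ Suc.prems(3)]) (use i in auto)
      thus ?thesis
      proof (rule family_cong)
        show "\<forall>\<^sub>F N in sequentially. f N * dd i (schubert (w N \<circ> s i)) = f N * schubert (w N)"
          using asc(2)
        proof eventually_elim
          case (elim N)
          hence "schubert (w N) = dd i (schubert (w N \<circ> s i))" by (intro schubert_ascent i) auto
          thus ?case by (simp only:)
        qed
      qed
    next
      case False
      have "\<forall>\<^sub>F N in sequentially. p (Suc i) * int N + q (Suc i) \<le> p i * int N + q i" if "1 \<le> i" "i < n" for i
        using affine_compare[where p = p and q = q and i = "Suc i" and j = i] False that by blast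
      from family_mult_dominant[OF Suc.prems(2,3) this] show ?thesis by blast
    qed
  qed
  from this[where k = "Suc (n * n)", OF _ assms] show ?thesis by simp
qed

lemma quasi_poly_sum: "(\<And>i. i \<in> A \<Longrightarrow> quasi_poly (f i)) \<Longrightarrow> quasi_poly (\<lambda>N. \<Sum>i\<in>A. f i N)"
  by (induction A rule: infinite_finite_induct) (auto intro: quasi_poly_const quasi_poly_add)

text \<open>With no code entries left the permutation is the identity and the functional is the
  constant term.\<close>

lemma quasi_poly_dual_fun_0:
  assumes w: "affine_code 0 p q w" and f: "family 0 f"
  shows "quasi_poly (\<lambda>N. of_int (dual_fun (w N) (f N)))"
proof -
  obtain F where F: "pw_quasi F" "\<forall>\<^sub>F N in sequentially. f N \<in> polys_in {1..0} \<and> (\<forall>y. y 0 = int N \<longrightarrow> F y = of_int (coeff_array 0 (f N) y))"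
    using familyE[OF f] by blast
  have "\<forall>\<^sub>F N in sequentially. F (time_env N) = of_int (dual_fun (w N) (f N))"
    using w[unfolded affine_code_def] F(2)
  proof eventually_elim
    case (elim N)
    have "lehmer_code (w N) i = lehmer_code id i" for i
      using elim lehmer_code_zero[of "w N"] by (cases i) auto
    hence "w N = id" using lehmer_code_inj[of "w N" id] elim by auto
    moreover have "time_env N 0 = int N" by (simp add: time_env_def)
    ultimately show ?case using elim unfolding coeff_array_0 by (metis dual_fun_id)
  qed
  from quasi_poly_cong[OF quasi_poly_pw_quasi[OF F(1)] this] show ?thesis .
qed

text \<open>Outer induction on the number of variables, inner induction on the inversions among the
  first n + 1 positions. Descents are moved onto the argument as divided differences until the code
  is weakly increasing; then \<open>peel\<close> removes a variable.\<close>

lemma quasi_poly_dual_fun: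
  assumes "affine_code n p q w" "family n f"
  shows "quasi_poly (\<lambda>N. of_int (dual_fun (w N) (f N)))"
  using assms
proof (induction n arbitrary: p q w f)
  case 0
  thus ?case by (rule quasi_poly_dual_fun_0)
next
  case (Suc n)
  have "\<forall>\<^sub>F N in sequentially. inv_upto (Suc n) (w N) < k \<Longrightarrow> affine_code (Suc n) p q w \<Longrightarrow> family (Suc n) f
     \<Longrightarrow> quasi_poly (\<lambda>N. of_int (dual_fun (w N) (f N)))" for k p q w f
  proof (induction k arbitrary: p q w f)
    case 0
    thus ?case by simp
  next
    case (Suc k)
    note affine = Suc.prems(2) and fam = Suc.prems(3)
    show ?case
    proof (cases "\<exists>i. 1 \<le> i \<and> i < Suc n \<and> (\<forall>\<^sub>F N in sequentially. p (Suc i) * int N + q (Suc i) < p i * int N + q i)")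
      case True
      then obtain i where i: "1 \<le> i" "i < Suc n"
        and lt: "\<forall>\<^sub>F N in sequentially. p (Suc i) * int N + q (Suc i) < p i * int N + q i" by blast
      note desc = affine_code_descent[OF affine i lt]
      have fewer: "\<forall>\<^sub>F N in sequentially. inv_upto (Suc n) (w N \<circ> s i) < k"
        using Suc.prems(1) desc(2)
      proof eventually_elim
        case (elim N)
        have "inv_upto (Suc n) (w N \<circ> s i \<circ> s i) = Suc (inv_upto (Suc n) (w N \<circ> s i))"
          using elim by (intro inv_upto_comp_s[OF i]) simp
        thus ?case using elim unfolding comp_s_cancel by simp
      qed
      have "family (Suc n) (\<lambda>N. dd i (f N))" by (rule family_dd[OF fam]) (use i in auto)
      from Suc.IH[OF fewer desc(1) this] have "quasi_poly (\<lambda>N. of_int (dual_fun (w N \<circ> s i) (dd i (f N))))" .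
      moreover have "\<forall>\<^sub>F N in sequentially. (of_int (dual_fun (w N \<circ> s i) (dd i (f N))) :: rat) = of_int (dual_fun (w N) (f N))"
        using desc(2)
      proof eventually_elim
        case (elim N)
        hence "dual_fun (w N) (f N) = dual_fun (w N \<circ> s i) (dd i (f N))" by (intro dual_fun_descent) auto
        thus ?case by (simp only:)
      qed
      ultimately show ?thesis by (rule quasi_poly_cong)
    next
      case False
      have inc: "\<forall>\<^sub>F N in sequentially. p i * int N + q i \<le> p (Suc i) * int N + q (Suc i)" if "i \<in> {1..n}" for i
        using affine_compare[where p = p and q = q and i = i and j = "Suc i"] False that by fastforce
      have "\<forall>\<^sub>F N in sequentially. \<forall>i\<in>{1..n}. p i * int N + q i \<le> p (Suc i) * int N + q (Suc i)"
        by (intro eventually_ball_finite ballI inc) auto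
      with affine[unfolded affine_code_def]
      have ev: "\<forall>\<^sub>F N in sequentially. w N \<in> S_infinity \<and> (\<forall>i>Suc n. lehmer_code (w N) i = 0) \<and>
         (\<forall>i. 1 \<le> i \<and> i \<le> n \<longrightarrow> lehmer_code (w N) i \<le> lehmer_code (w N) (Suc n)) \<and>
         (\<forall>i\<ge>1. int (lehmer_code (w N) i) = (if i \<le> Suc n then p i * int N + q i else 0))"
      proof eventually_elim
        case (elim N)
        have step: "lehmer_code (w N) i \<le> lehmer_code (w N) (Suc i)" if "1 \<le> i" "i < Suc n" for i
        proof -
          have "int (lehmer_code (w N) i) \<le> int (lehmer_code (w N) (Suc i))" using elim that by simp
          thus ?thesis by simp
        qed
        have "lehmer_code (w N) i \<le> lehmer_code (w N) (Suc n)" if "1 \<le> i" "i \<le> Suc n" for i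
          using that(2,1) by (induction rule: inc_induct) (use step le_trans in \<open>auto intro: le_trans[OF step]\<close>)
        moreover have "lehmer_code (w N) i = 0" if "Suc n < i" for i
        proof -
          have "int (lehmer_code (w N) i) = 0" using elim that by simp
          thus ?thesis by simp
        qed
        ultimately show ?case using elim by simp
      qed
      define Q where "Q N w' \<longleftrightarrow> w' \<in> S_infinity \<and> (\<forall>i. lehmer_code w' i = (if i \<le> n then lehmer_code (w N) i else 0)) \<and>
         (\<forall>f\<in>polys_in {1..Suc n}. dual_fun (w N) f =
          (\<Sum>r\<le>n. dual_fun w' (fps_nth (signed_elem n) r * slice (Suc n) (lehmer_code (w N) (Suc n) + r) f)))" for N w'
      \<comment> \<open>\<open>peel\<close> gives a permutation for each large \<open>N\<close>
        separately; choice turns these into a family, whose codes are the first \<open>n\<close>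
        entries of those of \<open>w N\<close> and hence affine again.\<close>
      define w' where "w' N = (SOME w'. Q N w')" for N
      have Q: "\<forall>\<^sub>F N in sequentially. Q N (w' N)"
        using ev
      proof eventually_elim
        case (elim N)
        have "\<exists>w'. Q N w'" using peel[of "w N" n] elim unfolding Q_def by blast
        thus ?case unfolding w'_def by (rule someI_ex)
      qed
      have "affine_code n p q w'" unfolding affine_code_def
        using Q ev by eventually_elim (auto simp: Q_def)
      moreover have "family n (\<lambda>N. fps_nth (signed_elem n) r * slice (Suc n) (lehmer_code (w N) (Suc n) + r) (f N))" for r
      proof (rule family_poly_mult[OF family_slice[OF fam] signed_elem_nth_polys_in])
        show "\<forall>\<^sub>F N in sequentially. int (lehmer_code (w N) (Suc n) + r) = p (Suc n) * int N + (q (Suc n) + int r)"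
          using ev by eventually_elim simp
      qed
      ultimately have "quasi_poly (\<lambda>N. \<Sum>r\<le>n. of_int (dual_fun (w' N) (fps_nth (signed_elem n) r * slice (Suc n) (lehmer_code (w N) (Suc n) + r) (f N))))"
        using \<open>\<And>w q p f. \<lbrakk>affine_code n p q w; family n f\<rbrakk> \<Longrightarrow> quasi_poly (\<lambda>N. rat_of_int (dual_fun (w N) (f N)))\<close>
        by (intro quasi_poly_sum) blast
      moreover have "\<forall>\<^sub>F N in sequentially. f N \<in> polys_in {1..Suc n}"
        using fam unfolding family_def by (auto elim: eventually_mono)
      with Q have "\<forall>\<^sub>F N in sequentially. (\<Sum>r\<le>n. of_int (dual_fun (w' N) (fps_nth (signed_elem n) r * slice (Suc n) (lehmer_code (w N) (Suc n) + r) (f N)))) =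
          (of_int (dual_fun (w N) (f N)) :: rat)"
        by eventually_elim (simp add: Q_def)
      ultimately show ?thesis by (rule quasi_poly_cong)
    qed
  qed
  moreover have "\<forall>\<^sub>F N in sequentially. inv_upto (Suc n) (w N) < Suc (Suc n * Suc n)"
    using inv_upto_le[of "Suc n"] by (simp add: less_Suc_eq_le del: mult_Suc mult_Suc_right)
  ultimately show ?case using Suc.prems by blast
qed

lemma affine_code_stretch:
  assumes w: "w permutes {1..n}"
  shows "affine_code n (\<lambda>i. int (lehmer_code w i)) (\<lambda>i. 0) (\<lambda>N. stretch n N w)"
  unfolding affine_code_def
  using eventually_ge_at_top[of 1]
  by eventually_elim (simp add: stretch[OF w] mult.commute)

theorem theorem1p1:
  fixes n :: nat and u v w :: "nat \<Rightarrow> nat"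
  assumes "u permutes {1..n}" and "v permutes {1..n}" and "w permutes {1..n}"
  shows "is_rational_fps (Abs_fps (\<lambda>N. if N = 0 then 0 else
             (of_int (schubert_coeff (stretch n N u) (stretch n N v) (stretch n N w)) :: rat)))
       \<and> eventually_quasi_polynomial
           (\<lambda>N. schubert_coeff (stretch n N u) (stretch n N v) (stretch n N w))"
proof -
  let ?c = "\<lambda>N. schubert_coeff (stretch n N u) (stretch n N v) (stretch n N w)"
  \<comment> \<open>The product is built from the constant family 1, one Schubert polynomial at a
    time.\<close>
  have "family n (\<lambda>N. 1 * schubert (stretch n N u) * schubert (stretch n N v))"
    by (rule family_mult_schubert[OF affine_code_stretch[OF assms(2)]
      family_mult_schubert[OF affine_code_stretch[OF assms(1)] family_one]])
  from quasi_poly_dual_fun[OF affine_code_stretch[OF assms(3)] this]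
  have "quasi_poly (\<lambda>N. of_int (dual_fun (stretch n N w) (schubert (stretch n N u) * schubert (stretch n N v))))" by simp
  moreover have "\<forall>\<^sub>F N in sequentially. (of_int (dual_fun (stretch n N w) (schubert (stretch n N u) * schubert (stretch n N v))) :: rat) = of_int (?c N)"
    using eventually_ge_at_top[of 1]
  proof eventually_elim
    case (elim N)
    have "?c N = dual_fun (stretch n N w) (schubert (stretch n N u) * schubert (stretch n N v))"
      by (intro schubert_coeff_eq_dual_fun stretch(1) assms elim)
    thus ?case by (simp only:)
  qed
  ultimately have c: "quasi_poly (\<lambda>N. of_int (?c N))" by (rule quasi_poly_cong)
  \<comment> \<open>The generating function starts at N = 1, so its constant term is reset to 0;
    this does not affect the behaviour for large \<open>N\<close>.\<close>
  have "\<forall>\<^sub>F N in sequentially. (of_int (?c N) :: rat) = (if N = 0 then 0 else of_int (?c N))"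
    using eventually_ge_at_top[of 1] by eventually_elim simp
  from quasi_poly_imp_rational[OF quasi_poly_cong[OF c this]] quasi_poly_imp_eventually_quasi_polynomial[OF c] show ?thesis by blast
qed

end
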